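(* Let $a$ be a positive integer with $a\equiv 3\pmod 6$ and $a<100$. Let $m$ be a nonnegative integer such that $m$ is odd if $a\equiv 3\pmod{12}$ and $m$ is even if $a\equiv 9\pmod{12}$. Then there exists a $\mathrm{TOC}_3(3^m a,5,3)$ if $a\notin\{57,87,93\}$, and there exists a $\mathrm{TOC}_3(3^m a+1,5,3)$ if $a\notin\{51,69,75\}$.
   Context: $\mathcal{H}_q(n,w)$ is the set of all words of length $n$ over $\mathbb{Z}_q$ with exactly $w$ nonzero entries, with the Hamming distance. An $(n,d,w)_q$-code is a nonempty subset of $\mathcal{H}_q(n,w)$ in which any two distinct words have Hamming distance at least $d$; $A_q(n,d,w)$ is the maximum size of such a code and a code of this size is optimal. A $\mathrm{TOC}_q(n,d,w)$ is a partition of $\mathcal{H}_q(n,w)$ into mutually disjoint optimal $(n,d,w)_q$-codes. *)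

theory Defs
  imports Main
begin

definition words :: "nat \<Rightarrow> nat \<Rightarrow> (nat \<Rightarrow> nat) set" where
  "words q n = {x. (\<forall>i<n. x i < q) \<and> (\<forall>i\<ge>n. x i = 0)}"

definition hamming_dist :: "nat \<Rightarrow> (nat \<Rightarrow> nat) \<Rightarrow> (nat \<Rightarrow> nat) \<Rightarrow> nat" where
  "hamming_dist n x y = card {i. i < n \<and> x i \<noteq> y i}"

definition weight :: "nat \<Rightarrow> (nat \<Rightarrow> nat) \<Rightarrow> nat" where
  "weight n x = card {i. i < n \<and> x i \<noteq> 0}"

definition H :: "nat \<Rightarrow> nat \<Rightarrow> nat \<Rightarrow> (nat \<Rightarrow> nat) set" where
  "H q n w = {x \<in> words q n. weight n x = w}"

definition is_code :: "nat \<Rightarrow> nat \<Rightarrow> nat \<Rightarrow> nat \<Rightarrow> (nat \<Rightarrow> nat) set \<Rightarrow> bool" where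
  "is_code q n d w C \<longleftrightarrow> C \<noteq> {} \<and> C \<subseteq> H q n w \<and>
     (\<forall>x\<in>C. \<forall>y\<in>C. x \<noteq> y \<longrightarrow> hamming_dist n x y \<ge> d)"

definition A :: "nat \<Rightarrow> nat \<Rightarrow> nat \<Rightarrow> nat \<Rightarrow> nat" where
  "A q n d w = Max {card C | C. is_code q n d w C}"

definition optimal_code :: "nat \<Rightarrow> nat \<Rightarrow> nat \<Rightarrow> nat \<Rightarrow> (nat \<Rightarrow> nat) set \<Rightarrow> bool" where
  "optimal_code q n d w C \<longleftrightarrow> is_code q n d w C \<and> card C = A q n d w"

definition is_TOC :: "nat \<Rightarrow> nat \<Rightarrow> nat \<Rightarrow> nat \<Rightarrow> (nat \<Rightarrow> nat) set set \<Rightarrow> bool" where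
  "is_TOC q n d w P \<longleftrightarrow> \<Union>P = H q n w \<and>
     (\<forall>C\<in>P. optimal_code q n d w C) \<and>
     (\<forall>C\<in>P. \<forall>D\<in>P. C \<noteq> D \<longrightarrow> C \<inter> D = {})"

definition TOC_exists :: "nat \<Rightarrow> nat \<Rightarrow> nat \<Rightarrow> nat \<Rightarrow> bool" where
  "TOC_exists q n d w \<longleftrightarrow> (\<exists>P. is_TOC q n d w P)"

end

theory Submission
  imports Defs "HOL-Library.Disjoint_Sets" "HOL-Library.Multiset" "HOL-Library.Product_Lexorder"
begin

text \<open>A ternary word of weight three is a triple of positions with signs. Suppose the triples of an
  \<open>N\<close>-set are partitioned into classes, each covering all points (all but one if \<open>N mod 3 = 1\<close>), and the
  classes are arranged in cycles such that blocks of consecutive classes meet in at most one point. The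
  blocks of two consecutive classes form a bipartite graph with the points as edges; by Koenig's theorem
  its edges have a proper 3-colouring. Signing the blocks of the first class by an even-weight pattern on
  the three colours, and those of the second by its complement, gives an optimal code, since blocks meeting
  in a point have different signs there. All words arise, because the parity of a signed triple does
  not depend on the colouring.

  Such cyclically linked partitions exist for \<open>3 n\<close> points whenever they exist for an odd
  multiple \<open>n\<close> of three, and for \<open>9 W + 1\<close> points whenever they exist for
  \<open>W + 1\<close>, \<open>W mod 6 = 3\<close>, \<open>W \<ge> 9\<close>. The starting orders are given by base classes
  developed under an affine group, one or two points being fixed.\<close>

section \<open>Linked parallel classes\<close>

definition triples :: "'a set \<Rightarrow> 'a set set" where
  "triples X = {B. B \<subseteq> X \<and> card B = 3}"

definition parallel_class :: "'a set \<Rightarrow> 'a set set \<Rightarrow> bool" where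
  "parallel_class X P \<longleftrightarrow> P \<subseteq> triples X \<and> disjoint P \<and> card P = card X div 3"

definition meet_once :: "'a set set \<Rightarrow> 'a set set \<Rightarrow> bool" where
  "meet_once P Q \<longleftrightarrow> (\<forall>B\<in>P. \<forall>C\<in>Q. \<forall>x\<in>B \<inter> C. \<forall>y\<in>B \<inter> C. x = y)"

definition linked_family ::
    "'a set \<Rightarrow> 'i set \<Rightarrow> ('i \<Rightarrow> 'a set set) \<Rightarrow> ('i \<Rightarrow> 'i) \<Rightarrow> 'a set set \<Rightarrow> bool" where
  "linked_family X I P s T \<longleftrightarrow> finite I \<and> bij_betw s I I \<and> (\<forall>i\<in>I. parallel_class X (P i)) \<and>
     (\<forall>i\<in>I. meet_once (P i) (P (s i))) \<and> T \<subseteq> (\<Union>i\<in>I. P i)"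

definition linked :: "'a set \<Rightarrow> nat \<Rightarrow> 'a set set \<Rightarrow> bool" where
  "linked X m T \<longleftrightarrow> (\<exists>(I::nat set) P s. linked_family X I P s T \<and> card I \<le> m)"

text \<open>The bound on the number of classes forces every triple into exactly one of them.\<close>

definition resolved :: "nat \<Rightarrow> bool" where
  "resolved N \<longleftrightarrow> (\<exists>m. linked {..<N} m (triples {..<N}) \<and> m * (N div 3) \<le> N choose 3)"

subsection \<open>Parallel classes\<close>

lemma finite_triples: "finite X \<Longrightarrow> finite (triples X)"
  unfolding triples_def by (rule finite_subset[of _ "Pow X"]) auto

lemma card_triples: "finite X \<Longrightarrow> card (triples X) = card X choose 3"
  unfolding triples_def by (rule n_subsets)

lemma triplesE:
  assumes "B \<in> triples X"
  obtains x y z where "B = {x, y, z}" "x \<noteq> y" "x \<noteq> z" "y \<noteq> z" "x \<in> X" "y \<in> X" "z \<in> X"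
  using assms unfolding triples_def by (auto simp: card_3_iff)

lemma parallel_class_triples: "parallel_class X P \<Longrightarrow> B \<in> P \<Longrightarrow> B \<in> triples X"
  unfolding parallel_class_def by blast

lemma parallel_class_block:
  assumes "parallel_class X P" "B \<in> P"
  shows "B \<subseteq> X" "card B = 3"
  using assms unfolding parallel_class_def triples_def by auto

lemma parallel_class_unique:
  "parallel_class X P \<Longrightarrow> B \<in> P \<Longrightarrow> C \<in> P \<Longrightarrow> x \<in> B \<Longrightarrow> x \<in> C \<Longrightarrow> B = C"
  unfolding parallel_class_def pairwise_def disjnt_def by blast

lemma parallel_class_finite: "finite X \<Longrightarrow> parallel_class X P \<Longrightarrow> finite P"
  unfolding parallel_class_def using finite_triples finite_subset by metis

lemma parallel_class_uncovered:
  assumes "finite X" "parallel_class X P"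
  shows "card (X - \<Union>P) = card X mod 3"
proof -
  have fin: "finite B" if "B \<in> P" for B
    using parallel_class_block(1)[OF assms(2) that] assms(1) finite_subset by blast
  have "card (\<Union>P) = sum card P"
    using assms(2) fin unfolding parallel_class_def by (intro card_Union_disjoint) auto
  also have "\<dots> = sum (\<lambda>_. 3) P"
    using parallel_class_block[OF assms(2)] by (intro sum.cong) auto
  also have "\<dots> = 3 * (card X div 3)"
    using assms(2) unfolding parallel_class_def by simp
  finally have "card (X - \<Union>P) = card X - 3 * (card X div 3)"
    using parallel_class_block(1)[OF assms(2)] assms(1)
    by (subst card_Diff_subset) (auto intro: finite_subset)
  then show ?thesis
    by (simp add: minus_mult_div_eq_mod)
qed

lemma disjoint_if_card_Union_ge:
  assumes "finite P" and "\<And>B. B \<in> P \<Longrightarrow> finite B \<and> card B \<le> k" and "card P * k \<le> card (\<Union>P)"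
  shows "disjoint P \<and> (\<forall>B\<in>P. card B = k)"
  using assms
proof (induction P rule: finite_induct)
  case (insert B P)
  have fin: "finite B" "finite (\<Union>P)" using insert by auto
  have small: "card (\<Union>P) \<le> card P * k"
    using card_Union_le_sum_card[of P] sum_bounded_above[of P card k] insert.prems(1) by force
  have count: "card B + card (\<Union>P) = card (B \<union> \<Union>P) + card (B \<inter> \<Union>P)"
    using card_Un_Int[OF fin] .
  have "card B \<le> k" "k + card P * k \<le> card (B \<union> \<Union>P)"
    using insert by auto
  then have "card (\<Union>P) = card P * k" "card B = k" "card (B \<inter> \<Union>P) = 0"
    using count small by linarith+
  moreover from this have "disjoint P \<and> (\<forall>C\<in>P. card C = k)"
    by (intro insert.IH) (use insert.prems(1) in auto)
  ultimately show ?case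
    using fin by (auto simp: pairwise_insert disjnt_iff[of B] disjnt_iff[of _ B])
qed simp

text \<open>Only coverage has to be checked: a family of the right size with at most the admissible
  number of uncovered points consists of disjoint triples.\<close>

lemma parallel_class_coverI:
  assumes fin: "finite X" "finite P" "finite Y" and small: "card P \<le> card X div 3"
    and P: "\<And>B. B \<in> P \<Longrightarrow> B \<subseteq> X" "\<And>B. B \<in> P \<Longrightarrow> card B \<le> 3"
    and cover: "X - Y \<subseteq> \<Union>P" and Y: "card Y \<le> card X mod 3"
  shows "parallel_class X P"
proof -
  have finP: "finite B" if "B \<in> P" for B
    using P(1)[OF that] fin(1) finite_subset by blast
  have "card X div 3 * 3 = card X - card X mod 3"
    by (metis minus_mod_eq_div_mult)
  also have "\<dots> \<le> card (X - Y)"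
    using Y diff_card_le_card_Diff[OF fin(3), of X] by linarith
  also have "\<dots> \<le> card (\<Union>P)"
    using cover fin(2) finP by (intro card_mono) auto
  finally have large: "card X div 3 * 3 \<le> card (\<Union>P)" .
  also have "\<dots> \<le> card P * 3"
    using card_Union_le_sum_card[of P] sum_bounded_above[of P card 3] finP P(2) by force
  finally have card: "card P = card X div 3" using small by simp
  then have "disjoint P \<and> (\<forall>B\<in>P. card B = 3)"
    by (intro disjoint_if_card_Union_ge fin(2)) (use finP P(2) large in auto)
  then show ?thesis
    using card P(1) unfolding parallel_class_def triples_def by blast
qed

lemma parallel_class_image:
  assumes f: "inj_on f X" "f ` X = Y" and P: "parallel_class X P"
  shows "parallel_class Y ((`) f ` P)"
proof -
  note block = parallel_class_block[OF P]
  have "inj_on ((`) f) P"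
    using inj_on_image_Pow[OF f(1)] by (rule inj_on_subset) (use block in auto)
  moreover have "card Y = card X" using f by (metis card_image)
  moreover have "(`) f ` P \<subseteq> triples Y"
    using block f unfolding triples_def by (auto simp: card_image inj_on_subset)
  moreover have "disjoint ((`) f ` P)"
  proof (rule pairwise_imageI)
    fix B C assume "B \<in> P" "C \<in> P" "B \<noteq> C"
    then show "disjnt (f ` B) (f ` C)"
      using P block f(1) unfolding parallel_class_def pairwise_def disjnt_def
      by (metis image_empty inj_on_image_Int)
  qed
  ultimately show ?thesis
    using P unfolding parallel_class_def by (simp add: card_image)
qed

lemma meet_onceI:
  "(\<And>B C x y. B \<in> P \<Longrightarrow> C \<in> Q \<Longrightarrow> x \<in> B \<Longrightarrow> x \<in> C \<Longrightarrow> y \<in> B \<Longrightarrow> y \<in> C \<Longrightarrow> x = y) \<Longrightarrow> meet_once P Q"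
  unfolding meet_once_def by blast

lemma meet_onceD:
  "meet_once P Q \<Longrightarrow> B \<in> P \<Longrightarrow> C \<in> Q \<Longrightarrow> x \<in> B \<Longrightarrow> x \<in> C \<Longrightarrow> y \<in> B \<Longrightarrow> y \<in> C \<Longrightarrow> x = y"
  unfolding meet_once_def by blast

lemma meet_once_commute: "meet_once P Q \<longleftrightarrow> meet_once Q P"
  unfolding meet_once_def by blast

lemma meet_once_Un:
  "meet_once (P \<union> Q) R \<longleftrightarrow> meet_once P R \<and> meet_once Q R"
  "meet_once P (Q \<union> R) \<longleftrightarrow> meet_once P Q \<and> meet_once P R"
  unfolding meet_once_def by blast+

lemma meet_once_UN:
  "meet_once (\<Union>i\<in>I. P i) Q \<longleftrightarrow> (\<forall>i\<in>I. meet_once (P i) Q)"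
  "meet_once Q (\<Union>i\<in>I. P i) \<longleftrightarrow> (\<forall>i\<in>I. meet_once Q (P i))"
  unfolding meet_once_def by blast+

lemma meet_once_image:
  assumes f: "inj_on f X" and sub: "\<Union>P \<subseteq> X" "\<Union>Q \<subseteq> X" and meet: "meet_once P Q"
  shows "meet_once ((`) f ` P) ((`) f ` Q)"
proof (rule meet_onceI)
  fix B C x y
  assume "B \<in> (`) f ` P" "C \<in> (`) f ` Q" and xy: "x \<in> B" "x \<in> C" "y \<in> B" "y \<in> C"
  then obtain B' C' where BC: "B' \<in> P" "B = f ` B'" "C' \<in> Q" "C = f ` C'" by blast
  have "B \<inter> C = f ` (B' \<inter> C')"
    unfolding BC using f sub BC by (intro inj_on_image_Int[symmetric]) auto
  then obtain x' y' where "x' \<in> B' \<inter> C'" "y' \<in> B' \<inter> C'" "x = f x'" "y = f y'" using xy by blast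
  then show "x = y" using meet_onceD[OF meet BC(1,3)] by auto
qed

subsection \<open>Linked families\<close>

lemma linked_familyI:
  assumes "finite I" "inj_on s I" "\<And>i. i \<in> I \<Longrightarrow> s i \<in> I"
    and "\<And>i. i \<in> I \<Longrightarrow> parallel_class X (P i)"
    and "\<And>i. i \<in> I \<Longrightarrow> meet_once (P i) (P (s i))"
    and "\<And>B. B \<in> T \<Longrightarrow> \<exists>i\<in>I. B \<in> P i"
  shows "linked_family X I P s T"
proof -
  have "s ` I = I" by (rule endo_inj_surj) (use assms in auto)
  then show ?thesis unfolding linked_family_def bij_betw_def using assms by auto
qed

lemma linked_familyD:
  assumes "linked_family X I P s T"
  shows "finite I" "bij_betw s I I" "inj_on s I" "\<And>i. i \<in> I \<Longrightarrow> s i \<in> I"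
    and "\<And>i. i \<in> I \<Longrightarrow> parallel_class X (P i)"
    and "\<And>i. i \<in> I \<Longrightarrow> meet_once (P i) (P (s i))"
    and "\<And>B. B \<in> T \<Longrightarrow> \<exists>i\<in>I. B \<in> P i"
  using assms unfolding linked_family_def bij_betw_def by auto

lemma linkedI:
  assumes L: "linked_family X I P s T" and m: "card I \<le> m"
  shows "linked X m T"
proof -
  note family = linked_familyD[OF L]
  obtain h where h: "bij_betw h I {..<card I}"
    using family(1) by (metis finite_same_card_bij card_lessThan finite_lessThan)
  let ?g = "inv_into I h"
  have gh: "?g (h i) = i" if "i \<in> I" for i
    using h that by (simp add: bij_betw_inv_into_left)
  have gI: "?g j \<in> I" if "j < card I" for j
    using bij_betw_inv_into[OF h] that bij_betwE by fastforce
  have "linked_family X {..<card I} (P \<circ> ?g) (h \<circ> s \<circ> ?g) T"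
    unfolding linked_family_def
  proof (intro conjI ballI)
    show "bij_betw (h \<circ> s \<circ> ?g) {..<card I} {..<card I}"
      using bij_betw_inv_into[OF h] h family(2) by (blast intro: bij_betw_trans)
    show "T \<subseteq> (\<Union>j\<in>{..<card I}. (P \<circ> ?g) j)"
    proof
      fix B assume "B \<in> T"
      then obtain i where "i \<in> I" "B \<in> P i" using family(7) by blast
      then show "B \<in> (\<Union>j\<in>{..<card I}. (P \<circ> ?g) j)"
        using gh bij_betwE[OF h] by (intro UN_I[of "h i"]) auto
    qed
  qed (use family(4-6) gI gh in auto)
  then show ?thesis unfolding linked_def using m by (metis card_lessThan)
qed

lemma linkedE:
  assumes "linked X m T"
  obtains I :: "nat set" and P s where "linked_family X I P s T" "card I \<le> m"
  using assms unfolding linked_def by blast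

lemma linked_mono:
  assumes "linked X m T" "U \<subseteq> T"
  shows "linked X m U"
proof -
  obtain I :: "nat set" and P s where L: "linked_family X I P s T" "card I \<le> m"
    using linkedE[OF assms(1)] .
  then have "linked_family X I P s U" using assms(2) unfolding linked_family_def by blast
  then show ?thesis using L(2) by (rule linkedI)
qed

text \<open>Each class \<open>Q j\<close> is inserted into the cycle of \<open>s\<close> between \<open>h j\<close> and \<open>s (h j)\<close>.\<close>

lemma linked_insert:
  assumes L: "linked_family X I P s T" and J: "finite J"
    and Q: "\<And>j. j \<in> J \<Longrightarrow> parallel_class X (Q j)"
    and h: "inj_on h J" "\<And>j. j \<in> J \<Longrightarrow> h j \<in> I"
    and before: "\<And>j. j \<in> J \<Longrightarrow> meet_once (P (h j)) (Q j)"
    and after: "\<And>j. j \<in> J \<Longrightarrow> meet_once (Q j) (P (s (h j)))"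
  shows "linked X (card I + card J) (T \<union> (\<Union>j\<in>J. Q j))"
proof (rule linkedI)
  note family = linked_familyD[OF L]
  define r where "r = case_sum (\<lambda>i. if i \<in> h ` J then Inr (inv_into J h i) else Inl (s i))
    (\<lambda>j. Inl (s (h j)))"
  have r_simps: "r (Inl (h j)) = Inr j" "r (Inr j) = Inl (s (h j))" if "j \<in> J" for j
    using that h(1) by (simp_all add: r_def)
  have r_Inl: "r (Inl i) = Inl (s i)" if "i \<notin> h ` J" for i
    using that by (simp add: r_def)
  show "linked_family X (I <+> J) (case_sum P Q) r (T \<union> (\<Union>j\<in>J. Q j))"
  proof (rule linked_familyI)
    have s_eq: "s i = s i' \<longleftrightarrow> i = i'" if "i \<in> I" "i' \<in> I" for i i'
      using inj_on_eq_iff[OF family(3) that] .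
    have h_eq: "h j = h j' \<longleftrightarrow> j = j'" if "j \<in> J" "j' \<in> J" for j j'
      using inj_on_eq_iff[OF h(1) that] .
    show "inj_on r (I <+> J)"
    proof (rule inj_onI)
      fix u v assume "u \<in> I <+> J" "v \<in> I <+> J" "r u = r v"
      then show "u = v"
        by (elim PlusE) (auto simp: r_def s_eq h h_eq split: if_splits)
    qed
    show "r u \<in> I <+> J" if "u \<in> I <+> J" for u
      using that by (elim PlusE) (auto simp: r_def family(4) h)
    show "meet_once (case_sum P Q u) (case_sum P Q (r u))" if u: "u \<in> I <+> J" for u
      using u
    proof (elim PlusE)
      fix i assume i: "i \<in> I" "u = Inl i"
      show ?thesis
      proof (cases "i \<in> h ` J")
        case True
        then show ?thesis using before i r_simps(1) by auto
      qed (use i family(6) r_Inl in simp)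
    qed (use after r_simps(2) in auto)
    show "\<exists>u\<in>I <+> J. B \<in> case_sum P Q u" if "B \<in> T \<union> (\<Union>j\<in>J. Q j)" for B
      using that family(7) by force
  qed (use family(1,5) J Q in auto)
  show "card (I <+> J) \<le> card I + card J" using family(1) J by (simp add: card_Plus)
qed

lemma linked_Un:
  assumes "linked X m T" "linked X n U"
  shows "linked X (m + n) (T \<union> U)"
proof -
  obtain I :: "nat set" and P s where L: "linked_family X I P s T" "card I \<le> m"
    using linkedE[OF assms(1)] .
  obtain J :: "nat set" and Q t where M: "linked_family X J Q t U" "card J \<le> n"
    using linkedE[OF assms(2)] .
  note left = linked_familyD[OF L(1)] and right = linked_familyD[OF M(1)]
  have "linked_family X (I <+> J) (case_sum P Q) (map_sum s t) (T \<union> U)"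
  proof (rule linked_familyI)
    show "inj_on (map_sum s t) (I <+> J)"
    proof (rule inj_onI)
      fix u v assume "u \<in> I <+> J" "v \<in> I <+> J" "map_sum s t u = map_sum s t v"
      then show "u = v"
        by (elim PlusE) (auto dest: inj_onD[OF left(3)] inj_onD[OF right(3)])
    qed
    show "meet_once (case_sum P Q u) (case_sum P Q (map_sum s t u))" if "u \<in> I <+> J" for u
      using that left(6) right(6) by (elim PlusE) auto
    show "\<exists>u\<in>I <+> J. B \<in> case_sum P Q u" if "B \<in> T \<union> U" for B
      using that left(7) right(7) by force
  qed (use left right in auto)
  moreover have "card (I <+> J) \<le> m + n" using L M left right by (simp add: card_Plus)
  ultimately show ?thesis by (rule linkedI)
qed

lemma linked_triples_transfer:
  assumes L: "linked X m (triples X)" and fin: "finite X" "finite Y" and card: "card Y = card X"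
  shows "linked Y m (triples Y)"
proof -
  obtain f where f: "inj_on f X" "f ` X = Y"
    using finite_same_card_bij[OF fin card[symmetric]] unfolding bij_betw_def by blast
  obtain I :: "nat set" and P s where L: "linked_family X I P s (triples X)" "card I \<le> m"
    using linkedE[OF L] .
  note family = linked_familyD[OF L(1)]
  have "linked_family Y I (\<lambda>i. (`) f ` P i) s (triples Y)"
  proof (rule linked_familyI)
    have points: "\<Union>(P i) \<subseteq> X" if "i \<in> I" for i
      using parallel_class_block(1)[OF family(5)[OF that]] by blast
    show "meet_once ((`) f ` P i) ((`) f ` P (s i))" if "i \<in> I" for i
      using meet_once_image[OF f(1) points points family(6)] that family(4) by blast
    show "\<exists>i\<in>I. B \<in> (`) f ` P i" if "B \<in> triples Y" for B
    proof -
      have "B \<subseteq> f ` X" using that f(2) unfolding triples_def by blast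
      then obtain C where C: "C \<subseteq> X" "B = f ` C" by (rule subset_imageE)
      then have "C \<in> triples X"
        using that f(1) unfolding triples_def by (auto simp: card_image inj_on_subset)
      then show ?thesis using family(7) C(2) by blast
    qed
  qed (use family parallel_class_image[OF f] in auto)
  then show ?thesis using L(2) by (rule linkedI)
qed

lemma six_choose_three: "6 * (n choose 3) = n * (n - 1) * (n - 2)"
proof -
  have "3 * (n choose 3) = n * ((n - 1) choose 2)" using times_binomial_minus1_eq[of 3 n] by simp
  moreover have "2 * ((n - 1) choose 2) = (n - 1) * (n - 2)"
    using times_binomial_minus1_eq[of 2 "n - 1"] by (simp add: numeral_2_eq_2)
  ultimately show ?thesis by (metis mult.assoc mult.left_commute mult_2 numeral_Bit0)
qed

lemma resolvedI:
  assumes "linked X m (triples X)" "finite X" "card X = N"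
    and "6 * (m * (N div 3)) \<le> N * (N - 1) * (N - 2)"
  shows "resolved N"
proof -
  have "linked {..<N} m (triples {..<N})"
    by (rule linked_triples_transfer[OF assms(1,2)]) (use assms(3) in simp_all)
  moreover have "m * (N div 3) \<le> N choose 3"
    using assms(4) unfolding six_choose_three[symmetric] by simp
  ultimately show ?thesis unfolding resolved_def by blast
qed

lemma linked_family_unique:
  assumes L: "linked_family X I P s (triples X)" and fin: "finite X"
    and count: "card I * (card X div 3) \<le> card X choose 3"
    and ij: "i \<in> I" "j \<in> I" "B \<in> P i" "B \<in> P j"
  shows "i = j"
proof (rule ccontr)
  assume "i \<noteq> j"
  note family = linked_familyD[OF L]
  let ?k = "card X div 3"
  have P: "card (P k) = ?k" "finite (P k)" if "k \<in> I" for k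
    using family(5)[OF that] parallel_class_finite[OF fin] unfolding parallel_class_def by auto
  have "triples X \<subseteq> (\<Union>k\<in>I-{i}. P k) \<union> (P i - {B})"
    using family(7) ij \<open>i \<noteq> j\<close> by blast
  then have "card X choose 3 \<le> card ((\<Union>k\<in>I-{i}. P k) \<union> (P i - {B}))"
    using P family(1) ij(1) by (subst card_triples[OF fin, symmetric], intro card_mono) auto
  also have "\<dots> \<le> card (\<Union>k\<in>I-{i}. P k) + card (P i - {B})" by (rule card_Un_le)
  also have "card (\<Union>k\<in>I-{i}. P k) \<le> (\<Sum>k\<in>I-{i}. card (P k))"
    using family(1) by (intro card_UN_le) auto
  also have "(\<Sum>k\<in>I-{i}. card (P k)) = (card I - 1) * ?k" using P family(1) ij(1) by simp
  also have "card (P i - {B}) < ?k" using P[OF ij(1)] ij(3) card_Diff1_less by metis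
  finally have "card X choose 3 < (card I - 1) * ?k + ?k" by simp
  also have "\<dots> = card I * ?k" using family(1) ij(1) by (cases "card I") auto
  finally show False using count by simp
qed

lemma resolvedE:
  assumes "resolved N"
  obtains I :: "nat set" and P s where "linked_family {..<N} I P s (triples {..<N})"
    and "6 * (card I * (N div 3)) \<le> N * (N - 1) * (N - 2)"
    and "\<And>i j B. i \<in> I \<Longrightarrow> j \<in> I \<Longrightarrow> B \<in> P i \<Longrightarrow> B \<in> P j \<Longrightarrow> i = j"
proof -
  obtain I :: "nat set" and P s m where L: "linked_family {..<N} I P s (triples {..<N})"
    and m: "card I \<le> m" "m * (N div 3) \<le> N choose 3"
    using assms unfolding resolved_def linked_def by blast
  from m have count: "card I * (N div 3) \<le> N choose 3" by (meson le_trans mult_le_mono1)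
  show thesis
  proof (rule that[OF L])
    show "6 * (card I * (N div 3)) \<le> N * (N - 1) * (N - 2)"
      using count unfolding six_choose_three[symmetric] by simp
    show "i = j" if "i \<in> I" "j \<in> I" "B \<in> P i" "B \<in> P j" for i j B
      by (rule linked_family_unique[OF L _ _ that]) (use count in simp_all)
  qed
qed

section \<open>Colouring points along two disjoint families\<close>

text \<open>Each \<open>e\<close> is an edge of a bipartite multigraph, joining the vertices \<open>p e\<close> and \<open>q e\<close>.\<close>

definition proper_colouring :: "'e set \<Rightarrow> ('e \<Rightarrow> 'u) \<Rightarrow> ('e \<Rightarrow> 'v) \<Rightarrow> ('e \<Rightarrow> nat) \<Rightarrow> bool" where
  "proper_colouring E p q col \<longleftrightarrow>
     (\<forall>e\<in>E. \<forall>f\<in>E. (p e = p f \<or> q e = q f) \<and> col e = col f \<longrightarrow> e = f)"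

lemma proper_colouringD:
  assumes "proper_colouring E p q col" "e \<in> E" "f \<in> E" "p e = p f \<or> q e = q f" "col e = col f"
  shows "e = f"
  using assms unfolding proper_colouring_def by blast

inductive_set kempe_chain ::
    "'e set \<Rightarrow> ('e \<Rightarrow> 'u) \<Rightarrow> ('e \<Rightarrow> 'v) \<Rightarrow> ('e \<Rightarrow> nat) \<Rightarrow> nat \<Rightarrow> nat \<Rightarrow> 'e \<Rightarrow> 'e set"
  for E p q col a b e0 where
  start: "e0 \<in> kempe_chain E p q col a b e0"
| step_q: "\<lbrakk>e \<in> kempe_chain E p q col a b e0; col e = b; f \<in> E; q f = q e; col f = a\<rbrakk>
    \<Longrightarrow> f \<in> kempe_chain E p q col a b e0"
| step_p: "\<lbrakk>e \<in> kempe_chain E p q col a b e0; col e = a; f \<in> E; p f = p e; col f = b\<rbrakk>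
    \<Longrightarrow> f \<in> kempe_chain E p q col a b e0"

lemma kempe_chain_bicoloured:
  assumes "e \<in> kempe_chain E p q col a b e0" "e0 \<in> E" "col e0 = b"
  shows "e \<in> E" "col e = a \<or> col e = b"
  using assms by (induction) auto

lemma kempe_chain_predecessor_q:
  assumes "f \<in> kempe_chain E p q col a b e0" "col f = a" "col e0 = b" "a \<noteq> b"
  shows "\<exists>e\<in>kempe_chain E p q col a b e0. col e = b \<and> q e = q f"
  using assms(1) by cases (use assms in auto)

lemma kempe_chain_predecessor_p:
  assumes "f \<in> kempe_chain E p q col a b e0" "col f = b" "a \<noteq> b" "f \<noteq> e0"
  shows "\<exists>e\<in>kempe_chain E p q col a b e0. col e = a \<and> p e = p f"
  using assms(1) by cases (use assms in auto)

lemma kempe_chain_closed: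
  assumes proper: "proper_colouring E p q col" and e0: "e0 \<in> E" "col e0 = b" and ab: "a \<noteq> b"
    and end_free: "\<And>f. f \<in> E \<Longrightarrow> p f = p e0 \<Longrightarrow> col f \<noteq> a"
    and e: "e \<in> kempe_chain E p q col a b e0"
    and f: "f \<in> E" "p f = p e \<or> q f = q e" "col f = a \<or> col f = b"
  shows "f \<in> kempe_chain E p q col a b e0"
proof (cases "col f = col e")
  case True
  then have "f = e"
    using proper_colouringD[OF proper f(1) kempe_chain_bicoloured(1)[OF e e0] f(2)] by blast
  then show ?thesis using e by blast
next
  case False
  consider (forward_p) "p f = p e" "col e = a" "col f = b"
    | (backward_p) "p f = p e" "col e = b" "col f = a"
    | (forward_q) "q f = q e" "col e = b" "col f = a"
    | (backward_q) "q f = q e" "col e = a" "col f = b"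
    using False f(2,3) kempe_chain_bicoloured(2)[OF e e0] by auto
  then show ?thesis
  proof cases
    case forward_p
    then show ?thesis using kempe_chain.step_p[OF e] f(1) by blast
  next
    case backward_p
    then have "e \<noteq> e0" using end_free f(1) by auto
    then obtain d where d: "d \<in> kempe_chain E p q col a b e0" "col d = a" "p d = p e"
      using kempe_chain_predecessor_p[OF e] backward_p ab by blast
    then have "d = f"
      using proper_colouringD[OF proper kempe_chain_bicoloured(1)[OF d(1) e0] f(1)] backward_p by simp
    then show ?thesis using d(1) by blast
  next
    case forward_q
    then show ?thesis using kempe_chain.step_q[OF e] f(1) by blast
  next
    case backward_q
    then obtain d where d: "d \<in> kempe_chain E p q col a b e0" "col d = b" "q d = q e"
      using kempe_chain_predecessor_q[OF e] e0(2) ab by blast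
    then have "d = f"
      using proper_colouringD[OF proper kempe_chain_bicoloured(1)[OF d(1) e0] f(1)] backward_q by simp
    then show ?thesis using d(1) by blast
  qed
qed

definition swap_colours :: "nat \<Rightarrow> nat \<Rightarrow> 'e set \<Rightarrow> ('e \<Rightarrow> nat) \<Rightarrow> 'e \<Rightarrow> nat" where
  "swap_colours a b K col e = (if e \<in> K then if col e = a then b else a else col e)"

lemma proper_colouring_swap_colours:
  assumes proper: "proper_colouring E p q col" and "a \<noteq> b"
    and bicoloured: "\<And>e. e \<in> K \<Longrightarrow> col e = a \<or> col e = b"
    and closed: "\<And>e f. e \<in> K \<Longrightarrow> f \<in> E \<Longrightarrow> p f = p e \<or> q f = q e \<Longrightarrow> col f = a \<or> col f = b \<Longrightarrow> f \<in> K"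
  shows "proper_colouring E p q (swap_colours a b K col)"
proof -
  have distinct: "e = f" if "e \<in> E" "f \<in> E" "p e = p f \<or> q e = q f"
    "swap_colours a b K col e = swap_colours a b K col f" for e f
  proof -
    have "e \<in> K \<longleftrightarrow> f \<in> K"
      using that closed[of e f] closed[of f e] \<open>a \<noteq> b\<close>
      unfolding swap_colours_def by (auto split: if_splits)
    then have "col e = col f"
      using that(4) bicoloured[of e] bicoloured[of f] \<open>a \<noteq> b\<close>
      unfolding swap_colours_def by (auto split: if_splits)
    then show ?thesis using proper_colouringD[OF proper that(1-3)] by blast
  qed
  then show ?thesis unfolding proper_colouring_def by blast
qed

lemma proper_colouring_insert:
  assumes "proper_colouring E p q col" "x \<notin> E"
    and "\<And>f. f \<in> E \<Longrightarrow> p f = p x \<or> q f = q x \<Longrightarrow> col f \<noteq> c"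
  shows "proper_colouring (insert x E) p q (col(x := c))"
proof -
  have free: "col f \<noteq> c" if "f \<in> E" "p x = p f \<or> q x = q f" for f
    using assms(3)[OF that(1)] that(2) by metis
  show ?thesis
    using assms free unfolding proper_colouring_def by (auto split: if_splits)
qed

lemma ex_missing_colour:
  assumes "finite F" "card F < k"
  shows "\<exists>c<k. \<forall>f\<in>F. col f \<noteq> (c :: nat)"
proof -
  have "card (col ` F) < card {..<k}" using assms card_image_le[OF assms(1), of col] by simp
  then have "\<not> {..<k} \<subseteq> col ` F" using assms(1) by (meson card_mono finite_imageI not_le)
  then show ?thesis by auto
qed

lemma fibre_bounds_insert:
  assumes "finite E" "x \<notin> E" and bound: "\<And>e. e \<in> insert x E \<Longrightarrow> card {f \<in> insert x E. r f = r e} \<le> k"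
  shows "\<And>e. e \<in> E \<Longrightarrow> card {f \<in> E. r f = r e} \<le> k" and "card {f \<in> E. r f = r x} < k"
proof -
  have "card {f \<in> E. r f = r e} \<le> card {f \<in> insert x E. r f = r e}" for e
    using assms(1) by (intro card_mono) auto
  then show "card {f \<in> E. r f = r e} \<le> k" if "e \<in> E" for e
    using bound[of e] that by (meson insertI2 le_trans)
  have "card {f \<in> E. r f = r x} < card {f \<in> insert x E. r f = r x}"
    using assms(1,2) by (intro psubset_card_mono) auto
  then show "card {f \<in> E. r f = r x} < k" using bound[of x] by simp
qed

lemma ex_colouring_common_free_colour:
  assumes proper: "proper_colouring E p q col" and bound: "\<forall>e\<in>E. col e < k" "a < k" "b < k"
    and a: "\<And>f. f \<in> E \<Longrightarrow> p f = p x \<Longrightarrow> col f \<noteq> a"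
    and b: "\<And>f. f \<in> E \<Longrightarrow> q f = q x \<Longrightarrow> col f \<noteq> b"
  shows "\<exists>col'. proper_colouring E p q col' \<and> (\<forall>e\<in>E. col' e < k) \<and>
    (\<forall>f\<in>E. p f = p x \<or> q f = q x \<longrightarrow> col' f \<noteq> b)"
proof (cases "\<exists>e0\<in>E. p e0 = p x \<and> col e0 = b")
  case True
  then obtain e0 where e0: "e0 \<in> E" "col e0 = b" "p e0 = p x" by blast
  have "a \<noteq> b" using a e0 by blast
  define K where "K = kempe_chain E p q col a b e0"
  define col' where "col' = swap_colours a b K col"
  have bicoloured: "e \<in> E" "col e = a \<or> col e = b" if "e \<in> K" for e
    using kempe_chain_bicoloured[of e E p q col a b e0] that e0 unfolding K_def by auto
  have col': "col' f = b \<longleftrightarrow> (if f \<in> K then col f = a else col f = b)" for f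
    using \<open>a \<noteq> b\<close> unfolding col'_def swap_colours_def by auto
  have "proper_colouring E p q col'"
    unfolding col'_def
  proof (rule proper_colouring_swap_colours[OF proper \<open>a \<noteq> b\<close> bicoloured(2)])
    show "f \<in> K" if "e \<in> K" "f \<in> E" "p f = p e \<or> q f = q e" "col f = a \<or> col f = b" for e f
      unfolding K_def
      by (rule kempe_chain_closed[OF proper e0(1,2) \<open>a \<noteq> b\<close> _ _ that(2-4)])
         (use a e0(3) that(1) in \<open>auto simp: K_def\<close>)
  qed
  moreover have "col' f \<noteq> b" if f: "f \<in> E" "p f = p x" for f
  proof
    assume "col' f = b"
    then have "f \<notin> K" "col f = b" using col'[of f] a[OF f] by (auto split: if_splits)
    then have "f = e0" using proper_colouringD[OF proper f(1) e0(1)] e0 f(2) by simp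
    then show False using \<open>f \<notin> K\<close> kempe_chain.start unfolding K_def by fast
  qed
  moreover have "col' f \<noteq> b" if f: "f \<in> E" "q f = q x" for f
  proof
    assume "col' f = b"
    then have "f \<in> K" "col f = a" using col'[of f] b[OF f] by (auto split: if_splits)
    then obtain e where "e \<in> K" "col e = b" "q e = q f"
      using kempe_chain_predecessor_q e0(2) \<open>a \<noteq> b\<close> unfolding K_def by metis
    then show False using b bicoloured(1) f(2) by metis
  qed
  moreover have "col' e < k" if "e \<in> E" for e
    using bound that unfolding col'_def swap_colours_def by auto
  ultimately show ?thesis by blast
next
  case False
  then show ?thesis using proper bound(1) b by (intro exI[of _ col]) auto
qed

theorem koenig_edge_colouring:
  assumes "finite E"
    and "\<And>e. e \<in> E \<Longrightarrow> card {f \<in> E. p f = p e} \<le> k"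
    and "\<And>e. e \<in> E \<Longrightarrow> card {f \<in> E. q f = q e} \<le> k"
  shows "\<exists>col. proper_colouring E p q col \<and> (\<forall>e\<in>E. col e < k)"
  using assms
proof (induction E rule: finite_induct)
  case (insert x E)
  note p_bounds = fibre_bounds_insert[OF insert.hyps insert.prems(1)]
    and q_bounds = fibre_bounds_insert[OF insert.hyps insert.prems(2)]
  obtain col where col: "proper_colouring E p q col" "\<forall>e\<in>E. col e < k"
    using insert.IH[OF p_bounds(1) q_bounds(1)] by blast
  have fin: "finite {f \<in> E. \<phi> f}" for \<phi> using insert.hyps(1) by simp
  obtain a where a: "a < k" "\<forall>f\<in>{f \<in> E. p f = p x}. col f \<noteq> a"
    using ex_missing_colour[OF fin p_bounds(2)] by blast
  obtain b where b: "b < k" "\<forall>f\<in>{f \<in> E. q f = q x}. col f \<noteq> b"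
    using ex_missing_colour[OF fin q_bounds(2)] by blast
  obtain col' where col': "proper_colouring E p q col'" "\<forall>e\<in>E. col' e < k"
    and free: "\<forall>f\<in>E. p f = p x \<or> q f = q x \<longrightarrow> col' f \<noteq> b"
    using ex_colouring_common_free_colour[OF col a(1) b(1), of x] a(2) b(2) by auto
  have "proper_colouring (insert x E) p q (col'(x := b))"
    using proper_colouring_insert[OF col'(1) insert.hyps(2)] free by blast
  moreover have "\<forall>e\<in>insert x E. (col'(x := b)) e < k" using col'(2) b(1) by simp
  ultimately show ?case by blast
qed (simp add: proper_colouring_def)

definition part :: "'a set set \<Rightarrow> 'a \<Rightarrow> 'a set" where
  "part P x = insert x (\<Union>{B \<in> P. x \<in> B})"

lemma part_eq: "disjoint P \<Longrightarrow> B \<in> P \<Longrightarrow> x \<in> B \<Longrightarrow> part P x = B"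
  unfolding part_def pairwise_def disjnt_def by blast

lemma card_part_le:
  assumes "disjoint P" "\<And>B. B \<in> P \<Longrightarrow> finite B \<and> card B \<le> k" "0 < k"
  shows "finite (part P x) \<and> card (part P x) \<le> k"
proof (cases "\<exists>B\<in>P. x \<in> B")
  case True
  then show ?thesis using part_eq[OF assms(1)] assms(2) by metis
next
  case False
  then have "part P x = {x}" unfolding part_def by blast
  then show ?thesis using assms(3) by simp
qed

theorem rainbow_colouring:
  fixes P Q :: "'a set set"
  assumes X: "finite X" and "disjoint P" "disjoint Q" "0 < k"
    and block: "\<And>B. B \<in> P \<union> Q \<Longrightarrow> B \<subseteq> X \<and> card B \<le> k"
  shows "\<exists>col::'a \<Rightarrow> nat. (\<forall>x\<in>X. col x < k) \<and> (\<forall>B\<in>P \<union> Q. inj_on col B)"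
proof -
  have fin: "finite B" if "B \<in> P \<union> Q" for B using block[OF that] X finite_subset by blast
  have degree: "card {y \<in> X. part R y = part R x} \<le> k" if "R = P \<or> R = Q" for R x
  proof -
    have "finite (part R x) \<and> card (part R x) \<le> k"
      using assms that fin by (intro card_part_le) auto
    moreover have "{y \<in> X. part R y = part R x} \<subseteq> part R x" unfolding part_def by blast
    ultimately show ?thesis by (meson card_mono le_trans)
  qed
  then obtain col where col: "\<forall>x\<in>X. col x < k" and proper: "proper_colouring X (part P) (part Q) col"
    using koenig_edge_colouring[OF X, of "part P" k "part Q"] by blast
  have "inj_on col B" if "B \<in> P \<union> Q" for B
  proof (rule inj_onI)
    fix x y assume xy: "x \<in> B" "y \<in> B" "col x = col y"
    then have "part P x = part P y \<or> part Q x = part Q y"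
      using that part_eq assms(2,3) by (metis UnE)
    then show "x = y"
      using proper_colouringD[OF proper] block[OF that] xy by blast
  qed
  then show ?thesis using col by blast
qed

section \<open>Ternary codes from linked families\<close>

subsection \<open>Optimality\<close>

lemma finite_words: "finite (words q n)"
proof (rule finite_subset)
  show "words q n \<subseteq> {x. \<forall>i. (i \<in> {..<n} \<longrightarrow> x i \<in> {..<q}) \<and> (i \<notin> {..<n} \<longrightarrow> x i = 0)}"
    unfolding words_def by auto
qed (rule finite_set_of_finite_funs, auto)

lemma code_card_bound:
  assumes code: "is_code q n d w C" and d: "2 * w \<le> d + 1"
  shows "w * card C \<le> n * (q - 1)"
proof -
  define supp where "supp x = {i. i < n \<and> x i \<noteq> 0}" for x :: "nat \<Rightarrow> nat"
  have C: "C \<subseteq> H q n w" and dist: "\<And>x y. x \<in> C \<Longrightarrow> y \<in> C \<Longrightarrow> x \<noteq> y \<Longrightarrow> d \<le> hamming_dist n x y"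
    using code unfolding is_code_def by auto
  have supp: "card (supp x) = w" "finite (supp x)" if "x \<in> C" for x
    using C that unfolding H_def weight_def supp_def by auto
  have "finite C" using C finite_subset[OF _ finite_words] unfolding H_def by blast
  have "inj_on (\<lambda>(x, i). (i, x i)) (SIGMA x:C. supp x)"
  proof (rule inj_onI, clarify, rule conjI[OF _ refl], rule ccontr)
    fix x y i assume xy: "x \<in> C" "y \<in> C" "i \<in> supp x" "i \<in> supp y" "x i = y i" "x \<noteq> y"
    have "{j. j < n \<and> x j \<noteq> y j} \<subseteq> (supp x - {i}) \<union> (supp y - {i})"
      using xy(5) unfolding supp_def by auto
    then have "hamming_dist n x y \<le> card ((supp x - {i}) \<union> (supp y - {i}))"
      unfolding hamming_dist_def using supp(2) xy by (intro card_mono) auto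
    also have "\<dots> \<le> (w - 1) + (w - 1)"
      using card_Un_le[of "supp x - {i}" "supp y - {i}"] supp xy by simp
    finally have "d \<le> (w - 1) + (w - 1)" using dist[OF xy(1,2,6)] by simp
    moreover have "w > 0" using supp[OF xy(1)] xy(3) card_gt_0_iff by blast
    ultimately show False using d by linarith
  qed
  then have "card (SIGMA x:C. supp x) = card ((\<lambda>(x, i). (i, x i)) ` (SIGMA x:C. supp x))"
    by (simp add: card_image)
  also have "\<dots> \<le> card ({..<n} \<times> {1..<q})"
    using C unfolding H_def words_def supp_def by (intro card_mono) auto
  finally show ?thesis
    using \<open>finite C\<close> supp by (simp add: card_SigmaI card_cartesian_product mult.commute)
qed

lemma optimal_codeI:
  assumes code: "is_code q n d w C" and "2 * w \<le> d + 1" "0 < w" and card: "card C = n * (q - 1) div w"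
  shows "optimal_code q n d w C"
proof -
  have le: "card D \<le> card C" if "is_code q n d w D" for D
    using code_card_bound[OF that assms(2)] \<open>0 < w\<close> unfolding card
    by (simp add: less_eq_div_iff_mult_less_eq mult.commute)
  have "Max {card D | D. is_code q n d w D} = card C"
  proof (rule Max_eqI)
    show "finite {card D | D. is_code q n d w D}"
      by (rule finite_subset[of _ "{..card C}"]) (use le in auto)
  qed (use le code in auto)
  then show ?thesis unfolding optimal_code_def A_def using code by simp
qed

subsection \<open>Signed blocks\<close>

definition signed :: "nat set \<Rightarrow> nat set \<Rightarrow> nat \<Rightarrow> nat" where
  "signed B S = (\<lambda>x. if x \<in> B then if x \<in> S then 2 else 1 else 0)"

lemma signed_eq_iff: "signed B S = signed C T \<longleftrightarrow> B = C \<and> B \<inter> S = B \<inter> T"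
proof
  assume eq: "signed B S = signed C T"
  have "x \<in> B \<longleftrightarrow> x \<in> C" "x \<in> B \<Longrightarrow> x \<in> S \<longleftrightarrow> x \<in> T" for x
    using fun_cong[OF eq, of x] unfolding signed_def by (auto split: if_splits)
  then show "B = C \<and> B \<inter> S = B \<inter> T" by blast
qed (auto simp: signed_def fun_eq_iff)

lemma H_ternary_eq: "H 3 N w = {signed B S | B S. B \<subseteq> {..<N} \<and> card B = w \<and> S \<subseteq> B}"
proof (intro equalityI subsetI)
  fix x assume x: "x \<in> H 3 N w"
  define B where "B = {i. i < N \<and> x i \<noteq> 0}"
  define S where "S = {i \<in> B. x i = 2}"
  have digit: "x i = 0 \<or> x i = 1 \<or> x i = 2" for i
  proof -
    have "x i < 3" using x unfolding H_def words_def by (cases "i < N") auto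
    then show ?thesis by linarith
  qed
  have outside: "x i = 0" if "i \<ge> N" for i using x that unfolding H_def words_def by blast
  have "x i = signed B S i" for i
    using digit[of i] outside[of i] unfolding signed_def B_def S_def by (cases "i < N") auto
  then have "x = signed B S" by (rule ext)
  moreover have "B \<subseteq> {..<N}" "card B = w" "S \<subseteq> B"
    using x unfolding H_def weight_def B_def S_def by auto
  ultimately show "x \<in> {signed B S | B S. B \<subseteq> {..<N} \<and> card B = w \<and> S \<subseteq> B}" by blast
next
  fix x assume "x \<in> {signed B S | B S. B \<subseteq> {..<N} \<and> card B = w \<and> S \<subseteq> B}"
  then obtain B S where B: "x = signed B S" "B \<subseteq> {..<N}" "card B = w" by blast
  then have "{i. i < N \<and> x i \<noteq> 0} = B" unfolding signed_def by auto
  then show "x \<in> H 3 N w" using B unfolding H_def words_def weight_def signed_def by auto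
qed

lemma signed_in_H:
  assumes "B \<in> triples {..<N}"
  shows "signed B S \<in> H 3 N 3"
proof -
  have "signed B S = signed B (S \<inter> B)" by (auto simp: signed_eq_iff)
  then show ?thesis using assms unfolding H_ternary_eq triples_def by blast
qed

lemma hamming_dist_signed:
  assumes B: "B \<in> triples {..<N}" and C: "C \<in> triples {..<N}"
    and one: "\<And>x y. x \<in> B \<inter> C \<Longrightarrow> y \<in> B \<inter> C \<Longrightarrow> x = y"
    and opposite: "\<And>x. x \<in> B \<inter> C \<Longrightarrow> x \<in> S \<longleftrightarrow> x \<notin> T"
  shows "5 \<le> hamming_dist N (signed B S) (signed C T)"
proof -
  have fin: "finite B" "finite C" "card B = 3" "card C = 3"
    using B C unfolding triples_def by (auto intro: finite_subset)
  have "card (B \<inter> C) \<le> 1" using one fin by (simp add: card_le_Suc0_iff_eq)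
  then have "5 \<le> card (B \<union> C)" using card_Un_Int[of B C] fin by linarith
  moreover have "{i. i < N \<and> signed B S i \<noteq> signed C T i} = B \<union> C"
    using B C opposite unfolding triples_def signed_def by (auto split: if_splits)
  ultimately show ?thesis unfolding hamming_dist_def by simp
qed

definition linked_code :: "nat set set \<Rightarrow> nat set set \<Rightarrow> nat set \<Rightarrow> (nat \<Rightarrow> nat) set" where
  "linked_code P Q S = (\<lambda>B. signed B S) ` P \<union> (\<lambda>B. signed B (- S)) ` Q"

lemma signed_in_linked_code_iff:
  "signed B R \<in> linked_code P Q S \<longleftrightarrow> B \<in> P \<and> B \<inter> R = B \<inter> S \<or> B \<in> Q \<and> B \<inter> R = B - S"
  unfolding linked_code_def by (auto simp: signed_eq_iff image_iff Diff_eq)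

lemma is_code_linked_code:
  assumes P: "parallel_class {..<N} P" and Q: "parallel_class {..<N} Q"
    and meet: "meet_once P Q" and "P \<noteq> {}"
  shows "is_code 3 N 5 3 (linked_code P Q S)"
proof -
  have same: "5 \<le> hamming_dist N (signed B R) (signed C R)"
    if "parallel_class {..<N} R'" "B \<in> R'" "C \<in> R'" "signed B R \<noteq> signed C R" for R' B C R
    using parallel_class_triples[OF that(1)] parallel_class_unique[OF that(1-3)] that(2-4)
    by (intro hamming_dist_signed) auto
  have cross: "5 \<le> hamming_dist N (signed B S) (signed C (- S))"
    "5 \<le> hamming_dist N (signed C (- S)) (signed B S)" if "B \<in> P" "C \<in> Q" for B C
    using parallel_class_triples[OF P] parallel_class_triples[OF Q] meet_onceD[OF meet that] that
    by (auto intro!: hamming_dist_signed)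
  have "linked_code P Q S \<subseteq> H 3 N 3"
    using parallel_class_triples[OF P] parallel_class_triples[OF Q] signed_in_H
    unfolding linked_code_def by blast
  moreover have "linked_code P Q S \<noteq> {}" using \<open>P \<noteq> {}\<close> unfolding linked_code_def by blast
  moreover have "5 \<le> hamming_dist N x y"
    if "x \<in> linked_code P Q S" "y \<in> linked_code P Q S" "x \<noteq> y" for x y
    using that same[OF P] same[OF Q] cross unfolding linked_code_def by blast
  ultimately show ?thesis unfolding is_code_def by blast
qed

lemma card_linked_code:
  assumes "parallel_class {..<N} P" "parallel_class {..<N} Q"
  shows "card (linked_code P Q S) = 2 * (N div 3)"
proof -
  have inj: "inj_on (\<lambda>B. signed B R) F" for R F by (auto simp: inj_on_def signed_eq_iff)
  have "B \<inter> S \<noteq> B \<inter> - S" if "B \<in> P" for B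
  proof -
    have "B \<noteq> {}" using parallel_class_block(2)[OF assms(1) that] by force
    then show ?thesis by blast
  qed
  then have "(\<lambda>B. signed B S) ` P \<inter> (\<lambda>B. signed B (- S)) ` Q = {}"
    by (auto simp: signed_eq_iff)
  moreover have "finite P" "finite Q" using assms parallel_class_finite by blast+
  ultimately have "card (linked_code P Q S) = card P + card Q"
    unfolding linked_code_def by (simp add: card_Un_disjoint card_image[OF inj])
  then show ?thesis using assms unfolding parallel_class_def by simp
qed

subsection \<open>The partition into optimal codes\<close>

definition even_patterns :: "nat set set" where
  "even_patterns = {S. S \<subseteq> {..<3} \<and> even (card S)}"

text \<open>A signed triple lies in a code of its own class or of the preceding one, according to the
  parity of its number of entries 2. That parity does not depend on the colouring.\<close>

locale coloured_family =
  fixes N :: nat and I :: "'i set" and P :: "'i \<Rightarrow> nat set set" and s :: "'i \<Rightarrow> 'i"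
    and col :: "'i \<Rightarrow> nat \<Rightarrow> nat"
  assumes family: "linked_family {..<N} I P s (triples {..<N})"
    and unique: "\<And>i j B. i \<in> I \<Longrightarrow> j \<in> I \<Longrightarrow> B \<in> P i \<Longrightarrow> B \<in> P j \<Longrightarrow> i = j"
    and rainbow: "\<And>i B. i \<in> I \<Longrightarrow> B \<in> P i \<union> P (s i) \<Longrightarrow> bij_betw (col i) B {..<3}"
    and order: "3 \<le> N" "N mod 3 \<noteq> 2"
begin

definition code :: "'i \<Rightarrow> nat set \<Rightarrow> (nat \<Rightarrow> nat) set" where
  "code i S = linked_code (P i) (P (s i)) (col i -` S)"

lemma optimal_code: "i \<in> I \<Longrightarrow> optimal_code 3 N 5 3 (code i S)"
proof (rule optimal_codeI)
  assume i: "i \<in> I"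
  note members = linked_familyD[OF family]
  have "card (P i) \<noteq> 0"
    using members(5)[OF i] order(1) unfolding parallel_class_def by (simp add: div_eq_0_iff)
  then show "is_code 3 N 5 3 (code i S)"
    unfolding code_def using members(4-6) i by (intro is_code_linked_code) auto
  have "N * (3 - 1) div 3 = 2 * (N div 3)" using order(2) by presburger
  then show "card (code i S) = N * (3 - 1) div 3"
    unfolding code_def using card_linked_code[OF members(5)[OF i] members(5)[OF members(4)[OF i]]] by simp
qed simp_all

lemma card_pattern:
  assumes "bij_betw c B {..<3::nat}" "S \<subseteq> {..<3}"
  shows "card (B \<inter> c -` S) = card S" "c ` (B \<inter> c -` S) = S"
proof -
  have "c ` (B \<inter> c -` S) = c ` B \<inter> S" by auto
  also have "\<dots> = S" using assms unfolding bij_betw_def by (simp add: Int_absorb1)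
  finally show image: "c ` (B \<inter> c -` S) = S" .
  have "inj_on c (B \<inter> c -` S)"
    using bij_betw_imp_inj_on[OF assms(1)] by (rule inj_on_subset) blast
  then show "card (B \<inter> c -` S) = card S" using card_image image by metis
qed

lemma signed_in_code_iff:
  assumes "i \<in> I" "S \<in> even_patterns" and R: "R \<subseteq> B"
  shows "signed B R \<in> code i S \<longleftrightarrow>
    B \<in> P i \<and> even (card R) \<and> S = col i ` R \<or> B \<in> P (s i) \<and> odd (card R) \<and> S = col i ` (B - R)"
proof -
  have pattern: "R' = B \<inter> col i -` S \<longleftrightarrow> even (card R') \<and> S = col i ` R'"
    if "B \<in> P i \<union> P (s i)" "R' \<subseteq> B" for R'
  proof -
    note bij = rainbow[OF assms(1) that(1)]
    have S: "S \<subseteq> {..<3}" "even (card S)" using assms(2) unfolding even_patterns_def by auto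
    have "R' = B \<inter> col i -` (col i ` R')"
      using bij that(2) unfolding bij_betw_def inj_on_def by blast
    then show ?thesis using card_pattern[OF bij S(1)] S(2) by metis
  qed
  have complement: "even (card (B - R)) \<longleftrightarrow> odd (card R)" if "B \<in> P (s i)"
  proof -
    have B: "card B = 3" "finite B"
      using parallel_class_block(2)[OF linked_familyD(5)[OF family linked_familyD(4)[OF family assms(1)]] that]
      by (auto intro: card_ge_0_finite)
    then have "card (B - R) = 3 - card R" "card R \<le> 3"
      using R card_mono[OF B(2) R] by (auto simp: card_Diff_subset finite_subset)
    then show ?thesis by presburger
  qed
  have "R = B - col i -` S \<longleftrightarrow> B - R = B \<inter> col i -` S" "B \<inter> R = R" using R by blast+
  then have "signed B R \<in> code i S \<longleftrightarrow>
      B \<in> P i \<and> R = B \<inter> col i -` S \<or> B \<in> P (s i) \<and> B - R = B \<inter> col i -` S"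
    unfolding code_def signed_in_linked_code_iff by simp
  moreover have "R = B \<inter> col i -` S \<longleftrightarrow> even (card R) \<and> S = col i ` R" if "B \<in> P i"
    using pattern[OF _ R] that by blast
  moreover have "B - R = B \<inter> col i -` S \<longleftrightarrow> odd (card R) \<and> S = col i ` (B - R)" if "B \<in> P (s i)"
    using pattern[of "B - R"] complement[OF that] that by blast
  ultimately show ?thesis by blast
qed

lemma codes_disjoint:
  assumes "i \<in> I" "j \<in> I" "S \<in> even_patterns" "T \<in> even_patterns" "w \<in> code i S" "w \<in> code j T"
  shows "i = j \<and> S = T"
proof -
  have "w \<in> H 3 N 3"
    using optimal_code[OF assms(1)] assms(5) unfolding optimal_code_def is_code_def by blast
  then obtain B R where w: "w = signed B R" "R \<subseteq> B" unfolding H_ternary_eq by blast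
  note left = assms(5)[unfolded w(1) signed_in_code_iff[OF assms(1,3) w(2)]]
    and right = assms(6)[unfolded w(1) signed_in_code_iff[OF assms(2,4) w(2)]]
  note members = linked_familyD[OF family]
  have "i = j"
  proof (cases "even (card R)")
    case False
    then have "s i = s j" using left right unique members(4) assms(1,2) by blast
    then show ?thesis using members(3) assms(1,2) by (simp add: inj_on_eq_iff)
  qed (use left right unique assms(1,2) in blast)
  then show ?thesis using left right by auto
qed

lemma codes_cover:
  assumes "w \<in> H 3 N 3"
  shows "\<exists>i\<in>I. \<exists>S\<in>even_patterns. w \<in> code i S"
proof -
  note members = linked_familyD[OF family]
  obtain B R where w: "w = signed B R" "R \<subseteq> B" "B \<in> triples {..<N}"
    using assms unfolding H_ternary_eq triples_def by blast
  obtain j where j: "j \<in> I" "B \<in> P j" using members(7)[OF w(3)] by blast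
  have "j \<in> s ` I" using bij_betw_imp_surj_on[OF members(2)] j(1) by simp
  then obtain i where i: "i \<in> I" "s i = j" by blast
  have B: "card B = 3" "finite B" using w(3) unfolding triples_def by (auto intro: card_ge_0_finite)
  have pattern: "col k ` R' \<in> even_patterns"
    if "k \<in> I" "B \<in> P k \<union> P (s k)" "R' \<subseteq> B" "even (card R')" for k R'
    using rainbow[OF that(1,2)] that(3,4) card_image[of "col k" R'] inj_on_subset
    unfolding even_patterns_def bij_betw_def by fastforce
  show ?thesis
  proof (cases "even (card R)")
    case True
    then have "w \<in> code j (col j ` R)"
      unfolding w(1) using signed_in_code_iff[OF j(1) pattern w(2)] j w(2) by blast
    then show ?thesis using pattern[OF j(1) _ w(2) True] j by blast
  next
    case False
    have "card (B - R) = 3 - card R" "card R \<le> 3"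
      using B w(2) card_mono[OF B(2) w(2)] by (auto simp: card_Diff_subset finite_subset)
    then have even: "even (card (B - R))" using False by presburger
    then have "w \<in> code i (col i ` (B - R))"
      unfolding w(1) using signed_in_code_iff[OF i(1) pattern w(2)] i j(2) False by blast
    then show ?thesis using pattern[OF i(1) _ _ even] i j(2) by blast
  qed
qed

lemma TOC_exists: "TOC_exists 3 N 5 3"
proof -
  define Z where "Z = (\<lambda>(i, S). code i S) ` (I \<times> even_patterns)"
  have "\<Union>Z = H 3 N 3"
  proof
    show "\<Union>Z \<subseteq> H 3 N 3"
      using optimal_code unfolding Z_def optimal_code_def is_code_def by fastforce
    show "H 3 N 3 \<subseteq> \<Union>Z" using codes_cover unfolding Z_def by fastforce
  qed
  moreover have "optimal_code 3 N 5 3 C" if "C \<in> Z" for C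
    using that optimal_code unfolding Z_def by auto
  moreover have "C \<inter> D = {}" if "C \<in> Z" "D \<in> Z" "C \<noteq> D" for C D
    using that codes_disjoint unfolding Z_def by blast
  ultimately have "is_TOC 3 N 5 3 Z" unfolding is_TOC_def by blast
  then show ?thesis unfolding TOC_exists_def by blast
qed

end

theorem resolved_imp_TOC_exists:
  assumes "resolved N" "3 \<le> N" "N mod 3 \<noteq> 2"
  shows "TOC_exists 3 N 5 3"
proof -
  obtain I :: "nat set" and P s where L: "linked_family {..<N} I P s (triples {..<N})"
    and unique: "\<And>i j B. i \<in> I \<Longrightarrow> j \<in> I \<Longrightarrow> B \<in> P i \<Longrightarrow> B \<in> P j \<Longrightarrow> i = j"
    using resolvedE[OF assms(1)] by metis
  note family = linked_familyD[OF L]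
  have "\<exists>c. \<forall>B\<in>P i \<union> P (s i). bij_betw c B {..<3::nat}" if i: "i \<in> I" for i
  proof -
    have block: "B \<subseteq> {..<N}" "card B = 3" if "B \<in> P i \<union> P (s i)" for B
      using parallel_class_block family(4,5) i that by blast+
    obtain c :: "nat \<Rightarrow> nat" where c: "\<forall>x\<in>{..<N}. c x < 3" "\<forall>B\<in>P i \<union> P (s i). inj_on c B"
      using rainbow_colouring[of "{..<N}" "P i" "P (s i)" 3] family(4,5)[OF i] family(5) block i
      unfolding parallel_class_def by auto
    have "bij_betw c B {..<3}" if "B \<in> P i \<union> P (s i)" for B
    proof -
      have "c ` B \<subseteq> {..<3}" using c(1) block[OF that] by blast
      then show ?thesis
        using c(2) block[OF that] that card_image[of c B] card_subset_eq[of "{..<3}" "c ` B"]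
        unfolding bij_betw_def by auto
    qed
    then show ?thesis by blast
  qed
  then obtain col where "\<And>i B. i \<in> I \<Longrightarrow> B \<in> P i \<union> P (s i) \<Longrightarrow> bij_betw (col i) B {..<3::nat}"
    by metis
  then interpret coloured_family N I P s col
    using L unique assms(2,3) by unfold_locales auto
  show ?thesis by (rule TOC_exists)
qed

section \<open>Base classes developed under a group\<close>

subsection \<open>Group actions\<close>

locale permutation_action =
  fixes X :: "'a set" and G :: "'g set" and mul :: "'g \<Rightarrow> 'g \<Rightarrow> 'g" and act :: "'g \<Rightarrow> 'a \<Rightarrow> 'a"
  assumes finite_points: "finite X" and finite_group: "finite G"
    and act_inj: "g \<in> G \<Longrightarrow> inj_on (act g) X"
    and act_closed: "g \<in> G \<Longrightarrow> x \<in> X \<Longrightarrow> act g x \<in> X"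
    and mult_closed: "g \<in> G \<Longrightarrow> h \<in> G \<Longrightarrow> mul g h \<in> G"
    and mult_right_cancel: "h \<in> G \<Longrightarrow> inj_on (\<lambda>g. mul g h) G"
    and act_mult: "g \<in> G \<Longrightarrow> h \<in> G \<Longrightarrow> x \<in> X \<Longrightarrow> act (mul g h) x = act g (act h x)"
begin

definition orbit :: "'a set set \<Rightarrow> 'a set set" where
  "orbit D = (\<Union>g\<in>G. (`) (act g) ` D)"

lemma orbit_Un: "orbit (D \<union> E) = orbit D \<union> orbit E"
  unfolding orbit_def by blast

lemma act_surj: "g \<in> G \<Longrightarrow> act g ` X = X"
  by (rule endo_inj_surj) (use finite_points act_closed act_inj in auto)

lemma act_parallel_class: "g \<in> G \<Longrightarrow> parallel_class X P \<Longrightarrow> parallel_class X ((`) (act g) ` P)"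
  using parallel_class_image[OF act_inj act_surj] .

lemma act_mult_class:
  assumes "g \<in> G" "h \<in> G" "parallel_class X P"
  shows "(`) (act (mul g h)) ` P = (`) (act g) ` (`) (act h) ` P"
proof -
  have "act (mul g h) ` B = act g ` act h ` B" if "B \<in> P" for B
    unfolding image_image using act_mult[OF assms(1,2)] parallel_class_block(1)[OF assms(3) that]
    by (intro image_cong) auto
  then show ?thesis by (simp add: image_image)
qed

lemma act_meet_once:
  assumes "g \<in> G" "parallel_class X P" "parallel_class X Q" "meet_once P Q"
  shows "meet_once ((`) (act g) ` P) ((`) (act g) ` Q)"
  using parallel_class_block(1)[OF assms(2)] parallel_class_block(1)[OF assms(3)]
  by (intro meet_once_image[OF act_inj[OF assms(1)]] assms(4)) blast+

lemma developed_linked_family: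
  assumes K: "finite K" and b: "\<And>k. k \<in> K \<Longrightarrow> parallel_class X (b k)"
    and c: "\<And>k. k \<in> K \<Longrightarrow> c k \<in> G" "\<And>k. k \<in> K \<Longrightarrow> meet_once (b k) ((`) (act (c k)) ` b k)"
  shows "linked_family X (K \<times> G) (\<lambda>(k, g). (`) (act g) ` b k) (\<lambda>(k, g). (k, mul g (c k)))
    (orbit (\<Union>k\<in>K. b k))"
proof (rule linked_familyI)
  show "inj_on (\<lambda>(k, g). (k, mul g (c k))) (K \<times> G)"
    using inj_onD[OF mult_right_cancel[OF c(1)]] by (intro inj_onI) auto
  fix i assume "i \<in> K \<times> G"
  then obtain k g where i: "i = (k, g)" "k \<in> K" "g \<in> G" by blast
  show "(case i of (k, g) \<Rightarrow> (k, mul g (c k))) \<in> K \<times> G"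
    using i mult_closed c(1) by simp
  show "parallel_class X (case i of (k, g) \<Rightarrow> (`) (act g) ` b k)"
    using act_parallel_class[OF i(3) b[OF i(2)]] i(1) by simp
  show "meet_once (case i of (k, g) \<Rightarrow> (`) (act g) ` b k)
      (case case i of (k, g) \<Rightarrow> (k, mul g (c k)) of (k, g) \<Rightarrow> (`) (act g) ` b k)"
    using act_meet_once[OF i(3) b[OF i(2)] act_parallel_class[OF c(1)[OF i(2)] b[OF i(2)]] c(2)[OF i(2)]]
    by (simp add: i(1) act_mult_class[OF i(3) c(1)[OF i(2)] b[OF i(2)]])
qed (use K finite_group in \<open>auto simp: orbit_def\<close>)

lemma triple_is_image:
  assumes B: "B \<in> triples X" and h: "h \<in> G" and xy: "x \<in> X" "y \<in> X" "x \<noteq> y"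
    and hit: "act h x \<in> B" "act h y \<in> B"
  shows "\<exists>z\<in>X - {x, y}. B = act h ` {x, y, z}"
proof -
  note inj = act_inj[OF h]
  have "B \<subseteq> act h ` X" using B act_surj[OF h] unfolding triples_def by simp
  then obtain C where C: "C \<subseteq> X" "B = act h ` C" by (rule subset_imageE)
  have "card C = 3" using B C card_image[OF inj_on_subset[OF inj C(1)]] unfolding triples_def by simp
  moreover have "x \<in> C" "y \<in> C" using hit xy C inj by (auto simp: inj_on_image_mem_iff)
  ultimately obtain z where "C = {x, y, z}" "z \<noteq> x" "z \<noteq> y"
    using xy(3) unfolding card_3_iff by auto
  then show ?thesis using C by blast
qed

end

subsection \<open>Affine groups\<close>

text \<open>A triple \<open>(m, t, l)\<close> stands for \<open>x \<mapsto> m x + t\<close> modulo \<open>p\<close>, combined with a translation by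
  \<open>l\<close> modulo 2.\<close>

type_synonym affine = "int \<times> int \<times> int"

definition affine_mult :: "int \<Rightarrow> affine \<Rightarrow> affine \<Rightarrow> affine" where
  "affine_mult p = (\<lambda>(m, t, l) (m', t', l'). (m * m' mod p, (m * t' + t) mod p, (l + l') mod 2))"

definition multipliers :: "int \<Rightarrow> int \<Rightarrow> int set" where
  "multipliers p g = range (\<lambda>j::nat. g ^ j mod p)"

locale affine_group =
  fixes p g :: int and r :: nat and L :: "int set"
  assumes p: "1 < p" and r: "0 < r" "g ^ r mod p = 1" and L: "L = {0} \<or> L = {0, 1}"
begin

abbreviation G :: "affine set" where
  "G \<equiv> multipliers p g \<times> {0..<p} \<times> L"

lemma multipliers_one: "1 \<in> multipliers p g"
  unfolding multipliers_def by (rule image_eqI[of _ _ 0]) (use p in simp_all)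

lemma multipliers_mult:
  assumes "m \<in> multipliers p g" "m' \<in> multipliers p g"
  shows "m * m' mod p \<in> multipliers p g"
proof -
  obtain i j where "m = g ^ i mod p" "m' = g ^ j mod p" using assms unfolding multipliers_def by blast
  then have "m * m' mod p = g ^ (i + j) mod p" by (simp add: power_add mod_mult_eq)
  then show ?thesis unfolding multipliers_def by blast
qed

lemma multipliers_eq: "multipliers p g = (\<lambda>j. g ^ j mod p) ` {..<r}"
proof -
  have period: "g ^ (r * k) mod p = 1" for k
    using r(2) p by (metis power_mod power_mult power_one mod_pos_pos_trivial zero_le_one)
  have "g ^ j mod p \<in> (\<lambda>j. g ^ j mod p) ` {..<r}" for j
  proof (rule image_eqI)
    have "g ^ j = g ^ (r * (j div r)) * g ^ (j mod r)" by (simp flip: power_add)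
    then show "g ^ j mod p = g ^ (j mod r) mod p"
      using period[of "j div r"] by (metis mod_mult_left_eq mult_1)
  qed (use r(1) in simp)
  then show ?thesis unfolding multipliers_def by auto
qed

lemma finite_group: "finite G"
  using L unfolding multipliers_eq by auto

lemma card_group_le: "card G \<le> r * (nat p * card L)"
  using card_image_le[of "{..<r}" "\<lambda>j. g ^ j mod p"]
  unfolding card_cartesian_product multipliers_eq by simp

lemma coprime_multiplier: "m \<in> multipliers p g \<Longrightarrow> coprime p m"
proof -
  have "coprime (g ^ r) p" using coprime_mod_left_iff[of p "g ^ r"] r(2) p by simp
  then have "coprime g p" using r(1) by simp
  then show "m \<in> multipliers p g \<Longrightarrow> coprime p m"
    using p unfolding multipliers_def by (auto simp: coprime_commute)
qed

lemma multiplier_cancel: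
  assumes "m \<in> multipliers p g" "(m * x + t) mod p = (m * y + t) mod p"
  shows "x mod p = y mod p"
proof -
  have "p dvd m * (x - y)" using assms(2) by (simp add: mod_eq_dvd_iff algebra_simps)
  then show ?thesis
    using coprime_multiplier[OF assms(1)] by (simp add: coprime_dvd_mult_right_iff mod_eq_dvd_iff)
qed

lemma affine_mult_closed: "f \<in> G \<Longrightarrow> h \<in> G \<Longrightarrow> affine_mult p f h \<in> G"
  using multipliers_mult p L unfolding affine_mult_def by auto

lemma affine_mult_right_cancel:
  assumes h: "h \<in> G"
  shows "inj_on (\<lambda>f. affine_mult p f h) G"
proof (rule inj_onI)
  fix f f' assume f: "f \<in> G" "f' \<in> G" and eq: "affine_mult p f h = affine_mult p f' h"
  obtain m t l n u k where e: "f = (m, t, l)" "h = (n, u, k)" by (cases f, cases h)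
  obtain m' t' l' where e': "f' = (m', t', l')" by (cases f')
  have range: "m mod p = m" "m' mod p = m'" "t mod p = t" "t' mod p = t'" "l mod 2 = l" "l' mod 2 = l'"
    using f L unfolding e e' multipliers_def by auto
  have "m mod p = m' mod p"
    using multiplier_cancel[of n m 0 m'] h eq unfolding e e' affine_mult_def by (simp add: mult.commute)
  then have "m = m'" unfolding range .
  moreover from this have "t mod p = t' mod p"
    using eq unfolding e e' affine_mult_def by (simp add: mod_eq_dvd_iff)
  moreover have "l mod 2 = l' mod 2"
    using eq unfolding e e' affine_mult_def by (simp add: mod_eq_dvd_iff)
  ultimately show "f = f'" unfolding e e' range by simp
qed

lemma affine_mult_mod:
  "(m * m' mod p * x + (m * t' + t) mod p) mod p = (m * ((m' * x + t') mod p) + t) mod p"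
proof -
  have "(m * m' mod p * x + (m * t' + t) mod p) mod p = (m * m' * x + (m * t' + t)) mod p"
    by (intro mod_add_cong mod_mult_cong) simp_all
  also have "\<dots> = (m * (m' * x + t') + t) mod p" by (simp add: algebra_simps)
  also have "\<dots> = (m * ((m' * x + t') mod p) + t) mod p" by (intro mod_add_cong mod_mult_cong) simp_all
  finally show ?thesis .
qed

end

definition level_act :: "int \<Rightarrow> affine \<Rightarrow> int \<Rightarrow> int" where
  "level_act p = (\<lambda>(m, t, l) x. (m * x + t) mod p + p * ((x div p + l) mod 2))"

text \<open>The points \<open>q\<close> and \<open>q + 1\<close> are fixed.\<close>

definition fixing_act :: "int \<Rightarrow> affine \<Rightarrow> int \<Rightarrow> int" where
  "fixing_act q = (\<lambda>(m, t, l) x. if x < q then (m * x + t) mod q else x)"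

locale level_group = affine_group p g r "{0, 1}" for p g r
begin

lemma level_act_mod: "level_act p (m, t, l) x mod p = (m * x + t) mod p"
  and level_act_div: "level_act p (m, t, l) x div p = (x div p + l) mod 2"
  using p unfolding level_act_def by auto

lemma div_level: "x \<in> {0..<2 * p} \<Longrightarrow> x div p = (if x < p then 0 else 1)"
  by (auto intro: int_div_pos_eq[of _ _ _ "x - p"])

lemma level_eqI: "x mod p = y mod p \<Longrightarrow> x div p = y div p \<Longrightarrow> x = (y :: int)"
  by (metis div_mult_mod_eq)

sublocale permutation_action "{0..<2 * p}" G "affine_mult p" "level_act p"
proof
  show "finite {0..<2 * p}" by simp
  show "finite G" by (rule finite_group)
  show "affine_mult p f h \<in> G" if "f \<in> G" "h \<in> G" for f h using that by (rule affine_mult_closed)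
  show "inj_on (\<lambda>f. affine_mult p f h) G" if "h \<in> G" for h using that by (rule affine_mult_right_cancel)
  fix h assume h: "h \<in> G"
  obtain m t l where e: "h = (m, t, l)" "m \<in> multipliers p g" using h by blast
  show "inj_on (level_act p h) {0..<2 * p}"
  proof (rule inj_onI)
    fix x y assume xy: "x \<in> {0..<2 * p}" "y \<in> {0..<2 * p}" "level_act p h x = level_act p h y"
    have "(m * x + t) mod p = (m * y + t) mod p"
      using arg_cong[OF xy(3), of "\<lambda>z. z mod p"] unfolding e(1) level_act_mod .
    then have "x mod p = y mod p" by (rule multiplier_cancel[OF e(2)])
    moreover have "(x div p + l) mod 2 = (y div p + l) mod 2"
      using arg_cong[OF xy(3), of "\<lambda>z. z div p"] unfolding e(1) level_act_div .
    then have "x div p mod 2 = y div p mod 2" by (simp only: mod_eq_dvd_iff) simp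
    then have "x div p = y div p" using xy(1,2) by (simp add: div_level split: if_splits)
    ultimately show "x = y" by (rule level_eqI)
  qed
  show "level_act p h x \<in> {0..<2 * p}" if "x \<in> {0..<2 * p}" for x
  proof -
    have "0 \<le> (m * x + t) mod p" "(m * x + t) mod p < p" using p by auto
    moreover have "(x div p + l) mod 2 = 0 \<or> (x div p + l) mod 2 = 1" by (simp add: mod2_eq_if)
    ultimately show ?thesis unfolding e(1) level_act_def by (elim disjE) auto
  qed
  fix f x assume f: "f \<in> G"
  obtain m' t' l' where e': "f = (m', t', l')" by (cases f)
  show "level_act p (affine_mult p h f) x = level_act p h (level_act p f x)"
  proof (rule level_eqI)
    show "level_act p (affine_mult p h f) x mod p = level_act p h (level_act p f x) mod p"
      unfolding e(1) e' affine_mult_def prod.case level_act_mod affine_mult_mod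
      by (metis level_act_mod mod_add_left_eq mod_mult_right_eq)
    show "level_act p (affine_mult p h f) x div p = level_act p h (level_act p f x) div p"
      unfolding e(1) e' affine_mult_def prod.case level_act_div by (simp add: mod_simps algebra_simps)
  qed
qed

end

locale fixing_group = affine_group q g r "{0}" for q g r
begin

lemma fixing_act_simps:
  "x < q \<Longrightarrow> fixing_act q (m, t, l) x = (m * x + t) mod q"
  "\<not> x < q \<Longrightarrow> fixing_act q h x = x"
  unfolding fixing_act_def by (auto simp: case_prod_unfold)

lemma fixing_act_less: "fixing_act q h x < q \<longleftrightarrow> x < q"
  using p unfolding fixing_act_def by (auto simp: case_prod_unfold)

sublocale permutation_action "{0..<q + 2}" G "affine_mult q" "fixing_act q"
proof
  show "finite {0..<q + 2}" by simp
  show "finite G" by (rule finite_group)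
  show "affine_mult q f h \<in> G" if "f \<in> G" "h \<in> G" for f h using that by (rule affine_mult_closed)
  show "inj_on (\<lambda>f. affine_mult q f h) G" if "h \<in> G" for h using that by (rule affine_mult_right_cancel)
  fix h assume h: "h \<in> G"
  obtain m t l where e: "h = (m, t, l)" "m \<in> multipliers q g" using h by blast
  show "inj_on (fixing_act q h) {0..<q + 2}"
  proof (rule inj_onI)
    fix x y assume xy: "x \<in> {0..<q + 2}" "y \<in> {0..<q + 2}" "fixing_act q h x = fixing_act q h y"
    then have "x < q \<longleftrightarrow> y < q" using fixing_act_less by metis
    then show "x = y"
      using xy multiplier_cancel[OF e(2), of x t y]
      unfolding e(1) by (cases "x < q") (simp_all add: fixing_act_simps)
  qed
  show "fixing_act q h x \<in> {0..<q + 2}" if "x \<in> {0..<q + 2}" for x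
  proof -
    have "0 \<le> (m * x + t) mod q" "(m * x + t) mod q < q" using p by auto
    then show ?thesis using that unfolding e(1) fixing_act_def by (auto intro: less_trans)
  qed
  fix f x assume f: "f \<in> G"
  obtain m' t' l' where e': "f = (m', t', l')" by (cases f)
  show "fixing_act q (affine_mult q h f) x = fixing_act q h (fixing_act q f x)"
  proof (cases "x < q")
    case True
    then show ?thesis
      using fixing_act_less[of f x] unfolding e(1) e' affine_mult_def prod.case
      by (simp add: fixing_act_simps affine_mult_mod)
  qed (simp add: fixing_act_simps)
qed

end

subsection \<open>Sorting\<close>

text \<open>The tables below are checked by rewriting. Branching on a comparison goes through the patterns
  \<open>True\<close> and \<open>False\<close> here, because the simplifier normalises the branches of an \<open>if\<close> or \<open>case\<close>
  afresh, which would traverse both lists at every step.\<close>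

fun merge_from :: "bool \<Rightarrow> 'a::linorder \<Rightarrow> 'a list \<Rightarrow> 'a \<Rightarrow> 'a list \<Rightarrow> 'a list" where
  "merge_from True x [] y ys = x # y # ys"
| "merge_from True x (x' # xs) y ys = x # merge_from (x' \<le> y) x' xs y ys"
| "merge_from False x xs y [] = y # x # xs"
| "merge_from False x xs y (y' # ys) = y # merge_from (x \<le> y') x xs y' ys"

fun merge :: "'a::linorder list \<Rightarrow> 'a list \<Rightarrow> 'a list" where
  "merge [] ys = ys"
| "merge xs [] = xs"
| "merge (x # xs) (y # ys) = merge_from (x \<le> y) x xs y ys"

fun merge_adjacent :: "'a::linorder list list \<Rightarrow> 'a list list" where
  "merge_adjacent (xs # ys # xss) = merge xs ys # merge_adjacent xss"
| "merge_adjacent xss = xss"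

lemma length_merge_adjacent [termination_simp]:
  "length (merge_adjacent xss) = (length xss + 1) div 2"
  by (induction xss rule: merge_adjacent.induct) auto

fun merge_all :: "'a::linorder list list \<Rightarrow> 'a list" where
  "merge_all [] = []"
| "merge_all [xs] = xs"
| "merge_all xss = merge_all (merge_adjacent xss)"

definition merge_sort :: "'a::linorder list \<Rightarrow> 'a list" where
  "merge_sort xs = merge_all (map (\<lambda>x. [x]) xs)"

lemma mset_merge_from: "mset (merge_from b x xs y ys) = mset (x # xs) + mset (y # ys)"
  by (induction b x xs y ys rule: merge_from.induct) auto

lemma mset_merge: "mset (merge xs ys) = mset xs + mset ys"
  by (cases "(xs, ys)" rule: merge.cases) (simp_all add: mset_merge_from)

lemma mset_merge_adjacent: "mset (concat (merge_adjacent xss)) = mset (concat xss)"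
  by (induction xss rule: merge_adjacent.induct) (auto simp: mset_merge)

lemma mset_merge_all: "mset (merge_all xss) = mset (concat xss)"
proof (induction xss rule: merge_all.induct)
  case (3 xs ys xss)
  then show ?case using mset_merge_adjacent[of "xs # ys # xss"] by simp
qed auto

lemma mset_merge_sort: "mset (merge_sort xs) = mset xs"
proof -
  have "concat (map (\<lambda>x. [x]) xs) = xs" by (induction xs) auto
  then show ?thesis unfolding merge_sort_def mset_merge_all by simp
qed

lemma set_merge_sort: "set (merge_sort xs) = set xs"
  by (metis mset_merge_sort set_mset_mset)

fun increasing :: "'a::linorder list \<Rightarrow> bool" where
  "increasing (x # y # xs) \<longleftrightarrow> x < y \<and> increasing (y # xs)"
| "increasing _ \<longleftrightarrow> True"

lemma increasing_imp_distinct: "increasing xs \<Longrightarrow> distinct xs"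
proof -
  have "increasing xs \<Longrightarrow> sorted_wrt (<) xs"
    by (induction xs rule: increasing.induct) (auto intro: less_trans)
  then show "increasing xs \<Longrightarrow> distinct xs" using strict_sorted_iff by blast
qed

lemma distinct_if_increasing_merge_sort: "increasing (merge_sort xs) \<Longrightarrow> distinct xs"
  using increasing_imp_distinct mset_merge_sort mset_eq_imp_distinct_iff by metis

fun consecutive :: "int \<Rightarrow> int list \<Rightarrow> int \<Rightarrow> bool" where
  "consecutive a [] b \<longleftrightarrow> a = b"
| "consecutive a (x # xs) b \<longleftrightarrow> x = a \<and> consecutive (a + 1) xs b"

lemma consecutive_imp_upto: "consecutive a xs b \<Longrightarrow> xs = [a..b - 1] \<and> a \<le> b"
proof (induction a xs b rule: consecutive.induct)
  case (2 a x xs b)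
  then have "xs = [a + 1..b - 1]" "x = a" "a + 1 \<le> b" by auto
  then show ?case by (simp add: upto_rec1)
qed auto

subsection \<open>Lists of blocks\<close>

type_synonym block = "int \<times> int \<times> int"

definition block_set :: "block \<Rightarrow> int set" where
  "block_set = (\<lambda>(x, y, z). {x, y, z})"

definition points :: "block list \<Rightarrow> int list" where
  "points bl = concat (map (\<lambda>(x, y, z). [x, y, z]) bl)"

definition move :: "(int \<Rightarrow> int) \<Rightarrow> block list \<Rightarrow> block list" where
  "move f bl = map (\<lambda>(x, y, z). (f x, f y, f z)) bl"

definition edge_code :: "int \<Rightarrow> int \<Rightarrow> int \<Rightarrow> int" where
  "edge_code n x y = (if x < y then x * n + y else y * n + x)"

definition edges :: "int \<Rightarrow> block list \<Rightarrow> int list" where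
  "edges n bl = concat (map (\<lambda>(x, y, z). [edge_code n x y, edge_code n y z, edge_code n z x]) bl)"

definition parallel_check :: "int \<Rightarrow> block list \<Rightarrow> bool" where
  "parallel_check n bl \<longleftrightarrow> consecutive (n mod 3) (merge_sort (points bl)) n"

definition meet_once_check :: "int \<Rightarrow> block list \<Rightarrow> block list \<Rightarrow> bool" where
  "meet_once_check n bl bl' \<longleftrightarrow> increasing (merge_sort (edges n bl @ edges n bl'))"

lemma edge_code_commute: "edge_code n x y = edge_code n y x"
  unfolding edge_code_def by simp

lemma set_points: "set (points bl) = \<Union>(block_set ` set bl)"
  unfolding points_def block_set_def by auto

lemma points_append: "points (bl @ bl') = points bl @ points bl'"
  unfolding points_def by simp

lemma length_points: "length (points bl) = 3 * length bl"
  unfolding points_def by (induction bl) auto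

lemma block_set_move: "block_set ` set (move f bl) = (`) f ` block_set ` set bl"
  unfolding move_def block_set_def by (auto simp: image_image case_prod_unfold)

lemma parallel_check_points:
  assumes "parallel_check n bl"
  shows "set (points bl) = {n mod 3..<n}"
proof -
  have "merge_sort (points bl) = [n mod 3..n - 1]"
    using assms consecutive_imp_upto unfolding parallel_check_def by blast
  then have "set (points bl) = set [n mod 3..n - 1]" by (metis set_merge_sort)
  moreover have "set [a..n - 1] = {a..<n}" for a by auto
  ultimately show ?thesis by (simp only:)
qed

lemma parallel_check_sound:
  assumes "parallel_check n bl"
  shows "parallel_class {0..<n} (block_set ` set bl)"
proof -
  have sorted: "merge_sort (points bl) = [n mod 3..n - 1]" and "n mod 3 \<le> n"
    using assms consecutive_imp_upto unfolding parallel_check_def by blast+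
  then have "0 \<le> n" by (metis dual_order.trans pos_mod_sign zero_less_numeral)
  have points: "\<Union>(block_set ` set bl) = {n mod 3..<n}"
    using parallel_check_points[OF assms] unfolding set_points .
  have "3 * length bl = size (mset [n mod 3..n - 1])"
    unfolding sorted[symmetric] mset_merge_sort by (simp add: length_points)
  then have "3 * int (length bl) = n - n mod 3"
    using \<open>n mod 3 \<le> n\<close> by simp
  then have length: "length bl = card {0..<n} div 3"
    using \<open>0 \<le> n\<close> by (auto simp: nat_div_distrib minus_mod_eq_mult_div)
  show ?thesis
  proof (rule parallel_class_coverI[where Y = "{0..<n mod 3}"])
    show "card (block_set ` set bl) \<le> card {0..<n} div 3"
      unfolding length[symmetric] by (metis card_image_le card_length finite_set order_trans)
    show "card {0..<n mod 3} \<le> card {0..<n} mod 3"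
      using \<open>0 \<le> n\<close> by (simp add: nat_mod_distrib)
    show "{0..<n} - {0..<n mod 3} \<subseteq> \<Union>(block_set ` set bl)"
      unfolding points by auto
    fix B assume B: "B \<in> block_set ` set bl"
    then have "B \<subseteq> {n mod 3..<n}" using points by blast
    also have "\<dots> \<subseteq> {0..<n}" by (simp add: subset_iff) (metis dual_order.trans pos_mod_sign zero_less_numeral)
    finally show "B \<subseteq> {0..<n}" .
    show "card B \<le> 3"
      using B unfolding block_set_def by (auto simp: card_insert_if)
  qed simp_all
qed

lemma parallel_check_subset: "parallel_check n bl \<Longrightarrow> set (points bl) \<subseteq> {0..<n}"
  using parallel_class_block(1)[OF parallel_check_sound] unfolding set_points by blast

lemma meet_once_check_sound:
  assumes "meet_once_check n bl bl'"
  shows "meet_once (block_set ` set bl) (block_set ` set bl')"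
proof (rule meet_onceI, rule ccontr)
  fix B C x y
  assume B: "B \<in> block_set ` set bl" and C: "C \<in> block_set ` set bl'"
    and xy: "x \<in> B" "x \<in> C" "y \<in> B" "y \<in> C" "x \<noteq> y"
  have edge: "edge_code n x y \<in> set (edges n bl)" if D: "D \<in> block_set ` set bl" "x \<in> D" "y \<in> D" for D bl
  proof -
    obtain a b c where abc: "(a, b, c) \<in> set bl" "D = {a, b, c}"
      using D(1) unfolding block_set_def by auto
    then have "edge_code n x y \<in> {edge_code n a b, edge_code n b c, edge_code n c a}"
      using D(2,3) xy(5) edge_code_commute[of n] by auto
    then show ?thesis using abc(1) unfolding edges_def by force
  qed
  have "distinct (edges n bl @ edges n bl')"
    using assms distinct_if_increasing_merge_sort unfolding meet_once_check_def by blast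
  then show False using edge[OF B xy(1,3)] edge[OF C xy(2,4)] by auto
qed

subsection \<open>Normal forms\<close>

text \<open>\<open>normalise x y\<close> is a group element sending \<open>x\<close> to 0 and \<open>y\<close> to a representative of its
  orbit under the stabiliser of 0. The code \<open>n d + z\<close> stands for the triple \<open>{0, d, z}\<close>.\<close>

definition orderings :: "block \<Rightarrow> block list" where
  "orderings = (\<lambda>(x, y, z). [(x, y, z), (y, x, z), (x, z, y), (z, x, y), (y, z, x), (z, y, x)])"

definition normal_codes ::
    "('g \<Rightarrow> int \<Rightarrow> int) \<Rightarrow> int \<Rightarrow> (int \<Rightarrow> int \<Rightarrow> 'g option) \<Rightarrow> block list \<Rightarrow> int list" where
  "normal_codes act n normalise bl = concat (map (\<lambda>(x, y, z).
     case normalise x y of None \<Rightarrow> [] | Some h \<Rightarrow> [n * act h y + act h z]) (concat (map orderings bl)))"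

definition all_codes :: "int \<Rightarrow> int list \<Rightarrow> int list" where
  "all_codes n reps =
     concat (map (\<lambda>d. [n * d + 1..n * d + d - 1] @ [n * d + d + 1..n * d + n - 1]) reps)"

definition cover_check ::
    "('g \<Rightarrow> int \<Rightarrow> int) \<Rightarrow> int \<Rightarrow> (int \<Rightarrow> int \<Rightarrow> 'g option) \<Rightarrow> int list \<Rightarrow> block list \<Rightarrow> bool" where
  "cover_check act n normalise reps bl \<longleftrightarrow>
     remdups_adj (merge_sort (normal_codes act n normalise bl)) = all_codes n reps"

lemma block_set_orderings: "(x, y, z) \<in> set (orderings b) \<Longrightarrow> block_set b = {x, y, z}"
  unfolding orderings_def block_set_def by (cases b) auto

lemma normal_codesE:
  assumes "e \<in> set (normal_codes act n normalise bl)"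
  obtains b x y z h where "b \<in> set bl" "block_set b = {x, y, z}" "normalise x y = Some h"
    "e = n * act h y + act h z"
proof -
  obtain b w where b: "b \<in> set bl" "w \<in> set (orderings b)" and e: "e \<in> set (case w of (x, y, z) \<Rightarrow>
      case normalise x y of None \<Rightarrow> [] | Some h \<Rightarrow> [n * act h y + act h z])"
    using assms unfolding normal_codes_def set_concat set_map by blast
  obtain x y z where "w = (x, y, z)" by (cases w)
  then show thesis
    using that[OF b(1) block_set_orderings] b(2) e by (cases "normalise x y") auto
qed

lemma cover_check_sound:
  assumes action: "permutation_action {0..<n} G mul act"
    and check: "cover_check act n normalise reps bl" and points: "set (points bl) \<subseteq> {0..<n}"
    and normalise: "\<And>x y h. x \<in> {0..<n} \<Longrightarrow> normalise x y = Some h \<Longrightarrow> h \<in> G \<and> act h x = 0"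
    and cover: "\<And>B. B \<in> T \<Longrightarrow> \<exists>h\<in>G. \<exists>d\<in>set reps. act h 0 \<in> B \<and> act h d \<in> B"
    and T: "T \<subseteq> triples {0..<n}" and reps: "set reps \<subseteq> {1..<n}"
  shows "T \<subseteq> permutation_action.orbit G act (block_set ` set bl)"
proof
  interpret permutation_action "{0..<n}" G mul act by (rule action)
  fix B assume "B \<in> T"
  then obtain h d where h: "h \<in> G" "d \<in> set reps" "act h 0 \<in> B" "act h d \<in> B" using cover by blast
  have "d \<in> {1..<n}" using h(2) reps by blast
  then have d: "0 \<in> {0..<n}" "d \<in> {0..<n}" "0 \<noteq> d" by auto
  have "B \<in> triples {0..<n}" using T \<open>B \<in> T\<close> by blast
  then obtain z where z: "z \<in> {0..<n} - {0, d}" "B = act h ` {0, d, z}"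
    using triple_is_image[OF _ h(1) d h(3,4)] by blast
  then have "n * d + z \<in> set (all_codes n reps)"
    using h(2) unfolding all_codes_def by (auto intro!: bexI[of _ d])
  then have "n * d + z \<in> set (normal_codes act n normalise bl)"
    using check unfolding cover_check_def by (metis remdups_adj_set set_merge_sort)
  then obtain b x y w k where b: "b \<in> set bl" "block_set b = {x, y, w}" "normalise x y = Some k"
    and code: "n * d + z = n * act k y + act k w" by (rule normal_codesE)
  have xyw: "{x, y, w} \<subseteq> {0..<n}" using points b(1,2) unfolding set_points by blast
  then have k: "k \<in> G" "act k x = 0" using normalise b(3) by auto
  have "act k y \<in> {0..<n}" "act k w \<in> {0..<n}" using act_closed[OF k(1)] xyw by auto
  then have "d = act k y" "z = act k w"
    using arg_cong[OF code, of "\<lambda>e. e div n"] arg_cong[OF code, of "\<lambda>e. e mod n"] z(1) d by auto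
  then have "B = act h ` act k ` block_set b" unfolding z(2) b(2) using k(2) by simp
  also have "\<dots> = act (mul h k) ` block_set b"
    unfolding image_image b(2) using act_mult[OF h(1) k(1)] xyw by (intro image_cong) auto
  finally show "B \<in> orbit (block_set ` set bl)"
    using mult_closed[OF h(1) k(1)] b(1) unfolding orbit_def by blast
qed

definition base_check :: "int \<Rightarrow> ('g \<Rightarrow> int \<Rightarrow> int) \<Rightarrow> (block list \<times> 'g) list \<Rightarrow> bool" where
  "base_check n act cs \<longleftrightarrow>
     list_all (\<lambda>(bl, c). parallel_check n bl \<and> meet_once_check n bl (move (act c) bl)) cs"

lemma base_check_points:
  assumes "base_check n act cs"
  shows "set (points (concat (map fst cs))) \<subseteq> {0..<n}"
proof -
  have "parallel_check n bl" if "(bl, c) \<in> set cs" for bl c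
    using assms that unfolding base_check_def list_all_iff by auto
  then have "set (points bl) \<subseteq> {0..<n}" if "(bl, c) \<in> set cs" for bl c
    using parallel_check_subset that by blast
  then show ?thesis unfolding set_points by fastforce
qed

lemma base_linked_family:
  assumes action: "permutation_action {0..<n} G mul act"
    and check: "base_check n act cs" and shifts: "snd ` set cs \<subseteq> G"
  shows "linked_family {0..<n} ({..<length cs} \<times> G)
    (\<lambda>(k, g). (`) (act g) ` block_set ` set (fst (cs ! k))) (\<lambda>(k, g). (k, mul g (snd (cs ! k))))
    (permutation_action.orbit G act (block_set ` set (concat (map fst cs))))"
proof -
  interpret permutation_action "{0..<n}" G mul act by (rule action)
  define b where "b k = block_set ` set (fst (cs ! k))" for k
  define c where "c k = snd (cs ! k)" for k
  have nth: "(fst (cs ! k), c k) \<in> set cs" if "k \<in> {..<length cs}" for k using that by (simp add: c_def)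
  have "linked_family {0..<n} ({..<length cs} \<times> G) (\<lambda>(k, g). (`) (act g) ` b k)
      (\<lambda>(k, g). (k, mul g (c k))) (orbit (\<Union>k\<in>{..<length cs}. b k))"
  proof (rule developed_linked_family)
    fix k assume k: "k \<in> {..<length cs}"
    have "parallel_check n (fst (cs ! k))"
      and meet: "meet_once_check n (fst (cs ! k)) (move (act (c k)) (fst (cs ! k)))"
      using check nth[OF k] unfolding base_check_def list_all_iff by auto
    then show "parallel_class {0..<n} (b k)" unfolding b_def by (intro parallel_check_sound)
    show "meet_once (b k) ((`) (act (c k)) ` b k)"
      using meet_once_check_sound[OF meet] unfolding b_def block_set_move .
    show "c k \<in> G" using shifts nth[OF k] by force
  qed simp
  moreover have "(\<Union>k\<in>{..<length cs}. b k) = block_set ` set (concat (map fst cs))"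
  proof -
    have "set cs = (!) cs ` {..<length cs}" by (auto simp: set_conv_nth)
    then show ?thesis unfolding b_def by (simp add: image_UN)
  qed
  ultimately show ?thesis unfolding b_def c_def by simp
qed

subsection \<open>Orders from tables\<close>

fun powers :: "int \<Rightarrow> int \<Rightarrow> int \<Rightarrow> nat \<Rightarrow> int list" where
  "powers p g m 0 = []"
| "powers p g m (Suc n) = m # powers p g (m * g mod p) n"

fun lookup :: "(int \<times> 'a) list \<Rightarrow> int \<Rightarrow> 'a option"
  and lookup_if :: "bool \<Rightarrow> 'a \<Rightarrow> (int \<times> 'a) list \<Rightarrow> int \<Rightarrow> 'a option" where
  "lookup [] k = None"
| "lookup ((k', v) # ps) k = lookup_if (k = k') v ps k"
| "lookup_if True v ps k = Some v"
| "lookup_if False v ps k = lookup ps k"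

text \<open>The difference \<open>m d\<close>, with \<open>d\<close> a representative, is listed together with the inverse of \<open>m\<close>.\<close>

definition difference_table :: "int \<Rightarrow> int \<Rightarrow> nat \<Rightarrow> int list \<Rightarrow> (int \<times> int) list" where
  "difference_table p g r reps = (let ms = powers p g 1 r in
     concat (map (\<lambda>d. map (\<lambda>(m, m'). (m * d mod p, m')) (zip ms (hd ms # rev (tl ms)))) reps))"

definition difference_check :: "int \<Rightarrow> (int \<times> int) list \<Rightarrow> bool" where
  "difference_check p table \<longleftrightarrow>
     consecutive 1 (merge_sort (concat (map (\<lambda>(\<delta>, _). [\<delta>, - \<delta> mod p]) table))) p"

definition affine_check :: "int \<Rightarrow> int \<Rightarrow> nat \<Rightarrow> int list \<Rightarrow> int list \<Rightarrow> affine list \<Rightarrow> bool" where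
  "affine_check p g r levels reps cs \<longleftrightarrow> 1 < p \<and> 0 < r \<and> g ^ r mod p = 1 \<and>
     list_all (\<lambda>d. 1 \<le> d \<and> d < p) reps \<and> difference_check p (difference_table p g r reps) \<and>
     list_all (\<lambda>(m, t, l). m \<in> set (powers p g 1 r) \<and> 0 \<le> t \<and> t < p \<and> l \<in> set levels) cs"

lemma set_powers: "set (powers p g (g ^ i mod p) n) \<subseteq> multipliers p g"
proof (induction n arbitrary: i)
  case (Suc n)
  have "g ^ i mod p * g mod p = g ^ Suc i mod p" by (simp add: mod_simps mult.commute)
  then show ?case using Suc.IH[of "Suc i"] unfolding powers.simps multipliers_def by auto
qed simp

lemma lookup_SomeD:
  "lookup ps k = Some v \<Longrightarrow> (k, v) \<in> set ps"
  "lookup_if b w ps k = Some v \<Longrightarrow> b \<and> v = w \<or> (k, v) \<in> set ps"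
  by (induction ps k and b w ps k rule: lookup_lookup_if.induct) auto

context affine_group
begin

lemma powers_subset: "set (powers p g 1 r) \<subseteq> multipliers p g"
  using set_powers[of p g 0 r] p by simp

lemma difference_table_subset:
  assumes "(\<delta>, m') \<in> set (difference_table p g r reps)"
  shows "m' \<in> multipliers p g" "\<exists>m\<in>multipliers p g. \<exists>d\<in>set reps. \<delta> = m * d mod p"
proof -
  let ?ms = "powers p g 1 r"
  obtain d m where md: "d \<in> set reps" "(m, m') \<in> set (zip ?ms (hd ?ms # rev (tl ?ms)))" "\<delta> = m * d mod p"
    using assms unfolding difference_table_def Let_def by auto
  have "?ms \<noteq> []" using r(1) by (cases r) auto
  then have "set (hd ?ms # rev (tl ?ms)) = set ?ms" by (cases ?ms) auto
  then have "m \<in> set ?ms" "m' \<in> set ?ms" using set_zip_leftD[OF md(2)] set_zip_rightD[OF md(2)] by auto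
  then show "m' \<in> multipliers p g" "\<exists>m\<in>multipliers p g. \<exists>d\<in>set reps. \<delta> = m * d mod p"
    using powers_subset md by blast+
qed

lemma difference_check_sound:
  assumes check: "difference_check p (difference_table p g r reps)" and uv: "u mod p \<noteq> v mod p"
  shows "\<exists>m\<in>multipliers p g. \<exists>d\<in>set reps. (v - u) mod p = m * d mod p \<or> (u - v) mod p = m * d mod p"
proof -
  let ?ds = "concat (map (\<lambda>(\<delta>, _). [\<delta>, - \<delta> mod p]) (difference_table p g r reps))"
  have "merge_sort ?ds = [1..p - 1]"
    using check consecutive_imp_upto unfolding difference_check_def by blast
  from arg_cong[OF this, of set] have "set ?ds = set [1..p - 1]" unfolding set_merge_sort .
  moreover have "(v - u) mod p \<noteq> 0" using uv by (metis dvd_eq_mod_eq_0 mod_eq_dvd_iff)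
  then have "(v - u) mod p \<in> set [1..p - 1]"
    using p pos_mod_sign[of p "v - u"] pos_mod_bound[of p "v - u"]
    unfolding set_upto atLeastAtMost_iff by linarith
  ultimately have "(v - u) mod p \<in> set ?ds" by (simp only:)
  then obtain \<delta> m' where \<delta>: "(\<delta>, m') \<in> set (difference_table p g r reps)"
    "(v - u) mod p = \<delta> \<or> (v - u) mod p = - \<delta> mod p" by auto
  obtain m d where md: "m \<in> multipliers p g" "d \<in> set reps" "\<delta> = m * d mod p"
    using difference_table_subset(2)[OF \<delta>(1)] by blast
  have "(u - v) mod p = m * d mod p" if "(v - u) mod p = - \<delta> mod p"
    using mod_minus_cong[OF that] by (simp add: md(3) mod_minus_eq)
  then show ?thesis using md \<delta>(2) by blast
qed

end

lemma affine_checkD: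
  assumes "affine_check p g r levels reps cs"
  shows "1 < p" "0 < r" "g ^ r mod p = 1" "set reps \<subseteq> {1..<p}"
    and "difference_check p (difference_table p g r reps)"
    and "set cs \<subseteq> multipliers p g \<times> {0..<p} \<times> set levels"
proof -
  show p: "1 < p" and "0 < r" "g ^ r mod p = 1" "difference_check p (difference_table p g r reps)"
    and "set reps \<subseteq> {1..<p}"
    using assms unfolding affine_check_def list_all_iff by auto
  show "set cs \<subseteq> multipliers p g \<times> {0..<p} \<times> set levels"
    using assms set_powers[of p g 0 r] p unfolding affine_check_def list_all_iff by fastforce
qed

definition level_normalise :: "int \<Rightarrow> (int \<times> int) list \<Rightarrow> int \<Rightarrow> int \<Rightarrow> affine option" where
  "level_normalise p table x y = (if (x < p) = (y < p)
     then map_option (\<lambda>m. (m, - m * x mod p, x div p)) (lookup table ((y - x) mod p)) else None)"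

definition level_check :: "int \<Rightarrow> int \<Rightarrow> nat \<Rightarrow> int list \<Rightarrow> (block list \<times> affine) list \<Rightarrow> bool" where
  "level_check p g r reps cs \<longleftrightarrow> affine_check p g r [0, 1] reps (map snd cs) \<and>
     2 * p mod 3 = 1 \<and> int (length cs) * int r \<le> p - 1 \<and> base_check (2 * p) (level_act p) cs \<and>
     cover_check (level_act p) (2 * p) (level_normalise p (difference_table p g r reps)) reps
       (concat (map fst cs))"

context level_group
begin

lemma level_act_from_zero:
  assumes "x \<in> {0..<2 * p}" "y \<in> {0..<2 * p}" "x div p = y div p"
    and "(y - x) mod p = m * d mod p" "d \<in> {1..<p}"
  shows "level_act p (m, x mod p, x div p) 0 = x" "level_act p (m, x mod p, x div p) d = y"
proof -
  have level: "x div p mod 2 = x div p" using assms(1) div_level by simp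
  show "level_act p (m, x mod p, x div p) 0 = x"
    by (rule level_eqI) (simp_all add: level_act_mod level_act_div level)
  have "(m * d + x mod p) mod p = ((y - x) + x) mod p"
    by (intro mod_add_cong) (simp_all add: assms(4))
  then show "level_act p (m, x mod p, x div p) d = y"
    using assms(3,5)
    by - (rule level_eqI, simp_all add: level_act_mod level_act_div level[unfolded assms(3)] div_pos_pos_trivial)
qed

lemma level_pair_cover:
  assumes check: "difference_check p (difference_table p g r reps)" and reps: "set reps \<subseteq> {1..<p}"
    and B: "B \<in> triples {0..<2 * p}"
  shows "\<exists>h\<in>G. \<exists>d\<in>set reps. level_act p h 0 \<in> B \<and> level_act p h d \<in> B"
proof -
  have BX: "B \<subseteq> {0..<2 * p}" using B unfolding triples_def by blast
  obtain x y z where xyz: "B = {x, y, z}" "x \<noteq> y" "x \<noteq> z" "y \<noteq> z"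
    using B by (rule triplesE)
  then have "x div p = y div p \<or> x div p = z div p \<or> y div p = z div p"
    using BX div_level[of x] div_level[of y] div_level[of z] by simp
  then have "\<exists>u\<in>B. \<exists>v\<in>B. u \<noteq> v \<and> u div p = v div p" using xyz by blast
  then obtain u v where uv: "u \<in> B" "v \<in> B" "u \<noteq> v" "u div p = v div p" by blast
  have "u mod p \<noteq> v mod p" using uv(3,4) level_eqI by blast
  then obtain m d where m: "m \<in> multipliers p g" and d: "d \<in> set reps"
    and md: "(v - u) mod p = m * d mod p \<or> (u - v) mod p = m * d mod p"
    using difference_check_sound[OF check] by blast
  have found: ?thesis if "a \<in> B" "b \<in> B" "a div p = b div p" "(b - a) mod p = m * d mod p" for a b
  proof -
    have ab: "a \<in> {0..<2 * p}" "b \<in> {0..<2 * p}" "d \<in> {1..<p}" using BX that(1,2) reps d by blast+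
    have "(m, a mod p, a div p) \<in> G" using m ab(1) p div_level by simp
    then show ?thesis
      using level_act_from_zero[OF ab(1,2) that(3,4) ab(3)] that(1,2) d
      by (intro bexI[of _ "(m, a mod p, a div p)"] bexI[of _ d]) simp_all
  qed
  show ?thesis using md found[OF uv(1,2,4)] found[OF uv(2,1) uv(4)[symmetric]] by blast
qed

lemma level_normalise_sound:
  assumes "x \<in> {0..<2 * p}" "level_normalise p (difference_table p g r reps) x y = Some h"
  shows "h \<in> G \<and> level_act p h x = 0"
proof -
  obtain m where m: "lookup (difference_table p g r reps) ((y - x) mod p) = Some m"
    and h: "h = (m, - m * x mod p, x div p)"
    using assms(2) unfolding level_normalise_def by (auto split: if_splits)
  have "h \<in> G"
    using difference_table_subset(1)[OF lookup_SomeD(1)[OF m]] p div_level[OF assms(1)] unfolding h by simp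
  moreover have "level_act p h x = 0"
    unfolding h by (rule level_eqI) (simp_all add: level_act_mod level_act_div mod_add_right_eq)
  ultimately show ?thesis by blast
qed

end

theorem resolved_if_level_check:
  assumes check: "level_check p g r reps cs" and order_eq: "nat (2 * p) = N"
  shows "resolved N"
proof -
  have affine_check: "affine_check p g r [0, 1] reps (map snd cs)" and order: "2 * p mod 3 = 1"
    and size: "int (length cs) * int r \<le> p - 1" and base: "base_check (2 * p) (level_act p) cs"
    and cover: "cover_check (level_act p) (2 * p) (level_normalise p (difference_table p g r reps)) reps
      (concat (map fst cs))"
    using check unfolding level_check_def by blast+
  note affine = affine_checkD[OF affine_check]
  interpret level_group p g r using affine(1-3) by unfold_locales auto
  let ?I = "{..<length cs} \<times> G"
  have shifts: "snd ` set cs \<subseteq> G" using affine(6) by simp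
  have "triples {0..<2 * p} \<subseteq> orbit (block_set ` set (concat (map fst cs)))"
    using level_pair_cover[OF affine(5,4)] level_normalise_sound affine(4)
    by (intro cover_check_sound[OF permutation_action_axioms cover base_check_points[OF base]]) auto
  then have L: "linked {0..<2 * p} (card ?I) (triples {0..<2 * p})"
    using linked_mono[OF linkedI[OF base_linked_family[OF permutation_action_axioms base shifts] order_refl]]
    by blast
  define n c where "n = nat p" and "c = length cs * r"
  have p_eq: "p = int n" using p unfolding n_def by simp
  have "int c \<le> int n - 1" using size unfolding p_eq c_def by simp
  then have c: "c \<le> n - 1" by linarith
  have N: "nat (2 * p) = 2 * n" unfolding p_eq by (simp add: nat_mult_distrib)
  have "2 * n mod 3 = 1" using order unfolding p_eq by presburger
  then have third: "3 * (2 * n div 3) = 2 * n - 1" by presburger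
  have "card ?I \<le> length cs * (r * (n * 2))"
    using card_group_le unfolding card_cartesian_product[of "{..<length cs}"] n_def by (simp add: mult_2_right)
  also have "\<dots> = c * (n * 2)" by (simp add: c_def)
  also have "\<dots> \<le> (n - 1) * (n * 2)" using c by simp
  finally have "6 * (card ?I * (2 * n div 3)) \<le> 6 * ((n - 1) * (n * 2) * (2 * n div 3))"
    by (intro mult_le_mono order_refl)
  also have "\<dots> = (n - 1) * (n * 2) * 2 * (3 * (2 * n div 3))" by simp
  also have "\<dots> = 2 * n * (2 * n - 1) * (2 * n - 2)"
    unfolding third by (cases n) (simp_all add: algebra_simps)
  finally show ?thesis unfolding order_eq[symmetric] N by (intro resolvedI[OF L]) (simp_all add: N)
qed

text \<open>If \<open>w\<close> is a cube root of unity modulo \<open>q\<close>, the cosets of \<open>{1, w, w\<^sup>2}\<close> and the block of the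
  fixed points form a class that every multiplier maps to itself.\<close>

definition coset_class :: "int \<Rightarrow> int \<Rightarrow> block list" where
  "coset_class q w = (0, q, q + 1) # filter (\<lambda>(x, y, z). x < y \<and> x < z)
     (map (\<lambda>x. (x, w * x mod q, w * (w * x mod q) mod q)) [1..q - 1])"

definition fixing_normalise :: "int \<Rightarrow> (int \<times> int) list \<Rightarrow> int \<Rightarrow> int \<Rightarrow> affine option" where
  "fixing_normalise q table x y = (if x < q \<and> y < q
     then map_option (\<lambda>m. (m, - m * x mod q, 0)) (lookup table ((y - x) mod q)) else None)"

definition fixing_check ::
    "int \<Rightarrow> int \<Rightarrow> nat \<Rightarrow> int list \<Rightarrow> int \<Rightarrow> (block list \<times> affine) list \<Rightarrow> bool" where
  "fixing_check q g r reps w cs \<longleftrightarrow> affine_check q g r [0] reps (map snd cs) \<and>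
     q mod 3 = 1 \<and> w ^ 3 mod q = 1 \<and> cs \<noteq> [] \<and> 2 * (int (length cs) * int r) \<le> q - 1 \<and>
     parallel_check (q + 2) (coset_class q w) \<and> base_check (q + 2) (fixing_act q) cs \<and>
     meet_once_check (q + 2) (coset_class q w) (fst (hd cs)) \<and>
     meet_once_check (q + 2) (coset_class q w) (move (fixing_act q (snd (hd cs))) (fst (hd cs))) \<and>
     cover_check (fixing_act q) (q + 2) (fixing_normalise q (difference_table q g r reps)) reps
       (coset_class q w @ concat (map fst cs))"

context fixing_group
begin

definition coset :: "int \<Rightarrow> int \<Rightarrow> int set" where
  "coset w x = {x, w * x mod q, w * (w * x mod q) mod q}"

lemma coset_eq:
  assumes w: "w ^ 3 mod q = 1" and x: "x \<in> {0..<q}" and y: "y \<in> coset w x"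
  shows "coset w y = coset w x"
proof -
  have "w * (w * (w * x mod q) mod q) mod q = w ^ 3 * x mod q"
    by (simp add: power3_eq_cube mod_simps mult.assoc)
  also have "\<dots> = x" using w x by (metis atLeastLessThan_iff mod_mult_left_eq mod_pos_pos_trivial mult_1)
  finally have cube: "w * (w * (w * x mod q) mod q) mod q = x" .
  then show ?thesis using y unfolding coset_def by (elim insertE) (auto simp: cube)
qed

lemma coset_class_blocks:
  assumes "B \<in> block_set ` set (coset_class q w)"
  shows "B = {0, q, q + 1} \<or> (\<exists>x\<in>{1..<q}. B = coset w x)"
proof -
  obtain b where b: "b \<in> set (coset_class q w)" "B = block_set b" using assms by blast
  then have "b = (0, q, q + 1) \<or> (\<exists>x\<in>set [1..q - 1]. b = (x, w * x mod q, w * (w * x mod q) mod q))"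
    unfolding coset_class_def set_simps set_filter set_map by blast
  then show ?thesis
  proof (elim disjE bexE)
    fix x assume "x \<in> set [1..q - 1]" "b = (x, w * x mod q, w * (w * x mod q) mod q)"
    then have "x \<in> {1..<q}" "B = coset w x" unfolding b(2) block_set_def coset_def by simp_all
    then show ?thesis by blast
  qed (simp add: b(2) block_set_def)
qed

lemma fixed_block: "{0, q, q + 1} \<in> block_set ` set (coset_class q w)"
  unfolding coset_class_def block_set_def by simp

lemma coset_in_coset_class:
  assumes check: "parallel_check (q + 2) (coset_class q w)" "w ^ 3 mod q = 1" and order: "q mod 3 = 1"
    and y: "y \<in> {1..<q}"
  shows "coset w y \<in> block_set ` set (coset_class q w)"
proof -
  have "(q + 2) mod 3 = 0" using order by presburger
  then have "y \<in> \<Union>(block_set ` set (coset_class q w))"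
    using parallel_check_points[OF check(1)] y unfolding set_points by simp
  then obtain B where B: "B \<in> block_set ` set (coset_class q w)" "y \<in> B" by blast
  then obtain x where "x \<in> {1..<q}" "B = coset w x" using coset_class_blocks[OF B(1)] y by auto
  then show ?thesis using B coset_eq[OF check(2), of x y] by simp
qed

lemma multiplier_coset_class:
  assumes check: "parallel_check (q + 2) (coset_class q w)" "w ^ 3 mod q = 1" and order: "q mod 3 = 1"
    and m: "m \<in> multipliers q g" and B: "B \<in> block_set ` set (coset_class q w)"
  shows "fixing_act q (m, 0, 0) ` B \<in> block_set ` set (coset_class q w)"
  using coset_class_blocks[OF B]
proof
  assume "B = {0, q, q + 1}"
  then have "fixing_act q (m, 0, 0) ` B = {0, q, q + 1}" using p by (simp add: fixing_act_simps)
  then show ?thesis using fixed_block by simp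
next
  assume "\<exists>x\<in>{1..<q}. B = coset w x"
  then obtain x where x: "x \<in> {1..<q}" "B = coset w x" by blast
  have "m * x mod q \<noteq> 0" using multiplier_cancel[OF m, of x 0 0] x(1) by auto
  moreover have "0 \<le> m * x mod q" "m * x mod q < q" using p by auto
  ultimately have "m * x mod q \<in> {1..<q}" unfolding atLeastLessThan_iff by linarith
  moreover have "fixing_act q (m, 0, 0) ` B = coset w (m * x mod q)"
    using x p unfolding coset_def by (simp add: fixing_act_simps mod_simps ac_simps)
  ultimately show ?thesis using coset_in_coset_class[OF check order] by simp
qed

lemma orbit_coset_class:
  assumes check: "parallel_check (q + 2) (coset_class q w)" "w ^ 3 mod q = 1" and order: "q mod 3 = 1"
  shows "orbit (block_set ` set (coset_class q w)) \<subseteq>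
    (\<Union>t\<in>{0..<q}. (`) (fixing_act q (1, t, 0)) ` block_set ` set (coset_class q w))"
proof
  fix B assume "B \<in> orbit (block_set ` set (coset_class q w))"
  then obtain m t C where m: "m \<in> multipliers q g" "t \<in> {0..<q}" and C: "C \<in> block_set ` set (coset_class q w)"
    and B: "B = fixing_act q (m, t, 0) ` C"
    unfolding orbit_def by blast
  have "C \<subseteq> {0..<q + 2}"
    using parallel_class_block(1)[OF parallel_check_sound[OF check(1)] C] .
  moreover have "affine_mult q (1, t, 0) (m, 0, 0) = (m, t, 0)"
    using m p unfolding affine_mult_def multipliers_def by auto
  moreover have "(1, t, 0) \<in> G" "(m, 0, 0) \<in> G" using m p multipliers_one by auto
  ultimately have "B = fixing_act q (1, t, 0) ` fixing_act q (m, 0, 0) ` C"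
    using act_mult[of "(1, t, 0)" "(m, 0, 0)"] unfolding B image_image by (intro image_cong) auto
  then show "B \<in> (\<Union>t\<in>{0..<q}. (`) (fixing_act q (1, t, 0)) ` block_set ` set (coset_class q w))"
    using multiplier_coset_class[OF check order m(1) C] m(2) by blast
qed

lemma fixing_pair_cover:
  assumes check: "difference_check q (difference_table q g r reps)" and reps: "set reps \<subseteq> {1..<q}"
    and B: "B \<in> triples {0..<q + 2}" and xy: "x \<in> B" "y \<in> B" "x \<noteq> y" "x < q" "y < q"
  shows "\<exists>h\<in>G. \<exists>d\<in>set reps. fixing_act q h 0 \<in> B \<and> fixing_act q h d \<in> B"
proof -
  have range: "x \<in> {0..<q}" "y \<in> {0..<q}" using B xy unfolding triples_def by auto
  then have "x mod q \<noteq> y mod q" using xy(3) by simp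
  then obtain m d where m: "m \<in> multipliers q g" and d: "d \<in> set reps"
    and md: "(y - x) mod q = m * d mod q \<or> (x - y) mod q = m * d mod q"
    using difference_check_sound[OF check] by blast
  have found: ?thesis if ab: "a \<in> B" "b \<in> B" "a \<in> {0..<q}" "b \<in> {0..<q}" "(b - a) mod q = m * d mod q" for a b
  proof -
    have "(m * d + a) mod q = ((b - a) + a) mod q" using ab(5) by (intro mod_add_cong) simp_all
    then have "fixing_act q (m, a, 0) d = b" "fixing_act q (m, a, 0) 0 = a"
      using ab(3,4) d reps p by (auto simp: fixing_act_simps)
    then show ?thesis using m ab(1-3) d by (intro bexI[of _ "(m, a, 0)"] bexI[of _ d]) simp_all
  qed
  show ?thesis using md found[OF xy(1,2) range] found[OF xy(2,1) range(2,1)] by blast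
qed

lemma fixing_normalise_sound:
  assumes "fixing_normalise q (difference_table q g r reps) x y = Some h"
  shows "h \<in> G \<and> fixing_act q h x = 0"
proof -
  obtain m where m: "lookup (difference_table q g r reps) ((y - x) mod q) = Some m"
    and h: "h = (m, - m * x mod q, 0)" and "x < q"
    using assms unfolding fixing_normalise_def by (auto split: if_splits)
  then show ?thesis
    using difference_table_subset(1)[OF lookup_SomeD(1)[OF m]] p
    unfolding h by (simp add: fixing_act_simps mod_add_right_eq)
qed

lemma triple_cases:
  assumes "B \<in> triples {0..<q + 2}"
  shows "(\<exists>x\<in>B. \<exists>y\<in>B. x \<noteq> y \<and> x < q \<and> y < q) \<or> (\<exists>t\<in>{0..<q}. B = {t, q, q + 1})"
proof (cases "\<exists>x\<in>B. \<exists>y\<in>B. x \<noteq> y \<and> x < q \<and> y < q")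
  case False
  have B: "B \<subseteq> {0..<q + 2}" "card B = 3" using assms unfolding triples_def by auto
  have "\<not> B \<subseteq> {q, q + 1}" using card_mono[of "{q, q + 1}" B] B(2) by auto
  then obtain t where t: "t \<in> B" "t \<noteq> q" "t \<noteq> q + 1" by blast
  then have "t \<in> {0..<q}" using B(1) by auto
  moreover have "B \<subseteq> {t, q, q + 1}"
  proof
    fix x assume x: "x \<in> B"
    then have "x < q \<longrightarrow> x = t" using False t(1) calculation by auto
    moreover have "x < q + 2" using x B(1) by auto
    ultimately show "x \<in> {t, q, q + 1}" by auto
  qed
  then have "B = {t, q, q + 1}" using t B(2) by (intro card_subset_eq) auto
  ultimately show ?thesis by blast
qed blast

lemma coset_class_linked:
  assumes check: "parallel_check (q + 2) (coset_class q w)" "w ^ 3 mod q = 1" and order: "q mod 3 = 1"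
    and base: "base_check (q + 2) (fixing_act q) cs" and shifts: "snd ` set cs \<subseteq> G" and "cs \<noteq> []"
    and before: "meet_once_check (q + 2) (coset_class q w) (fst (hd cs))"
    and after: "meet_once_check (q + 2) (coset_class q w) (move (fixing_act q (snd (hd cs))) (fst (hd cs)))"
  shows "linked {0..<q + 2} (card ({..<length cs} \<times> G) + nat q)
    (orbit (block_set ` set (coset_class q w @ concat (map fst cs))))"
proof -
  let ?E = "block_set ` set (coset_class q w)" and ?b = "block_set ` set (fst (hd cs))"
  let ?h = "\<lambda>t. (0, 1, t, 0) :: nat \<times> affine"
  let ?P = "\<lambda>(k, g). (`) (fixing_act q g) ` block_set ` set (fst (cs ! k))"
  let ?s = "\<lambda>(k, g). (k :: nat, affine_mult q g (snd (cs ! k)))"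
  have hd: "cs ! 0 = hd cs" "hd cs \<in> set cs" using \<open>cs \<noteq> []\<close> by (simp_all add: hd_conv_nth)
  have E: "parallel_class {0..<q + 2} ?E" using parallel_check_sound[OF check(1)] .
  have b: "parallel_class {0..<q + 2} ?b"
    using base hd(2) parallel_check_sound unfolding base_check_def list_all_iff by fastforce
  have c: "snd (hd cs) \<in> G" using shifts hd(2) by blast
  have translation: "(1, t, 0) \<in> G" if "t \<in> {0..<q}" for t using that multipliers_one by simp
  note family = base_linked_family[OF permutation_action_axioms base shifts]
  have "linked {0..<q + 2} (card ({..<length cs} \<times> G) + card {0..<q})
    (orbit (block_set ` set (concat (map fst cs))) \<union> (\<Union>t\<in>{0..<q}. (`) (fixing_act q (1, t, 0)) ` ?E))"
  proof (rule linked_insert[OF family, where h = ?h])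
    show "inj_on ?h {0..<q}" by (simp add: inj_on_def)
    fix t assume t: "t \<in> {0..<q}"
    note t = translation[OF t]
    show "?h t \<in> {..<length cs} \<times> G" using t \<open>cs \<noteq> []\<close> by simp
    show "parallel_class {0..<q + 2} ((`) (fixing_act q (1, t, 0)) ` ?E)"
      by (rule act_parallel_class[OF t E])
    show "meet_once (?P (?h t)) ((`) (fixing_act q (1, t, 0)) ` ?E)"
      using act_meet_once[OF t E b meet_once_check_sound[OF before]] hd(1) by (simp add: meet_once_commute)
    show "meet_once ((`) (fixing_act q (1, t, 0)) ` ?E) (?P (?s (?h t)))"
      using act_meet_once[OF t E act_parallel_class[OF c b]] meet_once_check_sound[OF after]
      by (simp add: hd(1) act_mult_class[OF t c b] block_set_move)
  qed simp
  moreover have "orbit (block_set ` set (coset_class q w @ concat (map fst cs))) \<subseteq>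
      orbit (block_set ` set (concat (map fst cs))) \<union> (\<Union>t\<in>{0..<q}. (`) (fixing_act q (1, t, 0)) ` ?E)"
    using orbit_coset_class[OF check order] unfolding set_append image_Un orbit_Un by blast
  ultimately show ?thesis using linked_mono by simp
qed

end

lemma fixing_count_bound:
  fixes i c n :: nat
  assumes i: "i \<le> c * n" and c: "2 * c \<le> n - 1" "0 < n" and "n mod 3 = 1"
  shows "6 * ((i + n) * ((n + 2) div 3)) \<le> (n + 2) * (n + 1) * n"
proof -
  have third: "3 * ((n + 2) div 3) = n + 2" using assms(4) by presburger
  have "2 * (i + n) \<le> 2 * c * n + 2 * n" using i by simp
  also have "\<dots> \<le> (n - 1) * n + 2 * n" using c(1) by simp
  also have "\<dots> = (n + 1) * n" using c(2) by (cases n) simp_all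
  finally have bound: "2 * (i + n) \<le> (n + 1) * n" .
  have "6 * ((i + n) * ((n + 2) div 3)) = 2 * (i + n) * (3 * ((n + 2) div 3))" by simp
  also have "\<dots> = 2 * (i + n) * (n + 2)" unfolding third ..
  also have "\<dots> \<le> (n + 1) * n * (n + 2)" using bound by (rule mult_le_mono1)
  also have "\<dots> = (n + 2) * (n + 1) * n" by (simp only: ac_simps)
  finally show ?thesis .
qed

theorem resolved_if_fixing_check:
  assumes check: "fixing_check q g r reps w cs" and order_eq: "nat (q + 2) = N"
  shows "resolved N"
proof -
  let ?bl = "coset_class q w @ concat (map fst cs)"
  have affine_check: "affine_check q g r [0] reps (map snd cs)"
    and order: "q mod 3 = 1" and w: "w ^ 3 mod q = 1" and "cs \<noteq> []" and size: "2 * (int (length cs) * int r) \<le> q - 1"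
    and E: "parallel_check (q + 2) (coset_class q w)" and base: "base_check (q + 2) (fixing_act q) cs"
    and meet: "meet_once_check (q + 2) (coset_class q w) (fst (hd cs))"
      "meet_once_check (q + 2) (coset_class q w) (move (fixing_act q (snd (hd cs))) (fst (hd cs)))"
    and cover: "cover_check (fixing_act q) (q + 2) (fixing_normalise q (difference_table q g r reps)) reps ?bl"
    using check unfolding fixing_check_def by blast+
  note affine = affine_checkD[OF affine_check]
  interpret fixing_group q g r using affine(1-3) by unfold_locales auto
  let ?I = "{..<length cs} \<times> G"
  have shifts: "snd ` set cs \<subseteq> G" using affine(6) by simp
  have points: "set (points ?bl) \<subseteq> {0..<q + 2}"
    using parallel_check_subset[OF E] base_check_points[OF base] unfolding points_append by simp
  let ?T = "{B \<in> triples {0..<q + 2}. \<exists>x\<in>B. \<exists>y\<in>B. x \<noteq> y \<and> x < q \<and> y < q}"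
  have "?T \<subseteq> orbit (block_set ` set ?bl)"
    using fixing_pair_cover[OF affine(5,4)] fixing_normalise_sound affine(4)
    by (intro cover_check_sound[OF permutation_action_axioms cover points]) auto
  moreover have "{t, q, q + 1} \<in> orbit (block_set ` set ?bl)" if "t \<in> {0..<q}" for t
  proof -
    have "{t, q, q + 1} = fixing_act q (1, t, 0) ` {0, q, q + 1}"
      using that p by (simp add: fixing_act_simps)
    moreover have "{0, q, q + 1} \<in> block_set ` set ?bl" using fixed_block by (simp add: image_Un)
    moreover have "(1, t, 0) \<in> G" using multipliers_one that by simp
    ultimately show ?thesis unfolding orbit_def by blast
  qed
  ultimately have "triples {0..<q + 2} \<subseteq> orbit (block_set ` set ?bl)"
    using triple_cases by blast
  then have L: "linked {0..<q + 2} (card ?I + nat q) (triples {0..<q + 2})"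
    using linked_mono[OF coset_class_linked[OF E w order base shifts \<open>cs \<noteq> []\<close> meet]] by blast
  define n c where "n = nat q" and "c = length cs * r"
  have q: "q = int n" using p unfolding n_def by simp
  have "2 * int c \<le> int n - 1" using size unfolding q c_def by simp
  then have c: "2 * c \<le> n - 1" "n > 0" by linarith+
  have N: "nat (q + 2) = n + 2" unfolding q by simp
  have n_mod: "n mod 3 = 1" using order unfolding q by presburger
  have "card ?I \<le> length cs * (r * n)"
    using card_group_le unfolding card_cartesian_product[of "{..<length cs}"] n_def by simp
  then have "card ?I \<le> c * n" by (simp add: c_def)
  from fixing_count_bound[OF this c n_mod] show ?thesis
    unfolding order_eq[symmetric] N by (intro resolvedI[OF L]) (simp_all add: N n_def)
qed

subsection \<open>Small orders\<close>

definition base_classes_9 :: "(block list \<times> affine) list" where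
  "base_classes_9 =
    [([(0, 1, 6), (2, 3, 7), (4, 5, 8)], (2, 0, 0))]"

lemma resolved_9: "resolved 9"
  by (rule resolved_if_fixing_check[of 7 2 3 "[1]" 2 base_classes_9]) code_simp+

definition base_classes_10 :: "(block list \<times> affine) list" where
  "base_classes_10 =
    [([(3, 1, 6), (7, 8, 9), (2, 4, 5)], (1, 2, 0)),
     ([(7, 9, 3), (8, 5, 2), (1, 4, 6)], (1, 2, 0)),
     ([(2, 1, 5), (6, 7, 4), (9, 8, 3)], (1, 1, 0)),
     ([(1, 2, 7), (3, 4, 5), (6, 8, 9)], (1, 1, 0))]"

lemma resolved_10: "resolved 10"
  by (rule resolved_if_level_check[of 5 1 1 "[1, 2]" base_classes_10]) code_simp+

definition base_classes_15 :: "(block list \<times> affine) list" where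
  "base_classes_15 =
    [([(10, 8, 0), (11, 2, 14), (5, 7, 1), (12, 9, 6), (3, 4, 13)], (1, 7, 0)),
     ([(6, 11, 13), (9, 0, 3), (1, 8, 4), (12, 7, 14), (2, 10, 5)], (1, 6, 0))]"

lemma resolved_15: "resolved 15"
  by (rule resolved_if_fixing_check[of 13 3 3 "[1, 2]" 3 base_classes_15]) code_simp+

definition base_classes_21 :: "(block list \<times> affine) list" where
  "base_classes_21 =
    [([(8, 0, 15), (1, 9, 20), (2, 10, 7), (11, 5, 19), (18, 6, 16), (14, 13, 12), (17, 4, 3)],
        (1, 5, 0))]"

lemma resolved_21: "resolved 21"
  by (rule resolved_if_fixing_check[of 19 4 9 "[1]" 7 base_classes_21]) code_simp+

definition base_classes_22 :: "(block list \<times> affine) list" where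
  "base_classes_22 =
    [([(21, 17, 9), (20, 15, 11), (6, 2, 14), (1, 7, 16), (3, 5, 18), (12, 19, 10), (8, 4, 13)],
        (1, 1, 0)),
     ([(11, 18, 6), (17, 21, 3), (13, 14, 9), (20, 12, 15), (10, 5, 16), (8, 7, 19), (4, 1, 2)],
        (1, 2, 0))]"

lemma resolved_22: "resolved 22"
  by (rule resolved_if_level_check[of 11 3 5 "[1]" base_classes_22]) code_simp+

definition base_classes_33 :: "(block list \<times> affine) list" where
  "base_classes_33 =
    [([(13, 12, 32), (19, 17, 31), (2, 9, 18), (30, 20, 27), (26, 25, 15), (7, 29, 8),
        (11, 16, 22), (14, 1, 28), (24, 3, 10), (5, 4, 6), (23, 21, 0)], (1, 16, 0))]"

lemma resolved_33: "resolved 33"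
  by (rule resolved_if_fixing_check[of 31 7 15 "[1]" 5 base_classes_33]) code_simp+

definition base_classes_34 :: "(block list \<times> affine) list" where
  "base_classes_34 =
    [([(3, 4, 22), (31, 29, 11), (7, 13, 32), (20, 24, 2), (25, 28, 17), (23, 27, 15),
        (6, 14, 30), (21, 26, 9), (16, 8, 12), (10, 1, 33), (18, 19, 5)], (1, 1, 0)),
     ([(7, 11, 16), (15, 14, 19), (21, 26, 1), (28, 24, 12), (31, 25, 8), (22, 29, 20), (3, 9, 18),
        (27, 33, 5), (6, 10, 17), (30, 32, 13), (4, 2, 23)], (1, 3, 0)),
     ([(10, 7, 33), (6, 14, 31), (1, 5, 30), (3, 11, 32), (8, 12, 26), (9, 15, 19), (13, 2, 29),
        (28, 21, 16), (18, 22, 25), (20, 27, 4), (23, 24, 17)], (1, 5, 0)),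
     ([(14, 3, 25), (15, 1, 13), (24, 17, 30), (21, 23, 27), (32, 22, 6), (8, 10, 31),
        (26, 18, 11), (28, 29, 9), (7, 16, 4), (12, 5, 20), (19, 33, 2)], (1, 1, 0)),
     ([(16, 8, 23), (25, 24, 20), (30, 22, 10), (32, 27, 2), (26, 29, 7), (28, 21, 9), (5, 4, 18),
        (19, 33, 3), (13, 1, 17), (15, 6, 31), (12, 11, 14)], (1, 0, 1)),
     ([(27, 29, 4), (18, 24, 5), (2, 12, 28), (22, 26, 7), (11, 14, 25), (3, 1, 15), (33, 21, 16),
        (19, 20, 10), (8, 9, 32), (30, 31, 6), (23, 17, 13)], (1, 7, 0)),
     ([(24, 20, 23), (32, 30, 10), (27, 18, 14), (17, 21, 4), (5, 7, 31), (19, 28, 12),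
        (15, 3, 25), (33, 22, 8), (11, 2, 1), (26, 29, 9), (13, 16, 6)], (1, 2, 0)),
     ([(12, 16, 11), (23, 32, 28), (14, 8, 3), (4, 6, 31), (15, 5, 17), (24, 26, 10), (13, 2, 1),
        (19, 27, 33), (30, 20, 29), (21, 18, 9), (22, 25, 7)], (1, 0, 1)),
     ([(23, 32, 12), (2, 13, 14), (33, 26, 9), (18, 28, 20), (3, 5, 27), (6, 16, 30), (10, 7, 25),
        (17, 29, 22), (4, 8, 19), (1, 11, 31), (21, 24, 15)], (1, 7, 0)),
     ([(28, 17, 16), (10, 14, 24), (5, 11, 23), (12, 15, 25), (26, 31, 3), (19, 21, 30),
        (18, 29, 32), (1, 6, 20), (7, 9, 8), (2, 4, 27), (22, 33, 13)], (1, 1, 1)),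
     ([(11, 5, 28), (31, 21, 3), (30, 29, 12), (26, 33, 1), (2, 4, 24), (23, 27, 25), (9, 16, 20),
        (17, 19, 13), (22, 18, 8), (15, 10, 7), (14, 6, 32)], (1, 4, 0)),
     ([(33, 30, 6), (15, 11, 17), (16, 3, 19), (18, 25, 5), (26, 22, 28), (20, 31, 4), (8, 13, 24),
        (23, 21, 2), (9, 10, 32), (27, 29, 12), (14, 7, 1)], (1, 3, 1)),
     ([(11, 15, 21), (12, 16, 9), (6, 13, 30), (20, 23, 22), (19, 17, 1), (3, 4, 31), (14, 10, 18),
        (8, 5, 28), (29, 32, 7), (33, 27, 26), (24, 25, 2)], (1, 6, 0)),
     ([(14, 5, 33), (31, 19, 12), (6, 15, 26), (13, 7, 27), (28, 18, 4), (25, 17, 3), (1, 9, 10),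
        (30, 24, 22), (23, 29, 8), (20, 32, 11), (16, 2, 21)], (1, 6, 0)),
     ([(24, 33, 12), (3, 4, 21), (19, 29, 8), (7, 2, 25), (32, 20, 5), (17, 30, 13), (6, 11, 26),
        (15, 16, 18), (9, 14, 27), (22, 23, 1), (31, 28, 10)], (1, 1, 1)),
     ([(16, 14, 26), (28, 31, 1), (29, 24, 2), (32, 27, 25), (6, 7, 22), (15, 3, 5), (18, 23, 9),
        (11, 10, 19), (8, 12, 21), (4, 13, 30), (17, 33, 20)], (1, 1, 1))]"

lemma resolved_34: "resolved 34"
  by (rule resolved_if_level_check[of 17 1 1 "[1, 2, 3, 4, 5, 6, 7, 8]" base_classes_34]) code_simp+

definition base_classes_39 :: "(block list \<times> affine) list" where
  "base_classes_39 =
    [([(1, 36, 38), (27, 30, 37), (35, 28, 15), (7, 20, 13), (24, 9, 23), (31, 2, 32),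
        (4, 25, 33), (29, 18, 10), (22, 21, 6), (3, 5, 17), (0, 12, 8), (19, 34, 14),
        (11, 26, 16)], (1, 20, 0)),
     ([(8, 34, 38), (10, 2, 37), (17, 3, 28), (15, 29, 36), (9, 14, 1), (0, 35, 26), (23, 32, 25),
        (7, 6, 18), (20, 27, 16), (31, 11, 21), (22, 5, 30), (19, 12, 4), (33, 24, 13)],
        (1, 7, 0))]"

lemma resolved_39: "resolved 39"
  by (rule resolved_if_fixing_check[of 37 7 9 "[1, 2]" 10 base_classes_39]) code_simp+

definition base_classes_46 :: "(block list \<times> affine) list" where
  "base_classes_46 =
    [([(3, 9, 42), (10, 2, 19), (43, 44, 6), (21, 22, 33), (26, 34, 28), (29, 41, 13),
        (7, 17, 32), (20, 5, 30), (38, 40, 18), (11, 15, 31), (45, 25, 8), (12, 16, 35),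
        (24, 39, 14), (23, 37, 4), (27, 36, 1)], (1, 3, 1)),
     ([(35, 23, 21), (15, 9, 37), (36, 25, 2), (43, 30, 12), (26, 38, 14), (5, 13, 41),
        (32, 42, 27), (31, 39, 45), (22, 7, 24), (33, 28, 34), (16, 11, 29), (18, 4, 44),
        (6, 8, 10), (1, 3, 17), (19, 20, 40)], (1, 8, 0))]"

lemma resolved_46: "resolved 46"
  by (rule resolved_if_level_check[of 23 2 11 "[1]" base_classes_46]) code_simp+

definition base_classes_51 :: "(block list \<times> affine) list" where
  "base_classes_51 =
    [([(9, 1, 49), (11, 46, 50), (27, 5, 40), (10, 2, 8), (32, 35, 4), (26, 34, 28), (38, 41, 45),
        (30, 48, 33), (7, 22, 16), (19, 15, 17), (13, 25, 39), (3, 42, 18), (37, 14, 23),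
        (20, 6, 21), (0, 36, 31), (47, 29, 44), (43, 12, 24)], (1, 16, 0)),
     ([(38, 22, 50), (13, 33, 49), (41, 20, 45), (29, 35, 30), (37, 39, 32), (3, 21, 15),
        (16, 14, 4), (6, 23, 8), (43, 0, 40), (28, 25, 2), (34, 36, 9), (19, 42, 1), (26, 27, 5),
        (24, 11, 10), (17, 12, 31), (48, 47, 44), (7, 18, 46)], (1, 5, 0)),
     ([(9, 17, 50), (35, 0, 49), (23, 26, 47), (7, 29, 43), (21, 20, 45), (11, 30, 39),
        (10, 8, 48), (28, 27, 16), (40, 22, 33), (6, 5, 1), (31, 37, 2), (3, 15, 24), (32, 19, 4),
        (44, 38, 34), (18, 46, 25), (41, 12, 14), (13, 42, 36)], (1, 3, 0)),
     ([(23, 36, 49), (22, 13, 50), (14, 16, 10), (42, 12, 34), (17, 4, 20), (45, 47, 27),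
        (48, 29, 33), (6, 0, 21), (39, 37, 2), (1, 5, 24), (41, 8, 11), (25, 19, 43), (31, 9, 18),
        (40, 32, 28), (26, 46, 38), (15, 7, 35), (30, 44, 3)], (1, 15, 0)),
     ([(47, 14, 49), (12, 13, 50), (15, 1, 27), (44, 43, 33), (40, 11, 0), (21, 5, 3), (24, 29, 4),
        (9, 34, 42), (41, 18, 19), (10, 37, 31), (48, 35, 17), (36, 28, 25), (46, 20, 8),
        (39, 2, 30), (16, 45, 22), (26, 38, 23), (6, 7, 32)], (1, 17, 0)),
     ([(14, 36, 50), (11, 45, 49), (27, 38, 44), (28, 47, 10), (48, 7, 20), (41, 6, 25),
        (32, 23, 16), (12, 29, 3), (39, 31, 42), (5, 26, 21), (30, 8, 9), (0, 34, 22), (2, 4, 37),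
        (19, 24, 33), (15, 13, 40), (35, 18, 43), (46, 17, 1)], (1, 5, 0)),
     ([(42, 20, 49), (1, 48, 50), (29, 13, 39), (23, 8, 21), (37, 17, 46), (35, 10, 16),
        (26, 14, 33), (15, 5, 47), (12, 43, 0), (7, 22, 38), (41, 2, 31), (25, 28, 18),
        (45, 24, 9), (6, 32, 30), (4, 3, 40), (34, 36, 44), (19, 11, 27)], (1, 6, 0)),
     ([(32, 44, 50), (35, 36, 49), (4, 46, 17), (18, 29, 47), (9, 30, 3), (19, 24, 15),
        (31, 33, 34), (41, 12, 13), (11, 7, 48), (38, 23, 39), (26, 40, 43), (21, 27, 20),
        (10, 0, 22), (2, 14, 5), (45, 37, 8), (28, 25, 1), (42, 16, 6)], (1, 7, 0))]"

lemma resolved_51: "resolved 51"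
  by (rule resolved_if_fixing_check[of 49 18 3 "[1, 2, 3, 4, 6, 7, 9, 12]" 18 base_classes_51]) code_simp+

definition base_classes_58 :: "(block list \<times> affine) list" where
  "base_classes_58 =
    [([(29, 31, 26), (57, 47, 15), (23, 1, 8), (10, 20, 34), (3, 13, 17), (6, 14, 25),
        (28, 9, 39), (46, 54, 5), (24, 7, 33), (40, 36, 2), (51, 43, 53), (12, 27, 56),
        (38, 32, 4), (41, 45, 55), (35, 50, 49), (44, 42, 21), (48, 37, 16), (19, 11, 18),
        (30, 52, 22)], (1, 5, 1)),
     ([(53, 55, 33), (24, 19, 3), (46, 57, 14), (10, 9, 26), (30, 50, 43), (6, 25, 42),
        (49, 38, 23), (37, 44, 27), (56, 45, 15), (20, 16, 47), (34, 39, 2), (5, 4, 36),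
        (1, 7, 35), (40, 54, 28), (11, 12, 32), (8, 21, 41), (31, 48, 52), (22, 18, 29),
        (17, 13, 51)], (1, 4, 0)),
     ([(40, 41, 13), (43, 55, 51), (20, 9, 47), (19, 15, 45), (6, 12, 14), (29, 44, 1),
        (17, 28, 57), (3, 23, 38), (5, 11, 48), (46, 56, 24), (39, 32, 25), (31, 35, 2),
        (50, 34, 10), (21, 8, 16), (37, 36, 42), (18, 4, 53), (30, 54, 7), (27, 26, 33),
        (49, 52, 22)], (1, 5, 1)),
     ([(57, 56, 24), (27, 8, 43), (34, 54, 23), (21, 7, 41), (42, 52, 18), (22, 6, 35),
        (4, 26, 38), (30, 32, 25), (44, 36, 20), (1, 13, 45), (29, 53, 51), (10, 16, 31),
        (50, 46, 11), (12, 15, 47), (48, 40, 9), (33, 49, 28), (14, 17, 37), (39, 55, 2),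
        (3, 5, 19)], (1, 12, 0))]"

lemma resolved_58: "resolved 58"
  by (rule resolved_if_level_check[of 29 7 7 "[1, 2]" base_classes_58]) code_simp+

definition base_classes_69 :: "(block list \<times> affine) list" where
  "base_classes_69 =
    [([(22, 30, 67), (52, 53, 68), (19, 56, 44), (18, 5, 45), (23, 14, 31), (12, 57, 51),
        (61, 4, 55), (2, 3, 9), (16, 63, 24), (42, 15, 28), (46, 11, 13), (66, 47, 17),
        (25, 34, 60), (10, 32, 41), (36, 64, 48), (26, 54, 6), (35, 20, 37), (43, 40, 1),
        (58, 59, 38), (62, 0, 50), (29, 7, 49), (33, 65, 27), (21, 39, 8)], (1, 51, 0))]"

lemma resolved_69: "resolved 69"
  by (rule resolved_if_fixing_check[of 67 4 33 "[1]" 29 base_classes_69]) code_simp+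

definition base_classes_75 :: "(block list \<times> affine) list" where
  "base_classes_75 =
    [([(1, 42, 73), (40, 37, 74), (36, 44, 30), (23, 48, 65), (70, 53, 10), (18, 67, 63),
        (35, 43, 55), (56, 20, 60), (2, 64, 31), (4, 72, 12), (16, 62, 69), (47, 39, 27),
        (22, 33, 25), (19, 58, 17), (5, 34, 24), (3, 14, 59), (71, 28, 32), (50, 13, 8),
        (51, 7, 0), (61, 52, 68), (9, 66, 15), (11, 46, 38), (54, 26, 57), (29, 45, 6),
        (21, 41, 49)], (1, 53, 0)),
     ([(57, 58, 74), (62, 67, 73), (60, 12, 15), (3, 25, 68), (22, 18, 47), (36, 48, 46),
        (8, 9, 38), (50, 31, 7), (26, 6, 59), (17, 21, 37), (49, 27, 44), (34, 40, 13),
        (41, 4, 14), (61, 20, 16), (1, 70, 53), (19, 30, 42), (0, 55, 24), (10, 35, 43),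
        (32, 66, 23), (71, 29, 5), (64, 11, 56), (65, 39, 63), (69, 51, 54), (52, 33, 28),
        (72, 45, 2)], (1, 3, 0)),
     ([(28, 38, 74), (57, 9, 73), (4, 62, 37), (14, 63, 70), (26, 15, 6), (68, 47, 2),
        (64, 25, 56), (31, 33, 46), (24, 60, 36), (67, 8, 19), (5, 42, 71), (18, 20, 61),
        (72, 55, 32), (39, 16, 29), (27, 43, 59), (1, 22, 49), (17, 35, 54), (13, 10, 12),
        (30, 51, 3), (23, 52, 48), (34, 40, 58), (53, 66, 69), (7, 45, 41), (21, 11, 0),
        (65, 50, 44)], (1, 4, 0)),
     ([(69, 58, 74), (71, 27, 73), (3, 37, 6), (32, 65, 39), (62, 29, 67), (28, 24, 19),
        (30, 45, 41), (44, 53, 4), (12, 43, 7), (56, 35, 21), (14, 11, 10), (59, 55, 66),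
        (0, 36, 49), (42, 26, 57), (61, 20, 63), (22, 48, 2), (8, 18, 46), (68, 25, 38),
        (33, 5, 72), (1, 47, 70), (50, 23, 54), (31, 34, 60), (9, 52, 51), (17, 16, 13),
        (64, 15, 40)], (1, 19, 0))]"

lemma resolved_75: "resolved 75"
  by (rule resolved_if_fixing_check[of 73 2 9 "[1, 3, 5, 11]" 8 base_classes_75]) code_simp+

definition base_classes_94 :: "(block list \<times> affine) list" where
  "base_classes_94 =
    [([(40, 28, 60), (59, 51, 31), (11, 1, 81), (63, 66, 5), (37, 15, 56), (17, 23, 33),
        (10, 32, 30), (77, 83, 18), (48, 89, 16), (78, 72, 50), (45, 19, 49), (91, 79, 29),
        (75, 62, 68), (25, 7, 86), (88, 76, 53), (70, 65, 13), (71, 84, 21), (6, 22, 93),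
        (54, 90, 64), (12, 26, 92), (47, 69, 52), (24, 35, 58), (43, 44, 80), (41, 9, 61),
        (38, 34, 14), (2, 27, 74), (67, 73, 46), (36, 4, 85), (8, 42, 82), (39, 3, 57),
        (55, 87, 20)], (1, 2, 0)),
     ([(18, 22, 12), (27, 10, 54), (53, 73, 1), (59, 67, 42), (38, 4, 69), (60, 72, 49),
        (45, 2, 74), (84, 55, 28), (13, 31, 6), (63, 52, 8), (26, 44, 47), (64, 93, 62),
        (33, 41, 57), (9, 25, 58), (40, 30, 71), (78, 48, 37), (81, 70, 11), (32, 5, 82),
        (66, 61, 15), (36, 20, 75), (68, 77, 79), (3, 21, 50), (80, 90, 39), (43, 23, 76),
        (16, 46, 86), (88, 83, 51), (65, 56, 34), (85, 87, 19), (24, 17, 89), (14, 29, 35),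
        (91, 92, 7)], (1, 2, 1))]"

lemma resolved_94: "resolved 94"
  by (rule resolved_if_level_check[of 47 2 23 "[1]" base_classes_94]) code_simp+

definition base_classes_118 :: "(block list \<times> affine) list" where
  "base_classes_118 =
    [([(117, 91, 3), (79, 104, 50), (75, 111, 21), (93, 73, 33), (62, 61, 115), (5, 36, 68),
        (99, 100, 7), (34, 38, 37), (11, 28, 47), (15, 56, 1), (89, 66, 76), (40, 54, 29),
        (116, 86, 112), (42, 58, 113), (94, 90, 52), (10, 39, 80), (82, 77, 20), (23, 25, 6),
        (95, 60, 64), (81, 83, 13), (44, 49, 46), (53, 22, 96), (17, 4, 65), (43, 45, 69),
        (92, 59, 31), (24, 8, 72), (102, 97, 9), (108, 98, 16), (19, 51, 110), (26, 57, 2),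
        (35, 27, 114), (105, 107, 109), (88, 78, 30), (32, 12, 101), (41, 18, 63), (67, 87, 55),
        (74, 103, 48), (106, 70, 14), (71, 85, 84)], (1, 8, 0)),
     ([(18, 22, 116), (107, 102, 54), (1, 14, 65), (42, 12, 114), (69, 72, 39), (100, 59, 37),
        (38, 45, 19), (53, 31, 97), (28, 49, 108), (13, 6, 103), (63, 64, 95), (73, 61, 16),
        (106, 104, 62), (47, 32, 93), (68, 112, 33), (101, 89, 55), (60, 76, 58), (40, 10, 70),
        (111, 110, 24), (81, 74, 79), (5, 56, 98), (96, 78, 43), (2, 30, 117), (3, 26, 92),
        (91, 66, 25), (21, 44, 94), (71, 87, 27), (115, 88, 15), (99, 105, 7), (8, 4, 52),
        (20, 50, 67), (23, 36, 77), (86, 113, 46), (83, 80, 51), (17, 35, 85), (75, 82, 57),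
        (41, 29, 9), (11, 48, 109), (84, 90, 34)], (1, 3, 0))]"

lemma resolved_118: "resolved 118"
  by (rule resolved_if_level_check[of 59 3 29 "[1]" base_classes_118]) code_simp+

definition base_classes_262 :: "(block list \<times> affine) list" where
  "base_classes_262 =
    [([(74, 101, 90), (148, 257, 119), (232, 255, 39), (62, 84, 144), (213, 167, 73),
        (37, 43, 166), (222, 169, 208), (16, 5, 194), (158, 182, 8), (135, 175, 131),
        (88, 36, 223), (235, 145, 192), (231, 147, 20), (18, 111, 9), (116, 14, 179),
        (215, 209, 81), (19, 22, 260), (55, 93, 247), (203, 237, 220), (106, 6, 170),
        (72, 129, 171), (69, 86, 250), (102, 122, 207), (120, 41, 202), (140, 184, 64),
        (201, 245, 117), (168, 195, 226), (198, 165, 7), (241, 218, 108), (200, 161, 44),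
        (244, 251, 115), (193, 216, 177), (66, 82, 261), (67, 78, 238), (83, 50, 63),
        (133, 246, 180), (61, 49, 153), (112, 15, 214), (221, 234, 172), (29, 125, 239),
        (92, 11, 176), (181, 224, 126), (249, 173, 141), (146, 136, 159), (164, 163, 34),
        (155, 186, 47), (183, 189, 114), (87, 38, 227), (17, 28, 230), (13, 30, 256),
        (254, 217, 51), (54, 48, 138), (150, 210, 107), (40, 99, 1), (258, 233, 76),
        (188, 204, 190), (212, 197, 42), (160, 143, 130), (85, 24, 96), (68, 60, 156),
        (97, 52, 33), (21, 109, 206), (35, 100, 132), (32, 23, 149), (58, 105, 174),
        (236, 199, 10), (243, 137, 211), (103, 91, 134), (77, 2, 94), (154, 252, 12), (80, 3, 253),
        (70, 124, 45), (123, 65, 240), (46, 95, 4), (157, 185, 89), (71, 25, 178), (219, 191, 110),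
        (53, 104, 229), (205, 225, 151), (79, 75, 98), (118, 127, 139), (128, 57, 56),
        (187, 152, 113), (162, 196, 59), (26, 121, 259), (31, 27, 142), (228, 242, 248)],
        (1, 1, 0)),
     ([(153, 146, 120), (157, 156, 110), (234, 176, 33), (166, 165, 50), (142, 144, 13),
        (19, 23, 233), (91, 41, 172), (251, 248, 220), (44, 128, 195), (14, 69, 228),
        (236, 161, 94), (256, 249, 194), (7, 58, 149), (5, 88, 134), (26, 20, 230),
        (214, 257, 105), (143, 202, 4), (40, 1, 39), (86, 82, 188), (45, 84, 115), (97, 18, 187),
        (163, 229, 9), (239, 216, 159), (200, 183, 16), (96, 127, 167), (215, 137, 31),
        (42, 85, 222), (261, 206, 121), (122, 30, 182), (164, 190, 63), (255, 253, 6),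
        (113, 108, 25), (140, 135, 76), (227, 177, 118), (29, 65, 235), (250, 217, 112),
        (192, 173, 141), (242, 199, 17), (201, 203, 36), (51, 24, 64), (151, 189, 61),
        (106, 98, 186), (211, 178, 54), (158, 218, 154), (179, 241, 27), (125, 72, 67),
        (60, 101, 258), (109, 52, 237), (90, 78, 160), (196, 180, 240), (129, 99, 259),
        (232, 184, 80), (71, 59, 123), (73, 56, 138), (126, 81, 175), (46, 107, 254),
        (57, 37, 247), (225, 208, 245), (168, 155, 92), (169, 243, 102), (114, 53, 204),
        (49, 95, 207), (22, 74, 132), (2, 12, 246), (103, 11, 170), (212, 226, 124), (62, 3, 213),
        (197, 224, 260), (47, 87, 205), (32, 77, 152), (181, 145, 55), (133, 139, 83),
        (93, 68, 162), (100, 117, 136), (111, 66, 198), (219, 221, 48), (223, 244, 70),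
        (231, 191, 209), (43, 79, 147), (130, 89, 185), (10, 119, 34), (28, 38, 193),
        (104, 116, 148), (35, 8, 15), (171, 252, 150), (210, 174, 75), (238, 131, 21)], (1, 1, 1))]"

lemma resolved_262: "resolved 262"
  by (rule resolved_if_level_check[of 131 3 65 "[1]" base_classes_262]) code_simp+

section \<open>Tripling\<close>

lemma card_3_fst_cases:
  assumes "card T = 3"
  obtains (transversal) "inj_on fst T"
    | (vertical) x where "T \<subseteq> {x} \<times> UNIV"
    | (split) x y i j k where "x \<noteq> y" "i \<noteq> j" "T = {(x, i), (x, j), (y, k)}"
proof -
  obtain p q r where pqr: "T = {p, q, r}" "p \<noteq> q" "p \<noteq> r" "q \<noteq> r"
    using assms by (auto simp: card_3_iff)
  obtain x i y j z k where "p = (x, i)" "q = (y, j)" "r = (z, k)" by (cases p, cases q, cases r)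
  note T = pqr(1)[unfolded this] and distinct = pqr(2-4)[unfolded this]
  consider (all_distinct) "x \<noteq> y" "x \<noteq> z" "y \<noteq> z" | (equal) "x = y" "y = z" | (first_two) "x = y" "x \<noteq> z" | (outer_two) "x = z" "x \<noteq> y" | (last_two) "y = z" "x \<noteq> y"
    by blast
  then show thesis
  proof cases
    case all_distinct
    then show thesis using transversal T by simp
  next
    case equal
    then show thesis using vertical[of x] T by auto
  next
    case first_two
    then show thesis using split[of x z i j k] T distinct by simp
  next
    case outer_two
    then show thesis using split[of x y i k j] T distinct by (simp add: insert_commute)
  next
    case last_two
    then show thesis using split[of y x j k i] T distinct by (simp add: insert_commute)
  qed
qed

subsection \<open>Lifted classes\<close>

definition offset :: "nat \<Rightarrow> nat \<Rightarrow> nat set \<Rightarrow> nat \<Rightarrow> nat" where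
  "offset a b B u = (if u = Min B then 0 else if u = Max B then b else a)"

definition lift :: "nat \<Rightarrow> nat \<Rightarrow> nat set \<Rightarrow> nat \<Rightarrow> (nat \<times> nat) set" where
  "lift a b B j = (\<lambda>u. (u, (j + offset a b B u) mod 3)) ` B"

definition lift_class :: "nat \<Rightarrow> nat \<Rightarrow> nat set set \<Rightarrow> (nat \<times> nat) set set" where
  "lift_class a b P = (\<lambda>(B, j). lift a b B j) ` (P \<times> {..<3})"

lemma lift_memD: "(u, c) \<in> lift a b B j \<Longrightarrow> u \<in> B \<and> c = (j + offset a b B u) mod 3"
  unfolding lift_def by auto

lemma add_mod_3_solution: "c < 3 \<Longrightarrow> ((c + 2 * k) mod 3 + k) mod 3 = (c :: nat)"
proof -
  have "((c + 2 * k) mod 3 + k) mod 3 = (c + 3 * k) mod 3" by (simp add: mod_simps algebra_simps)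
  then show "c < 3 \<Longrightarrow> ((c + 2 * k) mod 3 + k) mod 3 = c" by simp
qed

lemma card_3_sorted:
  fixes B :: "'a::linorder set"
  assumes "card B = 3"
  obtains x y z where "B = {x, y, z}" "x < y" "y < z"
proof -
  have "finite B" using assms by (auto intro: card_ge_0_finite)
  then have set: "set (sorted_list_of_set B) = B" and "length (sorted_list_of_set B) = 3"
    using assms by simp_all
  moreover have "\<exists>x y z. xs = [x, y, z]" if "length xs = 3" for xs :: "'a list"
    using that by (auto simp: length_Suc_conv numeral_3_eq_3)
  ultimately obtain x y z where list: "sorted_list_of_set B = [x, y, z]" by blast
  have "sorted_wrt (<) [x, y, z]" using strict_sorted_list_of_set[of B] unfolding list .
  moreover have "B = {x, y, z}" using set unfolding list by simp
  ultimately show thesis using that by simp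
qed

lemma graph_is_lift:
  assumes B: "card B = 3" and f: "\<And>u. u \<in> B \<Longrightarrow> f u < 3"
  shows "\<exists>a<3. \<exists>b<3. \<exists>j<3. (\<lambda>u. (u, f u)) ` B = lift a b B j"
proof -
  obtain x y z where B: "B = {x, y, z}" "x < y" "y < z" using card_3_sorted[OF B] .
  then have extremes: "Min B = x" "Max B = z" by simp_all
  define j a b where "j = f x" and "a = (f y + 2 * j) mod 3" and "b = (f z + 2 * j) mod 3"
  have "(j + offset a b B u) mod 3 = f u" if "u \<in> B" for u
    using that B f add_mod_3_solution[of "f u" j]
    unfolding offset_def extremes a_def b_def j_def by (auto simp: add.commute)
  then have "(\<lambda>u. (u, f u)) ` B = lift a b B j"
    unfolding lift_def by (intro image_cong refl) auto
  moreover have "a < 3" "b < 3" "j < 3" using f[of x] B(1) unfolding a_def b_def j_def by auto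
  ultimately show ?thesis by blast
qed

lemma parallel_class_lift:
  assumes P: "parallel_class {..<n} P" and n: "n mod 3 = 0"
  shows "parallel_class ({..<n} \<times> {..<3}) (lift_class a b P)"
proof (rule parallel_class_coverI[where Y = "{}"])
  have P_finite: "finite P" "card P = n div 3"
    using parallel_class_finite[OF _ P] P unfolding parallel_class_def by auto
  then show "finite (lift_class a b P)" unfolding lift_class_def by simp
  have "card (lift_class a b P) \<le> card (P \<times> {..<3::nat})"
    unfolding lift_class_def using P_finite by (intro card_image_le) simp
  then show "card (lift_class a b P) \<le> card ({..<n} \<times> {..<3::nat}) div 3"
    using P_finite n by (auto simp: card_cartesian_product)
  fix S assume "S \<in> lift_class a b P"
  then obtain B j where S: "S = lift a b B j" "B \<in> P" unfolding lift_class_def by auto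
  note block = parallel_class_block[OF P S(2)]
  show "S \<subseteq> {..<n} \<times> {..<3}"
    using block(1) unfolding S lift_def by auto
  have "card (lift a b B j) \<le> card B"
    unfolding lift_def using block(1) by (intro card_image_le) (auto intro: finite_subset)
  then show "card S \<le> 3" using block(2) S(1) by simp
next
  show "{..<n} \<times> {..<3} - {} \<subseteq> \<Union>(lift_class a b P)"
  proof clarify
    fix u c :: nat assume u: "u < n" "c < 3"
    have "{..<n} - \<Union>P = {}" using parallel_class_uncovered[OF _ P] n by simp
    then obtain B where B: "B \<in> P" "u \<in> B" using u by blast
    have "(u, c) \<in> lift a b B ((c + 2 * offset a b B u) mod 3)"
      unfolding lift_def using B(2) add_mod_3_solution[OF u(2), of "offset a b B u"] by force
    moreover have "lift a b B ((c + 2 * offset a b B u) mod 3) \<in> lift_class a b P"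
      unfolding lift_class_def using B(1) by force
    ultimately show "(u, c) \<in> \<Union>(lift_class a b P)" by blast
  qed
qed simp_all

lemma lift_classE:
  assumes "S \<in> lift_class a b P"
  obtains B j where "B \<in> P" "S = lift a b B j"
  using assms unfolding lift_class_def by auto

lemma meet_once_lift:
  assumes "meet_once P Q"
  shows "meet_once (lift_class a b P) (lift_class a b Q)"
proof (rule meet_onceI)
  fix S T x y assume "S \<in> lift_class a b P" "T \<in> lift_class a b Q"
    and xy: "x \<in> S" "x \<in> T" "y \<in> S" "y \<in> T"
  then obtain B C j k where B: "B \<in> P" "S = lift a b B j" and C: "C \<in> Q" "T = lift a b C k"
    by (metis lift_classE)
  obtain u c v d where e: "x = (u, c)" "y = (v, d)" by (cases x, cases y)
  note mem = lift_memD[OF xy(1)[unfolded e B]] lift_memD[OF xy(2)[unfolded e C]]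
    lift_memD[OF xy(3)[unfolded e B]] lift_memD[OF xy(4)[unfolded e C]]
  then have "u = v" using meet_onceD[OF assms B(1) C(1)] by blast
  then show "x = y" using mem unfolding e by simp
qed

lemma lifted_linked_family:
  assumes L: "linked_family {..<n} I P s (triples {..<n})" and n: "n mod 3 = 0"
  shows "linked_family ({..<n} \<times> {..<3}) (I \<times> {..<3} \<times> {..<3}) (\<lambda>(i, a, b). lift_class a b (P i))
    (map_prod s id) {T \<in> triples ({..<n} \<times> {..<3}). inj_on fst T}"
proof (rule linked_familyI)
  note family = linked_familyD[OF L]
  show "finite (I \<times> {..<3::nat} \<times> {..<3::nat})" using family(1) by simp
  show "inj_on (map_prod s id) (I \<times> {..<3::nat} \<times> {..<3::nat})"
    using family(3) by (intro map_prod_inj_on) simp_all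
  fix k assume k: "k \<in> I \<times> {..<3::nat} \<times> {..<3::nat}"
  then show "map_prod s id k \<in> I \<times> {..<3} \<times> {..<3}" using family(4) by auto
  show "parallel_class ({..<n} \<times> {..<3}) (case k of (i, a, b) \<Rightarrow> lift_class a b (P i))"
    using k parallel_class_lift[OF family(5) n] by auto
  show "meet_once (case k of (i, a, b) \<Rightarrow> lift_class a b (P i))
      (case map_prod s id k of (i, a, b) \<Rightarrow> lift_class a b (P i))"
    using k meet_once_lift[OF family(6)] by auto
next
  fix T :: "(nat \<times> nat) set" assume "T \<in> {T \<in> triples ({..<n} \<times> {..<3}). inj_on fst T}"
  then have T: "T \<subseteq> {..<n} \<times> {..<3}" "card T = 3" "inj_on fst T" unfolding triples_def by auto
  define f where "f u = snd (the_inv_into T fst u)" for u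
  have graph: "T = (\<lambda>u. (u, f u)) ` fst ` T"
    unfolding f_def image_image using the_inv_into_f_f[OF T(3)] by auto
  have card: "card (fst ` T) = 3" using T card_image by metis
  then have "fst ` T \<in> triples {..<n}" unfolding triples_def using T(1) by auto
  then obtain i where i: "i \<in> I" "fst ` T \<in> P i" using linked_familyD(7)[OF L] by blast
  have "f u < 3" if "u \<in> fst ` T" for u using graph T(1) that by blast
  then obtain a b j where "a < 3" "b < 3" "j < 3" "T = lift a b (fst ` T) j"
    using graph_is_lift[OF card, of f] graph by metis
  then show "\<exists>k\<in>I \<times> {..<3} \<times> {..<3}. T \<in> (case k of (i, a, b) \<Rightarrow> lift_class a b (P i))"
    using i unfolding lift_class_def
    by (intro bexI[of _ "(i, a, b)"]) (auto intro!: image_eqI[of _ _ "(fst ` T, j)"])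
qed

definition fibre_class :: "nat \<Rightarrow> (nat \<times> nat) set set" where
  "fibre_class n = (\<lambda>x. {x} \<times> {..<3}) ` {..<n}"

lemma parallel_class_fibre: "parallel_class ({..<n} \<times> {..<3}) (fibre_class n)"
proof (rule parallel_class_coverI[where Y = "{}"])
  show "card (fibre_class n) \<le> card ({..<n} \<times> {..<3::nat}) div 3"
    using card_image_le[of "{..<n}" "\<lambda>x. {x} \<times> {..<3::nat}"]
    by (simp add: fibre_class_def card_cartesian_product)
qed (auto simp: fibre_class_def card_cartesian_product)

lemma meet_once_lift_fibre: "meet_once (lift_class a b P) (fibre_class n)"
proof (rule meet_onceI)
  fix S T x y assume "S \<in> lift_class a b P" "T \<in> fibre_class n"
    and xy: "x \<in> S" "x \<in> T" "y \<in> S" "y \<in> T"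
  then obtain B j where S: "S = lift a b B j" by (metis lift_classE)
  have "fst x = fst y" using xy \<open>T \<in> fibre_class n\<close> unfolding fibre_class_def by auto
  then show "x = y" using xy(1,3) lift_memD unfolding S by (metis prod.collapse)
qed

subsection \<open>Classes of marked fibres\<close>

text \<open>The fibre over \<open>x\<close>, with its marked point replaced by the marked point over \<open>x + d\<close>.\<close>

definition marked_fibre :: "nat \<Rightarrow> nat \<Rightarrow> (nat \<Rightarrow> nat) \<Rightarrow> nat \<Rightarrow> (nat \<times> nat) set" where
  "marked_fibre n d \<mu> x = {x} \<times> ({..<3} - {\<mu> x}) \<union> {((x + d) mod n, \<mu> ((x + d) mod n))}"

lemma mem_marked_fibre_iff:
  "(y, c) \<in> marked_fibre n d \<mu> x \<longleftrightarrow> y = x \<and> c < 3 \<and> c \<noteq> \<mu> x \<or> y = (x + d) mod n \<and> c = \<mu> y"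
  unfolding marked_fibre_def by auto

lemma add_mod_neq: "x < n \<Longrightarrow> 0 < d \<Longrightarrow> d < n \<Longrightarrow> (x + d) mod n \<noteq> (x :: nat)"
  by (cases "x + d < n") (auto simp: mod_if)

lemma sub_add_mod: "x < n \<Longrightarrow> d < n \<Longrightarrow> ((x + (n - d)) mod n + d) mod n = (x :: nat)"
  by (simp add: mod_simps)

lemma add_add_mod_neq:
  fixes x d n :: nat
  assumes "odd n" "x < n" "0 < d" "d < n"
  shows "((x + d) mod n + d) mod n \<noteq> x"
proof
  assume "((x + d) mod n + d) mod n = x"
  then have "(x + 2 * d) mod n = x mod n" using assms(2) by (simp add: mod_simps mult_2 add.assoc)
  then have "n dvd 2 * d" by (metis add_diff_cancel_left' le_add1 mod_eq_dvd_iff_nat)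
  then have "n dvd d" using assms(1) by (simp add: coprime_dvd_mult_right_iff)
  then show False using assms(3,4) by (auto dest: dvd_imp_le)
qed

lemma parallel_class_marked_fibre:
  assumes d: "d < n" and \<mu>: "\<And>x. \<mu> x < 3"
  shows "parallel_class ({..<n} \<times> {..<3}) (marked_fibre n d \<mu> ` {..<n})"
proof (rule parallel_class_coverI[where Y = "{}"])
  show "card (marked_fibre n d \<mu> ` {..<n}) \<le> card ({..<n} \<times> {..<3::nat}) div 3"
    using card_image_le[of "{..<n}" "marked_fibre n d \<mu>"] by (simp add: card_cartesian_product)
  fix S assume "S \<in> marked_fibre n d \<mu> ` {..<n}"
  then obtain x where S: "S = marked_fibre n d \<mu> x" "x < n" by blast
  show "S \<subseteq> {..<n} \<times> {..<3}" using S \<mu> unfolding marked_fibre_def by auto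
  have "card (marked_fibre n d \<mu> x) \<le> card ({x} \<times> ({..<3} - {\<mu> x})) + 1"
    unfolding marked_fibre_def by (rule order_trans[OF card_Un_le]) simp
  then show "card S \<le> 3" using \<mu>[of x] S(1) by (simp add: card_cartesian_product)
next
  show "{..<n} \<times> {..<3} - {} \<subseteq> \<Union>(marked_fibre n d \<mu> ` {..<n})"
  proof clarify
    fix x c :: nat assume x: "x < n" "c < 3"
    show "(x, c) \<in> \<Union>(marked_fibre n d \<mu> ` {..<n})"
    proof (cases "c = \<mu> x")
      case True
      then show ?thesis
        using sub_add_mod[OF x(1) d] x(1)
        by (intro UN_I[of "(x + (n - d)) mod n"]) (auto simp: mem_marked_fibre_iff)
    qed (use x in \<open>auto simp: mem_marked_fibre_iff\<close>)
  qed
qed simp_all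

lemma third_colour_unique:
  fixes i j c c' :: nat
  assumes "i < 3" "j < 3" "c < 3" "c' < 3" "i \<noteq> j" "c \<noteq> i" "c \<noteq> j" "c' \<noteq> i" "c' \<noteq> j"
  shows "c = c'"
  using assms by linarith

lemma meet_once_marked_fibre:
  assumes n: "odd n" "0 < d" "d < n" and \<mu>: "\<And>x. \<mu> x < 3" "\<And>x. \<mu>' x < 3" "\<And>x. \<mu> x \<noteq> \<mu>' x"
  shows "meet_once (marked_fibre n d \<mu> ` {..<n}) (marked_fibre n d \<mu>' ` {..<n})"
proof (rule meet_onceI)
  fix S T p p' assume "S \<in> marked_fibre n d \<mu> ` {..<n}" "T \<in> marked_fibre n d \<mu>' ` {..<n}"
    and pp: "p \<in> S" "p \<in> T" "p' \<in> S" "p' \<in> T"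
  then obtain x z where S: "S = marked_fibre n d \<mu> x" "x < n" and T: "T = marked_fibre n d \<mu>' z" "z < n"
    by blast
  let ?f = "\<lambda>x. (x + d) mod n"
  obtain y c y' c' where e: "p = (y, c)" "p' = (y', c')" by (cases p, cases p')
  note mem = pp[unfolded e S(1) T(1) mem_marked_fibre_iff]
  have f: "?f x \<noteq> x" "?f z \<noteq> z" "?f (?f x) \<noteq> x"
    using add_mod_neq add_add_mod_neq n S(2) T(2) by auto
  show "p = p'"
  proof (cases "y = y'")
    case True
    then show ?thesis
    proof (cases "y = x \<and> y = z")
      case True
      then have "c < 3 \<and> c \<noteq> \<mu> x \<and> c \<noteq> \<mu>' x" "c' < 3 \<and> c' \<noteq> \<mu> x \<and> c' \<noteq> \<mu>' x"
        using mem f(1,2) \<open>y = y'\<close> by auto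
      then have "c = c'" using third_colour_unique \<mu>(1,2,3)[of x] by metis
      then show ?thesis unfolding e using \<open>y = y'\<close> by simp
    qed (use mem f(1,2) e in auto)
  next
    case False
    then have "y = x \<and> y' = ?f x \<or> y = ?f x \<and> y' = x" "y = z \<and> y' = ?f z \<or> y = ?f z \<and> y' = z"
      using mem by auto
    then have "x = z" using f(3) by metis
    then have "c = \<mu> y \<and> c = \<mu>' y \<or> c' = \<mu> y' \<and> c' = \<mu>' y'" using mem f(1) False by auto
    then show ?thesis using \<mu>(3) by metis
  qed
qed

text \<open>A proper colouring of the circulant graph with connection set \<open>\<plusminus>d\<close>, \<open>2 d < n\<close>: alternate along
  runs of length \<open>d\<close> and give the last run the third colour.\<close>

definition run_colour :: "nat \<Rightarrow> nat \<Rightarrow> nat \<Rightarrow> nat" where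
  "run_colour n d x = (if n - d \<le> x then 2 else x div d mod 2)"

definition circulant_colour :: "nat \<Rightarrow> nat \<Rightarrow> nat \<Rightarrow> nat" where
  "circulant_colour n d = run_colour n (if 2 * d < n then d else n - d)"

lemma run_colour_proper:
  assumes "0 < d" "2 * d < n" "x < n"
  shows "run_colour n d x \<noteq> run_colour n d ((x + d) mod n)"
proof (cases "n - d \<le> x")
  case True
  then have "(x + d) mod n = x + d - n" using assms by (simp add: mod_if)
  moreover have "x + d - n < d" using assms by simp
  ultimately show ?thesis using True assms by (simp add: run_colour_def)
next
  case False
  then have "(x + d) mod n = x + d" "(x + d) div d = Suc (x div d)"
    using assms div_add_self2[of d x] by simp_all
  then show ?thesis using False unfolding run_colour_def by (simp add: mod2_eq_if)
qed

lemma circulant_colour_less: "circulant_colour n d x < 3"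
  unfolding circulant_colour_def run_colour_def by (simp add: mod2_eq_if)

lemma circulant_colour_proper:
  assumes "0 < d" "d < n" "odd n" "x < n"
  shows "circulant_colour n d x \<noteq> circulant_colour n d ((x + d) mod n)"
proof (cases "2 * d < n")
  case True
  then show ?thesis using run_colour_proper[of d n x] assms by (simp add: circulant_colour_def)
next
  case False
  then have "2 * (n - d) < n" using assms by presburger
  moreover have "((x + d) mod n + (n - d)) mod n = x"
    using assms by (simp only: mod_add_left_eq) simp
  ultimately show ?thesis
    using run_colour_proper[of "n - d" n "(x + d) mod n"] assms False by (simp add: circulant_colour_def)
qed

definition marking :: "nat \<Rightarrow> nat \<Rightarrow> nat \<times> nat \<Rightarrow> nat \<Rightarrow> nat" where
  "marking n d = (\<lambda>(u, v) x. (u + v * circulant_colour n d x) mod 3)"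

lemma affine_interpolation_mod_3:
  fixes a b k l :: nat
  assumes "a < 3" "b < 3" "k < 3" "l < 3" "a \<noteq> b"
  obtains u v where "u < 3" "v < 3" "(u + v * a) mod 3 = k" "(u + v * b) mod 3 = l"
proof -
  \<comment> \<open>\<open>b - a\<close> is its own inverse modulo 3.\<close>
  define v where "v = ((l + 2 * k) * (b + 2 * a)) mod 3"
  define u where "u = (k + 2 * v * a) mod 3"
  have cases: "c = 0 \<or> c = 1 \<or> c = 2" if "c < 3" for c :: nat using that by auto
  have "(u + v * a) mod 3 = (k + 3 * (v * a)) mod 3"
    unfolding u_def by (simp add: mod_simps algebra_simps)
  moreover have "(u + v * b) mod 3 = l"
    unfolding u_def v_def
    using cases[OF assms(1)] cases[OF assms(2)] cases[OF assms(3)] cases[OF assms(4)] assms(5)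
    by (elim disjE) simp_all
  ultimately show thesis using that[of u v] assms(3) by (simp add: u_def v_def)
qed

lemma marking_interpolation:
  assumes "0 < d" "d < n" "odd n" "x < n" "k < 3" "l < 3"
  shows "\<exists>uv\<in>{..<3} \<times> {..<3}. marking n d uv x = k \<and> marking n d uv ((x + d) mod n) = l"
proof -
  obtain u v where "u < 3" "v < 3" "marking n d (u, v) x = k" "marking n d (u, v) ((x + d) mod n) = l"
    using affine_interpolation_mod_3[OF circulant_colour_less circulant_colour_less assms(5,6)
        circulant_colour_proper[OF assms(1-4)]]
    unfolding marking_def prod.case by metis
  then show ?thesis by (intro bexI[of _ "(u, v)"]) auto
qed

lemma marked_linked_family:
  assumes n: "odd n"
  shows "linked_family ({..<n} \<times> {..<3}) ({1..<n} \<times> {..<3} \<times> {..<3})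
    (\<lambda>(d, uv). marked_fibre n d (marking n d uv) ` {..<n}) (\<lambda>(d, u, v). (d, (u + 1) mod 3, v))
    {T \<in> triples ({..<n} \<times> {..<3::nat}). \<exists>x y c c' e. x \<noteq> y \<and> c \<noteq> c' \<and> T = {(x, c), (x, c'), (y, e)}}"
proof (rule linked_familyI)
  have mod_3: "u = u'" if "u < 3" "u' < 3" "Suc u mod 3 = Suc u' mod 3" for u u' :: nat
    using that by (auto simp: mod_Suc split: if_splits)
  show "inj_on (\<lambda>(d, u, v). (d, (u + 1) mod 3, v)) ({1..<n} \<times> {..<3::nat} \<times> {..<3::nat})"
    by (intro inj_onI) (auto intro: mod_3)
  fix k :: "nat \<times> nat \<times> nat" assume "k \<in> {1..<n} \<times> {..<3} \<times> {..<3}"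
  then obtain d u v where k: "k = (d, u, v)" "0 < d" "d < n" "u < 3" "v < 3" by auto
  have less: "marking n d uv x < 3" for uv x unfolding marking_def by (cases uv) simp
  have "marking n d ((u + 1) mod 3, v) x = (marking n d (u, v) x + 1) mod 3" for x
    unfolding marking_def by (simp add: mod_simps)
  moreover have "c \<noteq> (c + 1) mod 3" if "c < 3" for c :: nat using that by (simp add: mod_Suc)
  ultimately have neq: "marking n d (u, v) x \<noteq> marking n d ((u + 1) mod 3, v) x" for x
    using less by metis
  show "parallel_class ({..<n} \<times> {..<3})
      (case k of (d, uv) \<Rightarrow> marked_fibre n d (marking n d uv) ` {..<n})"
    using parallel_class_marked_fibre[OF k(3) less] k(1) by simp
  show "meet_once (case k of (d, uv) \<Rightarrow> marked_fibre n d (marking n d uv) ` {..<n})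
      (case case k of (d, u, v) \<Rightarrow> (d, (u + 1) mod 3, v) of
        (d, uv) \<Rightarrow> marked_fibre n d (marking n d uv) ` {..<n})"
    using meet_once_marked_fibre[OF n k(2,3) less less neq] k(1) by simp
next
  fix T assume "T \<in> {T \<in> triples ({..<n} \<times> {..<3::nat}).
    \<exists>x y c c' e. x \<noteq> y \<and> c \<noteq> c' \<and> T = {(x, c), (x, c'), (y, e)}}"
  then obtain x y c c' e where T: "x \<noteq> y" "c \<noteq> c'" "T = {(x, c), (x, c'), (y, e)}"
    and "T \<subseteq> {..<n} \<times> {..<3}"
    unfolding triples_def by auto
  then have r: "x < n" "y < n" "c < 3" "c' < 3" "e < 3" by auto
  define d where "d = (y + (n - x)) mod n"
  have d: "(x + d) mod n = y"
    using sub_add_mod[OF r(2,1)] unfolding d_def by (simp add: add.commute)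
  have "0 < d" "d < n" using d T(1) r unfolding d_def by (auto intro: gr0I)
  obtain k :: nat where k: "k < 3" "k \<noteq> c" "k \<noteq> c'"
    using that[of 0] that[of 1] that[of 2] by fastforce
  have "{..<3} - {k} = {c, c'}" using third_colour_unique k r(3,4) T(2) by auto
  moreover obtain uv where uv: "uv \<in> {..<3} \<times> {..<3}" "marking n d uv x = k" "marking n d uv y = e"
    using marking_interpolation[OF \<open>0 < d\<close> \<open>d < n\<close> n r(1) k(1) r(5)] d by auto
  ultimately have "T = marked_fibre n d (marking n d uv) x"
    unfolding marked_fibre_def d T(3) uv by auto
  then show "\<exists>k\<in>{1..<n} \<times> {..<3} \<times> {..<3}.
      T \<in> (case k of (d, uv) \<Rightarrow> marked_fibre n d (marking n d uv) ` {..<n})"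
    using uv(1) r(1) \<open>0 < d\<close> \<open>d < n\<close> by (intro bexI[of _ "(d, uv)"]) auto
qed auto

subsection \<open>The tripling theorem\<close>

lemma triples_fibred_cases:
  assumes "T \<in> triples ({..<n} \<times> {..<3::nat})"
  shows "inj_on fst T \<or> T \<in> fibre_class n \<or>
    (\<exists>x y c c' e. x \<noteq> y \<and> c \<noteq> c' \<and> T = {(x, c), (x, c'), (y, e)})"
proof -
  have T: "T \<subseteq> {..<n} \<times> {..<3}" "card T = 3" using assms unfolding triples_def by auto
  from T(2) show ?thesis
  proof (cases rule: card_3_fst_cases)
    case (vertical x)
    then have "T = {x} \<times> {..<3}"
      using T by (intro card_subset_eq) (auto simp: card_cartesian_product)
    moreover from this have "(x, 0) \<in> T" by simp
    then have "x < n" using T(1) by blast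
    ultimately show ?thesis unfolding fibre_class_def by blast
  qed blast+
qed

theorem resolved_triple:
  assumes res: "resolved n" and n: "odd n" "n mod 3 = 0" "3 \<le> n"
  shows "resolved (3 * n)"
proof -
  let ?X = "{..<n} \<times> {..<3::nat}" and ?F = "{..<3::nat} \<times> {..<3::nat}"
  obtain I :: "nat set" and P s where L: "linked_family {..<n} I P s (triples {..<n})"
    and count: "6 * (card I * (n div 3)) \<le> n * (n - 1) * (n - 2)"
    using resolvedE[OF res] by metis
  have "{0, 1, 2} \<in> triples {..<n}" using n(3) unfolding triples_def by auto
  then obtain i where i: "i \<in> I" using linked_familyD(7)[OF L] by blast
  have "linked ?X (card (I \<times> ?F) + card {()})
      ({T \<in> triples ?X. inj_on fst T} \<union> (\<Union>_\<in>{()}. fibre_class n))"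
    using i parallel_class_fibre meet_once_lift_fibre meet_once_lift_fibre[unfolded meet_once_commute[of "lift_class _ _ _"]]
    by (intro linked_insert[OF lifted_linked_family[OF L n(2)], where h = "\<lambda>_. (i, 0, 0)"]) auto
  note linked_Un[OF this linkedI[OF marked_linked_family[OF n(1)] order_refl]]
  then have "linked ?X (card (I \<times> ?F) + card {()} + card ({1..<n} \<times> ?F)) (triples ?X)"
    by (rule linked_mono) (use triples_fibred_cases in auto)
  moreover have "card (I \<times> ?F) + card {()} + card ({1..<n} \<times> ?F) = 9 * card I + 9 * n - 8"
    using n(3) by (simp add: card_cartesian_product)
  ultimately have L: "linked ?X (9 * card I + 9 * n - 8) (triples ?X)" by simp
  obtain l where l: "n = l + 2" using le_Suc_ex[of 2 n] n(3) by (auto simp: add.commute)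
  have "n * (2 * card I) = 6 * (card I * (n div 3))" using n(2) by auto
  also have "\<dots> \<le> n * ((n - 1) * (n - 2))" using count by (simp add: mult.assoc)
  finally have "2 * card I \<le> (n - 1) * (n - 2)" using n(3) by simp
  then have "2 * card I \<le> (l + 1) * l" using l by simp
  then have "2 * (9 * card I + 9 * n - 8) \<le> (3 * l + 5) * (3 * l + 4)" unfolding l by (simp add: algebra_simps)
  then have "3 * n * (2 * (9 * card I + 9 * n - 8)) \<le> 3 * n * ((3 * n - 1) * (3 * n - 2))"
    unfolding l by (intro mult_le_mono2) (simp add: algebra_simps)
  then show ?thesis
    using L by (intro resolvedI[OF L]) (simp_all add: card_cartesian_product mult.assoc mult.left_commute)
qed

section \<open>The nine-fold construction\<close>

subsection \<open>The affine plane of order three\<close>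

text \<open>Near parallel classes \<open>{\<infinity>, a, b}, U, V\<close> on the plane with an extra point \<open>\<infinity>\<close>, each missing
  \<open>x\<close>, listed as \<open>(x, a, b, U, V)\<close>: an overlarge set of Kirkman triple systems, without the
  classes of lines, which miss \<open>\<infinity>\<close>.\<close>

type_synonym near_base = "int \<times> int \<times> int \<times> block \<times> block"

definition near_classes :: "near_base list" where
  "near_classes =
    [(0, 1, 2, (3, 4, 6), (5, 7, 8)), (1, 2, 0, (4, 5, 7), (3, 6, 8)),
    (2, 0, 1, (3, 5, 8), (4, 6, 7)), (3, 4, 5, (0, 6, 7), (1, 2, 8)),
    (4, 5, 3, (1, 7, 8), (0, 2, 6)), (5, 3, 4, (2, 6, 8), (0, 1, 7)),
    (6, 7, 8, (0, 1, 3), (2, 4, 5)), (7, 8, 6, (1, 2, 4), (0, 3, 5)),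
    (8, 6, 7, (0, 2, 5), (1, 3, 4)), (0, 3, 6, (1, 2, 5), (4, 7, 8)),
    (1, 4, 7, (0, 2, 3), (5, 6, 8)), (2, 5, 8, (0, 1, 4), (3, 6, 7)),
    (3, 6, 0, (4, 5, 8), (1, 2, 7)), (4, 7, 1, (3, 5, 6), (0, 2, 8)),
    (5, 8, 2, (3, 4, 7), (0, 1, 6)), (6, 0, 3, (2, 7, 8), (1, 4, 5)),
    (7, 1, 4, (0, 6, 8), (2, 3, 5)), (8, 2, 5, (1, 6, 7), (0, 3, 4)),
    (0, 4, 8, (1, 2, 3), (5, 6, 7)), (1, 5, 6, (0, 2, 4), (3, 7, 8)),
    (2, 3, 7, (0, 1, 5), (4, 6, 8)), (3, 7, 2, (4, 5, 6), (0, 1, 8)),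
    (4, 8, 0, (3, 5, 7), (1, 2, 6)), (5, 6, 1, (3, 4, 8), (0, 2, 7)),
    (6, 1, 5, (0, 7, 8), (2, 3, 4)), (7, 2, 3, (1, 6, 8), (0, 4, 5)),
    (8, 0, 4, (2, 6, 7), (1, 3, 5)), (0, 5, 7, (1, 3, 6), (2, 4, 8)),
    (1, 3, 8, (2, 4, 7), (0, 5, 6)), (2, 4, 6, (0, 5, 8), (1, 3, 7)),
    (3, 8, 1, (0, 4, 6), (2, 5, 7)), (4, 6, 2, (1, 5, 7), (0, 3, 8)),
    (5, 7, 0, (2, 3, 8), (1, 4, 6)), (6, 2, 4, (0, 3, 7), (1, 5, 8)),
    (7, 0, 5, (1, 4, 8), (2, 3, 6)), (8, 1, 3, (2, 5, 6), (0, 4, 7))]"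

definition line_classes :: "block list list" where
  "line_classes =
    [[(0, 3, 6), (1, 4, 7), (2, 5, 8)],
     [(0, 1, 2), (3, 4, 5), (6, 7, 8)],
     [(0, 4, 8), (1, 5, 6), (2, 3, 7)],
     [(0, 5, 7), (1, 3, 8), (2, 4, 6)]]"

abbreviation lines :: "block list" where
  "lines \<equiv> concat line_classes"

text \<open>An entry \<open>(x, L, r, \<epsilon>)\<close> assigns residues mod 3 to the points of a line \<open>L\<close> missing \<open>x\<close>. At every
  point other than \<open>x\<close> the three lines missing \<open>x\<close> receive the three residues. For a fixed line the
  residue vectors run, up to constants, once through all that are not arithmetic progressions in
  the first table, and once through all progressions with a sign \<open>\<epsilon>\<close> in the second.\<close>

type_synonym entry = "int \<times> block \<times> (int \<times> int \<times> int) \<times> int"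

definition generic_entries :: "entry list" where
  "generic_entries =
    [(0, (1, 4, 7), (0, 0, 1), 0), (0, (2, 5, 8), (0, 0, 2), 0), (0, (3, 4, 5), (0, 1, 1), 0),
    (0, (6, 7, 8), (1, 0, 0), 0), (0, (1, 5, 6), (1, 2, 2), 0), (0, (2, 3, 7), (1, 1, 2), 0),
    (0, (1, 3, 8), (2, 2, 1), 0), (0, (2, 4, 6), (2, 2, 0), 0), (1, (0, 3, 6), (0, 0, 2), 0),
    (1, (2, 5, 8), (0, 0, 1), 0), (1, (3, 4, 5), (1, 0, 1), 0), (1, (6, 7, 8), (0, 1, 0), 0),
    (1, (0, 4, 8), (1, 1, 2), 0), (1, (2, 3, 7), (1, 2, 2), 0), (1, (0, 5, 7), (2, 2, 0), 0),
    (1, (2, 4, 6), (2, 2, 1), 0), (2, (0, 3, 6), (0, 0, 1), 0), (2, (1, 4, 7), (0, 0, 2), 0),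
    (2, (3, 4, 5), (1, 1, 0), 0), (2, (6, 7, 8), (0, 0, 1), 0), (2, (0, 4, 8), (1, 2, 2), 0),
    (2, (1, 5, 6), (1, 1, 2), 0), (2, (0, 5, 7), (2, 2, 1), 0), (2, (1, 3, 8), (2, 2, 0), 0),
    (3, (1, 4, 7), (1, 0, 0), 0), (3, (2, 5, 8), (2, 0, 0), 0), (3, (0, 1, 2), (1, 0, 0), 0),
    (3, (6, 7, 8), (0, 1, 1), 0), (3, (0, 4, 8), (2, 1, 2), 0), (3, (1, 5, 6), (2, 1, 1), 0),
    (3, (0, 5, 7), (0, 2, 2), 0), (3, (2, 4, 6), (1, 2, 2), 0), (4, (0, 3, 6), (2, 0, 0), 0),
    (4, (2, 5, 8), (1, 0, 0), 0), (4, (0, 1, 2), (0, 1, 0), 0), (4, (6, 7, 8), (1, 0, 1), 0),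
    (4, (1, 5, 6), (2, 1, 2), 0), (4, (2, 3, 7), (2, 1, 1), 0), (4, (0, 5, 7), (1, 2, 2), 0),
    (4, (1, 3, 8), (0, 2, 2), 0), (5, (0, 3, 6), (1, 0, 0), 0), (5, (1, 4, 7), (2, 0, 0), 0),
    (5, (0, 1, 2), (0, 0, 1), 0), (5, (6, 7, 8), (1, 1, 0), 0), (5, (0, 4, 8), (2, 1, 1), 0),
    (5, (2, 3, 7), (2, 1, 2), 0), (5, (1, 3, 8), (1, 2, 2), 0), (5, (2, 4, 6), (0, 2, 2), 0),
    (6, (1, 4, 7), (0, 1, 0), 0), (6, (2, 5, 8), (0, 2, 0), 0), (6, (0, 1, 2), (0, 1, 1), 0),
    (6, (3, 4, 5), (1, 0, 0), 0), (6, (0, 4, 8), (1, 2, 1), 0), (6, (2, 3, 7), (2, 2, 1), 0),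
    (6, (0, 5, 7), (2, 1, 2), 0), (6, (1, 3, 8), (2, 0, 2), 0), (7, (0, 3, 6), (0, 2, 0), 0),
    (7, (2, 5, 8), (0, 1, 0), 0), (7, (0, 1, 2), (1, 0, 1), 0), (7, (3, 4, 5), (0, 1, 0), 0),
    (7, (0, 4, 8), (2, 2, 1), 0), (7, (1, 5, 6), (1, 2, 1), 0), (7, (1, 3, 8), (2, 1, 2), 0),
    (7, (2, 4, 6), (2, 0, 2), 0), (8, (0, 3, 6), (0, 1, 0), 0), (8, (1, 4, 7), (0, 2, 0), 0),
    (8, (0, 1, 2), (1, 1, 0), 0), (8, (3, 4, 5), (0, 0, 1), 0), (8, (1, 5, 6), (2, 2, 1), 0),
    (8, (2, 3, 7), (1, 2, 1), 0), (8, (0, 5, 7), (2, 0, 2), 0), (8, (2, 4, 6), (2, 1, 2), 0)]"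

definition progression_entries :: "entry list" where
  "progression_entries =
    [(0, (1, 4, 7), (1, 2, 0), 1), (0, (2, 5, 8), (1, 2, 0), 1), (0, (3, 4, 5), (0, 0, 0), 1),
    (0, (6, 7, 8), (1, 1, 1), 1), (0, (1, 5, 6), (2, 1, 0), 1), (0, (2, 3, 7), (2, 2, 2), 1),
    (0, (1, 3, 8), (0, 1, 2), 1), (0, (2, 4, 6), (0, 1, 2), 1), (1, (0, 3, 6), (0, 1, 2), 1),
    (1, (2, 5, 8), (2, 2, 2), 1), (1, (3, 4, 5), (2, 0, 1), 1), (1, (6, 7, 8), (0, 2, 1), 1),
    (1, (0, 4, 8), (1, 2, 0), 1), (1, (2, 3, 7), (0, 0, 0), -1), (1, (0, 5, 7), (2, 0, 1), 1),
    (1, (2, 4, 6), (1, 1, 1), 1), (2, (0, 3, 6), (2, 0, 1), -1), (2, (1, 4, 7), (2, 2, 2), 1),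
    (2, (3, 4, 5), (1, 1, 1), -1), (2, (6, 7, 8), (0, 1, 2), 1), (2, (0, 4, 8), (0, 0, 0), 1),
    (2, (1, 5, 6), (1, 0, 2), -1), (2, (0, 5, 7), (1, 2, 0), -1), (2, (1, 3, 8), (0, 2, 1), 1),
    (3, (1, 4, 7), (2, 1, 0), 1), (3, (2, 5, 8), (1, 0, 2), 1), (3, (0, 1, 2), (1, 0, 2), 1),
    (3, (6, 7, 8), (2, 1, 0), -1), (3, (0, 4, 8), (0, 2, 1), 1), (3, (1, 5, 6), (1, 1, 1), 1),
    (3, (0, 5, 7), (2, 2, 2), 1), (3, (2, 4, 6), (0, 0, 0), -1), (4, (0, 3, 6), (2, 1, 0), 1),
    (4, (2, 5, 8), (0, 2, 1), -1), (4, (0, 1, 2), (0, 1, 2), 1), (4, (6, 7, 8), (2, 2, 2), -1),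
    (4, (1, 5, 6), (2, 0, 1), 1), (4, (2, 3, 7), (1, 2, 0), 1), (4, (0, 5, 7), (1, 1, 1), -1),
    (4, (1, 3, 8), (0, 0, 0), 1), (5, (0, 3, 6), (2, 1, 0), -1), (5, (1, 4, 7), (2, 1, 0), -1),
    (5, (0, 1, 2), (1, 0, 2), -1), (5, (6, 7, 8), (1, 2, 0), -1), (5, (0, 4, 8), (0, 2, 1), -1),
    (5, (2, 3, 7), (0, 2, 1), 1), (5, (1, 3, 8), (1, 0, 2), -1), (5, (2, 4, 6), (1, 0, 2), 1),
    (6, (1, 4, 7), (0, 1, 2), -1), (6, (2, 5, 8), (0, 0, 0), -1), (6, (0, 1, 2), (1, 1, 1), 1),
    (6, (3, 4, 5), (0, 2, 1), 1), (6, (0, 4, 8), (2, 0, 1), -1), (6, (2, 3, 7), (2, 1, 0), -1),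
    (6, (0, 5, 7), (0, 2, 1), 1), (6, (1, 3, 8), (2, 2, 2), -1), (7, (0, 3, 6), (0, 0, 0), 1),
    (7, (2, 5, 8), (0, 1, 2), -1), (7, (0, 1, 2), (2, 0, 1), -1), (7, (3, 4, 5), (1, 2, 0), -1),
    (7, (0, 4, 8), (1, 1, 1), -1), (7, (1, 5, 6), (2, 2, 2), -1), (7, (1, 3, 8), (1, 2, 0), -1),
    (7, (2, 4, 6), (2, 0, 1), -1), (8, (0, 3, 6), (0, 0, 0), -1), (8, (1, 4, 7), (1, 1, 1), -1),
    (8, (0, 1, 2), (2, 2, 2), -1), (8, (3, 4, 5), (1, 0, 2), -1), (8, (1, 5, 6), (0, 1, 2), -1),
    (8, (2, 3, 7), (1, 2, 0), -1), (8, (0, 5, 7), (1, 0, 2), -1), (8, (2, 4, 6), (0, 2, 1), -1)]"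

definition entries :: "bool \<Rightarrow> entry list" where
  "entries b = (if b then progression_entries else generic_entries)"

definition labels :: "entry \<Rightarrow> (int \<times> int) set" where
  "labels = (\<lambda>(x, (a, b, c), (r1, r2, r3), \<epsilon>). {(a, r1), (b, r2), (c, r3)})"

subsection \<open>Checks of the tables\<close>

definition ordered_blocks :: "block set" where
  "ordered_blocks = {(a, b, c). 0 \<le> a \<and> a < b \<and> b < c \<and> c \<le> 8}"

lemma set_eq_if_merge_sort_eq: "merge_sort xs = merge_sort ys \<Longrightarrow> set xs = set ys"
  by (metis set_merge_sort)

lemma near_classes_points:
  assumes "(x, a, b, (u1, u2, u3), (v1, v2, v3)) \<in> set near_classes"
  shows "distinct [x, a, b, u1, u2, u3, v1, v2, v3]" "set [x, a, b, u1, u2, u3, v1, v2, v3] = {0..8}"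
proof -
  have "\<forall>(x, a, b, U, V)\<in>set near_classes. consecutive 0 (merge_sort (x # a # b # points [U, V])) 9"
    by code_simp
  then have "consecutive 0 (merge_sort [x, a, b, u1, u2, u3, v1, v2, v3]) 9"
    using assms unfolding points_def by fastforce
  then have sorted: "merge_sort [x, a, b, u1, u2, u3, v1, v2, v3] = [0..8]"
    using consecutive_imp_upto by force
  have "set (merge_sort [x, a, b, u1, u2, u3, v1, v2, v3]) = {0..8}"
    unfolding sorted by (rule set_upto)
  then show "set [x, a, b, u1, u2, u3, v1, v2, v3] = {0..8}" unfolding set_merge_sort .
  have "mset [x, a, b, u1, u2, u3, v1, v2, v3] = mset [0..8]" by (metis sorted mset_merge_sort)
  then show "distinct [x, a, b, u1, u2, u3, v1, v2, v3]"
    using mset_eq_imp_distinct_iff distinct_upto by metis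
qed

lemma card_near_classes: "card (set near_classes) = 36"
proof -
  have "distinct near_classes \<and> length near_classes = 36" by code_simp
  then show ?thesis using distinct_card by metis
qed

lemma near_class_with_pair:
  assumes "a \<in> {0..8}" "b \<in> {0..8}" "a \<noteq> b"
  shows "\<exists>x U V. (x, a, b, U, V) \<in> set near_classes \<or> (x, b, a, U, V) \<in> set near_classes"
proof -
  have "set (map (\<lambda>(x, a, b, U, V). (min a b, max a b)) near_classes) =
      set [(a, b). a \<leftarrow> [0..8], b \<leftarrow> [a + 1..8]]"
    by (rule set_eq_if_merge_sort_eq) code_simp
  moreover have "(min a b, max a b) \<in> set [(a, b). a \<leftarrow> [0..8], b \<leftarrow> [a + 1..8]]"
    using assms by (auto simp: min_def max_def image_iff)
  ultimately have "(min a b, max a b) \<in> set (map (\<lambda>(x, a, b, U, V). (min a b, max a b)) near_classes)"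
    by simp
  then obtain x a' b' U V where "(x, a', b', U, V) \<in> set near_classes"
    and "min a' b' = min a b" "max a' b' = max a b"
    by auto
  moreover from this(2,3) have "a' = a \<and> b' = b \<or> a' = b \<and> b' = a"
    by (auto simp: min_def max_def split: if_splits)
  ultimately show ?thesis by blast
qed

lemma near_class_missing:
  assumes "x \<in> {0..8}" "a \<in> {0..8}" "a \<noteq> x"
  shows "\<exists>b U V. (x, a, b, U, V) \<in> set near_classes \<or> (x, b, a, U, V) \<in> set near_classes"
proof -
  have "set (concat (map (\<lambda>(x, a, b, U, V). [(x, a), (x, b)]) near_classes)) =
      set [(x, a). x \<leftarrow> [0..8], a \<leftarrow> [0..8], a \<noteq> x]"
    by (rule set_eq_if_merge_sort_eq) code_simp
  moreover have "(x, a) \<in> set [(x, a). x \<leftarrow> [0..8], a \<leftarrow> [0..8], a \<noteq> x]"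
    using assms by auto
  ultimately have "(x, a) \<in> set (concat (map (\<lambda>(x, a, b, U, V). [(x, a), (x, b)]) near_classes))"
    by simp
  then show ?thesis by (auto simp del: split_paired_Ex)
qed

lemma blocks_of_plane:
  "set (lines @ concat (map (\<lambda>(x, a, b, U, V). [U, V]) near_classes)) = ordered_blocks"
proof -
  have "set (lines @ concat (map (\<lambda>(x, a, b, U, V). [U, V]) near_classes)) =
      set [(a, b, c). a \<leftarrow> [0..8], b \<leftarrow> [a + 1..8], c \<leftarrow> [b + 1..8]]"
    by (rule set_eq_if_merge_sort_eq) code_simp
  also have "\<dots> = ordered_blocks" unfolding ordered_blocks_def by (auto simp: image_iff)
  finally show ?thesis .
qed

lemma near_class_with_block:
  assumes "L \<in> ordered_blocks" "L \<notin> set lines"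
  shows "\<exists>x a b U. (x, a, b, L, U) \<in> set near_classes \<or> (x, a, b, U, L) \<in> set near_classes"
  using assms unfolding blocks_of_plane[symmetric] by (auto simp del: split_paired_Ex)

lemma near_class_ordered:
  assumes "(x, a, b, U, V) \<in> set near_classes"
  shows "U \<in> ordered_blocks" "V \<in> ordered_blocks"
  using assms unfolding blocks_of_plane[symmetric] 
  by (cases U; cases V; auto intro!: bexI[of _ "(x, a, b, U, V)"])+

lemma inj_on_block_set: "inj_on block_set ordered_blocks"
proof (rule inj_on_inverseI)
  fix L assume "L \<in> ordered_blocks"
  then obtain a b c where L: "L = (a, b, c)" "a < b" "b < c" unfolding ordered_blocks_def by auto
  then have "sorted_list_of_set (block_set L) = [a, b, c]" unfolding block_set_def by simp
  then show "(\<lambda>B. let bs = sorted_list_of_set B in (bs ! 0, bs ! 1, bs ! 2)) (block_set L) = L"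
    using L by simp
qed

lemma lines_ordered: "set lines \<subseteq> ordered_blocks"
  unfolding blocks_of_plane[symmetric] by simp

lemma card_line_classes: "card (set line_classes) = 4"
proof -
  have "distinct line_classes \<and> length line_classes = 4" by code_simp
  then show ?thesis using distinct_card by metis
qed

lemma line_class_parallel:
  assumes "ls \<in> set line_classes"
  shows "length ls = 3" "\<Union>(block_set ` set ls) = {0..8}"
    and "\<And>L L' y. L \<in> set ls \<Longrightarrow> L' \<in> set ls \<Longrightarrow> y \<in> block_set L \<Longrightarrow> y \<in> block_set L' \<Longrightarrow> L = L'"
proof -
  have "\<forall>ls\<in>set line_classes. length ls = 3 \<and> parallel_check 9 ls"
    by code_simp
  then have ls: "length ls = 3" "parallel_check 9 ls" using assms by auto
  show "length ls = 3" by fact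
  show "\<Union>(block_set ` set ls) = {0..8}"
    using parallel_check_points[OF ls(2)] unfolding set_points by auto
  fix L L' y assume L: "L \<in> set ls" "L' \<in> set ls" "y \<in> block_set L" "y \<in> block_set L'"
  then have "block_set L = block_set L'"
    using parallel_class_unique[OF parallel_check_sound[OF ls(2)]] by blast
  moreover have "L \<in> ordered_blocks" "L' \<in> ordered_blocks" using L lines_ordered assms by auto
  ultimately show "L = L'" using inj_onD[OF inj_on_block_set] by blast
qed

lemma entries_labels:
  "set (concat (map (\<lambda>(x, (a, b, c), (r1, r2, r3), \<epsilon>). [(x, a, r1), (x, b, r2), (x, c, r3)]) (entries i))) =
    set [(x, y, r). x \<leftarrow> [0..8], y \<leftarrow> [0..8], y \<noteq> x, r \<leftarrow> [0..2]]"
proof (cases i)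
  case True
  show ?thesis unfolding entries_def if_P[OF True] by (rule set_eq_if_merge_sort_eq) code_simp
next
  case False
  show ?thesis unfolding entries_def if_not_P[OF False] by (rule set_eq_if_merge_sort_eq) code_simp
qed

lemma entry_labels:
  assumes "en \<in> set (entries i)" "(y, r) \<in> labels en"
  shows "fst en \<in> {0..8}" "y \<in> {0..8}" "y \<noteq> fst en" "r \<in> {0..2}"
proof -
  obtain x a b c r1 r2 r3 \<epsilon> where en: "en = (x, (a, b, c), (r1, r2, r3), \<epsilon>)" by (metis prod.exhaust)
  have "(x, y, r) \<in> set (concat (map (\<lambda>(x, (a, b, c), (r1, r2, r3), \<epsilon>). [(x, a, r1), (x, b, r2), (x, c, r3)]) (entries i)))"
    using assms unfolding en labels_def by force
  then have "(x, y, r) \<in> set [(x, y, r). x \<leftarrow> [0..8], y \<leftarrow> [0..8], y \<noteq> x, r \<leftarrow> [0..2]]"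
    unfolding entries_labels .
  then show "fst en \<in> {0..8}" "y \<in> {0..8}" "y \<noteq> fst en" "r \<in> {0..2}" unfolding en by auto
qed

lemma entry_with_label:
  assumes "x \<in> {0..8}" "y \<in> {0..8}" "y \<noteq> x" "r \<in> {0..2}"
  shows "\<exists>en\<in>set (entries i). fst en = x \<and> (y, r) \<in> labels en"
proof -
  have "(x, y, r) \<in> set [(x, y, r). x \<leftarrow> [0..8], y \<leftarrow> [0..8], y \<noteq> x, r \<leftarrow> [0..2]]"
    using assms by (auto simp: image_iff)
  then obtain a b c r1 r2 r3 \<epsilon> where en: "(x, (a, b, c), (r1, r2, r3), \<epsilon>) \<in> set (entries i)"
    and "(y, r) \<in> {(a, r1), (b, r2), (c, r3)}"
    unfolding entries_labels[symmetric, of i] by auto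
  then show ?thesis unfolding labels_def by (intro bexI[OF _ en]) auto
qed

lemma generic_entries_residues:
  "set (map (\<lambda>(x, L, (r1, r2, r3), \<epsilon>). (L, (r2 - r1) mod 3, (r3 - r1) mod 3)) generic_entries) =
    set [(L, p, q). L \<leftarrow> lines, p \<leftarrow> [0..2], q \<leftarrow> [0..2], q \<noteq> 2 * p mod 3]"
  by (rule set_eq_if_merge_sort_eq) code_simp

lemma progression_entries_residues:
  "set (map (\<lambda>(x, L, (r1, r2, r3), \<epsilon>). (L, (r2 - r1) mod 3, \<epsilon>)) progression_entries) =
    set [(L, p, \<epsilon>). L \<leftarrow> lines, p \<leftarrow> [0..2], \<epsilon> \<leftarrow> [- 1, 1]]"
  by (rule set_eq_if_merge_sort_eq) code_simp

lemma generic_entry: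
  assumes "L \<in> set lines" "p \<in> {0..2}" "q \<in> {0..2}" "q \<noteq> 2 * p mod 3"
  shows "\<exists>x r1 r2 r3 \<epsilon>. (x, L, (r1, r2, r3), \<epsilon>) \<in> set generic_entries \<and>
    (r2 - r1) mod 3 = p \<and> (r3 - r1) mod 3 = q"
proof -
  have "(L, p, q) \<in> set [(L, p, q). L \<leftarrow> lines, p \<leftarrow> [0..2], q \<leftarrow> [0..2], q \<noteq> 2 * p mod 3]"
    using assms by auto
  then show ?thesis unfolding generic_entries_residues[symmetric] by force
qed

lemma progression_entry:
  assumes "L \<in> set lines" "p \<in> {0..2}" "\<epsilon> \<in> {- 1, 1}"
  shows "\<exists>x r1 r2 r3. (x, L, (r1, r2, r3), \<epsilon>) \<in> set progression_entries \<and> (r2 - r1) mod 3 = p"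
proof -
  have "(L, p, \<epsilon>) \<in> set [(L, p, \<epsilon>). L \<leftarrow> lines, p \<leftarrow> [0..2], \<epsilon> \<leftarrow> [- 1, 1]]"
    using assms by auto
  then show ?thesis unfolding progression_entries_residues[symmetric] by force
qed

lemma entry_line:
  assumes "(x, L, r, \<epsilon>) \<in> set (entries i)"
  shows "L \<in> set lines"
proof -
  obtain r1 r2 r3 where r: "r = (r1, r2, r3)" by (cases r)
  show ?thesis
  proof (cases i)
    case True
    have "(L, (r2 - r1) mod 3, \<epsilon>) \<in> set [(L, p, \<epsilon>). L \<leftarrow> lines, p \<leftarrow> [0..2], \<epsilon> \<leftarrow> [- 1, 1]]"
      unfolding progression_entries_residues[symmetric]
      using assms True unfolding entries_def r by force
    then show ?thesis by auto
  next
    case False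
    have "(L, (r2 - r1) mod 3, (r3 - r1) mod 3) \<in>
        set [(L, p, q). L \<leftarrow> lines, p \<leftarrow> [0..2], q \<leftarrow> [0..2], q \<noteq> 2 * p mod 3]"
      unfolding generic_entries_residues[symmetric]
      using assms False unfolding entries_def r by force
    then show ?thesis by auto
  qed
qed

lemma entry_progression:
  assumes "(x, L, (r1, r2, r3), \<epsilon>) \<in> set (entries i)" "i"
  shows "(r3 - r1) mod 3 = 2 * (r2 - r1) mod 3"
proof -
  have "\<forall>(x, L, (r1, r2, r3), \<epsilon>)\<in>set progression_entries. (r3 - r1) mod 3 = 2 * (r2 - r1) mod 3"
    by code_simp
  then show ?thesis using assms unfolding entries_def by auto
qed

definition label_pairs :: "entry \<Rightarrow> ((int \<times> int) \<times> (int \<times> int)) list" where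
  "label_pairs = (\<lambda>(x, (a, b, c), (r1, r2, r3), \<epsilon>).
    [((a, r1), (b, r2)), ((a, r1), (c, r3)), ((b, r2), (c, r3))])"

lemma label_pairs_distinct:
  "distinct (concat (map (\<lambda>en. map (Pair (fst en)) (label_pairs en)) (entries i)) @
     concat (map (\<lambda>en. map (Pair ((fst en - 3) mod 9)) (label_pairs en)) (entries i)))"
proof (cases i)
  case True
  show ?thesis unfolding entries_def if_P[OF True] by (rule distinct_if_increasing_merge_sort) code_simp
next
  case False
  show ?thesis unfolding entries_def if_not_P[OF False] by (rule distinct_if_increasing_merge_sort) code_simp
qed

lemma labels_column:
  assumes "en \<in> set (entries i)" "p \<in> labels en" "q \<in> labels en" "fst p = fst q"
  shows "p = q"
proof -
  obtain x a b c r1 r2 r3 \<epsilon> where en: "en = (x, (a, b, c), (r1, r2, r3), \<epsilon>)" by (metis prod.exhaust)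
  have "(a, b, c) \<in> ordered_blocks" using entry_line lines_ordered assms(1) unfolding en by blast
  then show ?thesis using assms(2-4) unfolding en labels_def ordered_blocks_def by auto
qed

lemma label_pairs_if_labels:
  assumes "en \<in> set (entries i)" "p \<in> labels en" "q \<in> labels en" "fst p < fst q"
  shows "(p, q) \<in> set (label_pairs en)"
proof -
  obtain x a b c r1 r2 r3 \<epsilon> where en: "en = (x, (a, b, c), (r1, r2, r3), \<epsilon>)" by (metis prod.exhaust)
  have "(a, b, c) \<in> ordered_blocks" using entry_line lines_ordered assms(1) unfolding en by blast
  then show ?thesis using assms(2-4) unfolding en labels_def label_pairs_def ordered_blocks_def by auto
qed

lemma meet_once_labels:
  assumes "en \<in> set (entries i)" "en' \<in> set (entries i)" "fst en' = (fst en + 3) mod 9"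
    and "p \<in> labels en" "p \<in> labels en'" "q \<in> labels en" "q \<in> labels en'"
  shows "p = q"
proof -
  have no_pair: False if "(p, q) \<in> set (label_pairs en)" "(p, q) \<in> set (label_pairs en')" for p q
  proof -
    obtain y r where "(y, r) \<in> labels en" using assms(4) by (metis surj_pair)
    then have "fst en \<in> {0..8}" using entry_labels(1) assms(1) by blast
    then have "(fst en' - 3) mod 9 = fst en" unfolding assms(3) by (simp add: mod_simps)
    then have "(fst en, p, q) \<in> set (concat (map (\<lambda>en. map (Pair ((fst en - 3) mod 9)) (label_pairs en)) (entries i)))"
      using assms(2) that(2) by force
    moreover have "(fst en, p, q) \<in> set (concat (map (\<lambda>en. map (Pair (fst en)) (label_pairs en)) (entries i)))"
      using assms(1) that(1) by force
    ultimately show False using label_pairs_distinct[of i] unfolding distinct_append by blast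
  qed
  show ?thesis
    using no_pair label_pairs_if_labels assms(1,2,4-7) labels_column by (metis less_linear)
qed

lemma length_row:
  assumes "x \<in> {0..8}"
  shows "length (filter (\<lambda>en. fst en = x) (entries i)) = 8"
proof -
  have "\<forall>x\<in>{0..8}. length (filter (\<lambda>en. fst en = x) (entries i)) = 8"
  proof (cases i)
    case True
    show ?thesis unfolding entries_def if_P[OF True] by code_simp
  next
    case False
    show ?thesis unfolding entries_def if_not_P[OF False] by code_simp
  qed
  then show ?thesis using assms by blast
qed

subsection \<open>Points and blocks\<close>

definition half :: "int \<Rightarrow> int set" where
  "half w = {1..(w - 1) div 2}"

lemma half_difference:
  assumes "odd w" "i \<in> {0..<w}" "s \<in> {0..<w}" "i \<noteq> s"
  shows "\<exists>d\<in>half w. i = (s + d) mod w \<or> i = (s - d) mod w"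
proof -
  define e where "e = (i - s) mod w"
  have e: "(s + e) mod w = i" unfolding e_def using assms by (simp add: mod_simps)
  moreover have "(s - (w - e)) mod w = (s + e - w) mod w" by (simp add: algebra_simps)
  ultimately have e': "(s - (w - e)) mod w = i" by simp
  have "0 \<le> e" "e < w" unfolding e_def using assms by auto
  moreover have "e \<noteq> 0" using e assms by auto
  ultimately have "e \<in> half w \<or> w - e \<in> half w"
    unfolding half_def using assms(1) by (auto elim!: oddE)
  then show ?thesis by (metis e e')
qed

lemma midpoint:
  assumes w: "odd w" and p: "p \<in> {0..<w}" and q: "q \<in> {0..<w}" and "p \<noteq> q"
  shows "\<exists>s\<in>{0..<w}. \<exists>d\<in>half w. {p, q} = {(s + d) mod w, (s - d) mod w}"
proof -
  define s where "s = (p + q) * ((w + 1) div 2) mod w"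
  have "2 * s mod w = (p + q) * (2 * ((w + 1) div 2)) mod w"
    unfolding s_def by (simp add: mod_simps algebra_simps)
  also have "2 * ((w + 1) div 2) = w + 1" by (rule dvd_mult_div_cancel) (use w in simp)
  also have "(p + q) * (w + 1) mod w = (p + q) mod w" by (simp add: distrib_left)
  finally have double: "2 * s mod w = (p + q) mod w" .
  have reflect: "q = (2 * s - p) mod w"
  proof -
    have "(2 * s - p) mod w = (p + q - p) mod w" using double by (rule mod_diff_cong) simp
    then show ?thesis using q by simp
  qed
  have s: "s \<in> {0..<w}" unfolding s_def using p by auto
  have "p \<noteq> s" using reflect assms(4) p by auto
  then obtain d where d: "d \<in> half w" "p = (s + d) mod w \<or> p = (s - d) mod w"
    using half_difference[OF w p s] by blast
  have "(2 * s - (s + d)) mod w = (s - d) mod w" "(2 * s - (s - d)) mod w = (s + d) mod w"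
    by (simp_all add: algebra_simps)
  then have "p = (s + d) mod w \<and> q = (s - d) mod w \<or> p = (s - d) mod w \<and> q = (s + d) mod w"
    using d(2) reflect by (metis mod_diff_right_eq)
  then show ?thesis using s d(1) by blast
qed

locale nine_fold =
  fixes w :: int
  assumes odd_w: "odd w" and w_ge: "7 \<le> w"
begin

text \<open>Nine columns of \<open>w\<close> points, and the point \<open>\<infinity> = (9, 0)\<close>.\<close>

definition nine_points :: "(int \<times> int) set" where
  "nine_points = {0..8} \<times> {0..<w} \<union> {(9, 0)}"

definition star :: "int \<Rightarrow> int \<Rightarrow> int \<Rightarrow> int \<Rightarrow> int \<Rightarrow> (int \<times> int) set" where
  "star c y s u d = {(c, (s + d) mod w), (c, (s - d) mod w), (y, (u + d) mod w)}"

definition transversal :: "block \<Rightarrow> int \<Rightarrow> int \<Rightarrow> int \<Rightarrow> (int \<times> int) set" where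
  "transversal = (\<lambda>(a, b, c) s t i. {(a, i), (b, (i + s) mod w), (c, (i + t) mod w)})"

lemma finite_nine_points: "finite nine_points"
  unfolding nine_points_def by simp

lemma card_nine_points: "card nine_points = 9 * nat w + 1"
proof -
  have "card nine_points = card ({0..8::int} \<times> {0..<w}) + card {(9::int, 0::int)}"
    unfolding nine_points_def by (rule card_Un_disjoint) auto
  then show ?thesis by (simp add: card_cartesian_product)
qed

lemma parallel_class_nine_points:
  assumes "finite P" "card P \<le> 3 * nat w" "\<And>B. B \<in> P \<Longrightarrow> B \<subseteq> nine_points \<and> card B \<le> 3"
    and "nine_points - {p} \<subseteq> \<Union>P"
  shows "parallel_class nine_points P"
proof (rule parallel_class_coverI[where Y = "{p}"])
  have "(9 * n + 1) div 3 = 3 * n" "(9 * n + 1) mod 3 = 1" for n :: nat by presburger+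
  then have "card nine_points div 3 = 3 * nat w" "card nine_points mod 3 = 1"
    unfolding card_nine_points by blast+
  then show "card P \<le> card nine_points div 3" "card {p} \<le> card nine_points mod 3"
    using assms(2) by simp_all
qed (use assms finite_nine_points in auto)

lemma mod_range: "z mod w \<in> {0..<w}"
  using w_ge by simp

lemma dvd_if_mod_eq: "x mod w = y mod w \<Longrightarrow> w dvd x - y"
  by (simp add: mod_eq_dvd_iff)

lemma not_dvd_small: "0 < \<bar>c\<bar> \<Longrightarrow> \<bar>c\<bar> < 7 \<Longrightarrow> \<not> w dvd c"
  using w_ge zdvd_not_zless[of "\<bar>c\<bar>" w] by auto

lemma dvd_double_iff: "w dvd 2 * z \<longleftrightarrow> w dvd z"
  using odd_w by (simp add: coprime_dvd_mult_right_iff)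

lemma card_triple_le: "card {p, q, r} \<le> 3"
  by (simp add: card_insert_if)

lemma star_block:
  "c \<in> {0..8} \<Longrightarrow> y \<in> {0..8} \<Longrightarrow> star c y s u d \<subseteq> nine_points \<and> card (star c y s u d) \<le> 3"
  using mod_range card_triple_le unfolding star_def nine_points_def by auto

lemma transversal_block:
  "block_set L \<subseteq> {0..8} \<Longrightarrow> i \<in> {0..<w} \<Longrightarrow>
    transversal L s t i \<subseteq> nine_points \<and> card (transversal L s t i) \<le> 3"
  using mod_range card_triple_le unfolding transversal_def nine_points_def block_set_def
  by (cases L) auto

lemma transversal_cover:
  assumes "y \<in> block_set L" "i \<in> {0..<w}"
  shows "\<exists>j\<in>{0..<w}. (y, i) \<in> transversal L s t j"
proof -
  obtain a b c where L: "L = (a, b, c)" by (cases L)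
  have shift: "((i - z) mod w + z) mod w = i" for z using assms(2) by (simp add: mod_simps)
  consider (first) "y = a" | (second) "y = b" | (third) "y = c" using assms(1) unfolding L block_set_def by auto
  then show ?thesis
  proof cases
    case first
    then show ?thesis using assms(2) unfolding L transversal_def by (intro bexI[of _ i]) auto
  next
    case second
    then show ?thesis using mod_range shift unfolding L transversal_def
      by (intro bexI[of _ "(i - s) mod w"]) auto
  next
    case third
    then show ?thesis using mod_range shift unfolding L transversal_def
      by (intro bexI[of _ "(i - t) mod w"]) auto
  qed
qed

lemma transversal_cong:
  assumes "s mod w = s' mod w" "t mod w = t' mod w"
  shows "transversal L s t = transversal L s' t'"
proof -
  have "(i + s) mod w = (i + s') mod w" "(i + t) mod w = (i + t') mod w" for i
    by (intro mod_add_cong refl assms)+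
  then show ?thesis unfolding transversal_def by (cases L) auto
qed

subsection \<open>Blocks meeting at most once\<close>

lemma star_centre_common:
  assumes "c \<noteq> y" and s: "w dvd s' - s - 2"
    and P: "(c, P) \<in> star c y s u i" "(c, P) \<in> star c y s' u' j"
  shows "w dvd i - j - 2 \<or> w dvd i - - j - 2 \<or> w dvd - i - j - 2 \<or> w dvd - i - - j - 2"
proof -
  have diff: "w dvd d - e - 2" if "P = (s + d) mod w" "P = (s' + e) mod w" for d e
  proof -
    have "w dvd (s + d) - (s' + e)" using that by (intro dvd_if_mod_eq) simp
    then have "w dvd (s + d) - (s' + e) + (s' - s - 2)" using s by (rule dvd_add)
    then show ?thesis by (simp add: algebra_simps)
  qed
  have "P = (s + i) mod w \<or> P = (s + - i) mod w" "P = (s' + j) mod w \<or> P = (s' + - j) mod w"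
    using P assms(1) unfolding star_def by auto
  then show ?thesis using diff by metis
qed

lemma star_tip_common:
  assumes "c \<noteq> y" and u: "w dvd u' - u - 4"
    and P: "(y, P) \<in> star c y s u i" "(y, P) \<in> star c y s' u' j"
  shows "w dvd i - j - 4"
proof -
  have "P = (u + i) mod w" "P = (u' + j) mod w"
    using P assms(1) unfolding star_def by auto
  then have "w dvd (u + i) - (u' + j)" by (intro dvd_if_mod_eq) simp
  then have "w dvd (u + i) - (u' + j) + (u' - u - 4)" using u by (rule dvd_add)
  then show ?thesis by (simp add: algebra_simps)
qed

lemma star_centre_tip_common:
  assumes tip: "w dvd i - j - 4"
    and centre: "w dvd i - j - 2 \<or> w dvd i - - j - 2 \<or> w dvd - i - j - 2 \<or> w dvd - i - - j - 2"
  shows "w dvd i - 3 \<and> w dvd j + 1 \<or> w dvd i - 1 \<and> w dvd j + 3"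
  using centre
proof (elim disjE)
  assume "w dvd i - j - 2"
  from dvd_diff[OF this tip] show ?thesis using not_dvd_small[of 2] by simp
next
  assume "w dvd - i - - j - 2"
  from dvd_add[OF this tip] show ?thesis using not_dvd_small[of "- 6"] by simp
next
  assume sum: "w dvd i - - j - 2"
  have "w dvd 2 * (i - 3)" using dvd_add[OF sum tip] by (simp add: algebra_simps)
  moreover have "w dvd 2 * (j + 1)" using dvd_diff[OF sum tip] by (simp add: algebra_simps)
  ultimately show ?thesis unfolding dvd_double_iff by blast
next
  assume sum: "w dvd - i - j - 2"
  have "w dvd 2 * (i - 1)" using dvd_diff[OF tip sum] by (simp add: algebra_simps)
  moreover have "2 * (j + 3) = - ((- i - j - 2) + (i - j - 4))" by simp
  then have "w dvd 2 * (j + 3)" using dvd_add[OF sum tip] by (simp only: dvd_minus_iff)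
  ultimately show ?thesis unfolding dvd_double_iff by blast
qed

text \<open>Two points of a star in its central column sum to \<open>2 s\<close>.\<close>

lemma star_centres_common:
  assumes "c \<noteq> y" and s: "w dvd s' - s - 2"
    and P: "(c, P) \<in> star c y s u i" "(c, P) \<in> star c y s' u' j"
    and Q: "(c, Q) \<in> star c y s u i" "(c, Q) \<in> star c y s' u' j"
  shows "P = Q"
proof (rule ccontr)
  assume "P \<noteq> Q"
  have "(P + Q) mod w = ((s + i) + (s - i)) mod w"
    using P(1) Q(1) \<open>P \<noteq> Q\<close> assms(1) unfolding star_def by (auto simp: mod_add_eq add.commute)
  moreover have "(P + Q) mod w = ((s' + j) + (s' - j)) mod w"
    using P(2) Q(2) \<open>P \<noteq> Q\<close> assms(1) unfolding star_def by (auto simp: mod_add_eq add.commute)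
  ultimately have "w dvd 2 * s - 2 * s'" by (intro dvd_if_mod_eq) simp
  then have "w dvd 2 * s - 2 * s' + 2 * (s' - s - 2)" using s by (intro dvd_add dvd_mult)
  then show False using not_dvd_small[of "- 4"] by (simp add: algebra_simps)
qed

lemma meet_once_star:
  assumes cy: "c \<noteq> y" and s: "w dvd s' - s - 2" and u: "w dvd u' - u - 4"
    and D: "\<And>i j. i \<in> D \<Longrightarrow> j \<in> D \<Longrightarrow>
      \<not> (w dvd i - 3 \<and> w dvd j + 1) \<and> \<not> (w dvd i - 1 \<and> w dvd j + 3)"
  shows "meet_once (star c y s u ` D) (star c y s' u' ` D)"
proof (rule meet_onceI)
  fix B C p q assume "B \<in> star c y s u ` D" "C \<in> star c y s' u' ` D"
    and pq: "p \<in> B" "p \<in> C" "q \<in> B" "q \<in> C"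
  then obtain i j where ij: "i \<in> D" "j \<in> D" and B: "B = star c y s u i" and C: "C = star c y s' u' j"
    by blast
  have mixed: False if "(c, P) \<in> B" "(c, P) \<in> C" "(y, Q) \<in> B" "(y, Q) \<in> C" for P Q
    using star_centre_tip_common star_centre_common[OF cy s] star_tip_common[OF cy u] D[OF ij] that
    unfolding B C by blast
  have centres: "P = Q" if "(c, P) \<in> B" "(c, P) \<in> C" "(c, Q) \<in> B" "(c, Q) \<in> C" for P Q
    using star_centres_common[OF cy s] that unfolding B C by blast
  obtain z P z' Q where e: "p = (z, P)" "q = (z', Q)" by (cases p, cases q)
  then have "z = c \<or> z = y" "z' = c \<or> z' = y" using pq unfolding B star_def by auto
  moreover have "P = Q" if "z = y" "z' = y" using pq(1,3) that cy unfolding e B star_def by auto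
  ultimately show "p = q" using pq mixed centres unfolding e by auto
qed

lemma meet_once_transversal:
  assumes L: "a \<noteq> b" "a \<noteq> c" "b \<noteq> c"
    and shifts: "\<not> w dvd s - s'" "\<not> w dvd t - t'" "\<not> w dvd (t - s) - (t' - s')"
  shows "meet_once (transversal (a, b, c) s t ` {0..<w}) (transversal (a, b, c) s' t' ` {0..<w})"
proof (rule meet_onceI, rule ccontr)
  fix B C p q
  assume "B \<in> transversal (a, b, c) s t ` {0..<w}" "C \<in> transversal (a, b, c) s' t' ` {0..<w}"
    and pq: "p \<in> B" "p \<in> C" "q \<in> B" "q \<in> C" "p \<noteq> q"
  then obtain i j where B: "B = transversal (a, b, c) s t i" and C: "C = transversal (a, b, c) s' t' j"
    and ij: "i \<in> {0..<w}" "j \<in> {0..<w}"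
    by blast
  define f f' where "f z = (if z = a then 0 else if z = b then s else t)"
    and "f' z = (if z = a then 0 else if z = b then s' else t')" for z
  obtain z P z' Q where e: "p = (z, P)" "q = (z', Q)" by (cases p, cases q)
  have cols: "z \<in> {a, b, c}" "z' \<in> {a, b, c}" "z \<noteq> z'"
    using pq L unfolding e B transversal_def by auto
  have common: "w dvd (i + f z) - (j + f' z)" if "(z, P) \<in> B" "(z, P) \<in> C" for z P
    using that L ij unfolding B C transversal_def f_def f'_def by (intro dvd_if_mod_eq) auto
  have "w dvd (i + f z) - (j + f' z) - ((i + f z') - (j + f' z'))"
    using pq(1-4) unfolding e by (intro dvd_diff common[of z P] common[of z' Q])
  then have "w dvd (f z - f z') - (f' z - f' z')" by (simp add: algebra_simps)
  then show False
    using cols L shifts dvd_diff_commute[of w s s'] dvd_diff_commute[of w t t']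
      dvd_diff_commute[of w "t - s" "t' - s'"]
    unfolding f_def f'_def by (auto simp: algebra_simps)
qed

subsection \<open>Developed near parallel classes\<close>

definition near_class :: "near_base \<Rightarrow> int \<Rightarrow> int \<Rightarrow> (int \<times> int) set set" where
  "near_class = (\<lambda>(x, a, b, U, V) s t.
    {{(9, 0), (a, s), (b, t)}} \<union> star a x s (s + t) ` half w \<union>
    star b x t (s + t) ` uminus ` half w \<union> transversal U s (- t) ` {0..<w} \<union>
    transversal V s (- t) ` {0..<w})"

lemma card_near_class: "finite (near_class e s t)" "card (near_class e s t) \<le> 3 * nat w"
proof -
  obtain x a b U V where e: "e = (x, a, b, U, V)" by (metis prod.exhaust)
  show "finite (near_class e s t)" unfolding e near_class_def prod.case half_def by simp
  have half: "card (f ` half w) \<le> nat ((w - 1) div 2)" for f :: "int \<Rightarrow> (int \<times> int) set"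
    using card_image_le[of "half w" f] unfolding half_def by simp
  have full: "card (f ` {0..<w}) \<le> nat w" for f :: "int \<Rightarrow> (int \<times> int) set"
    using card_image_le[of "{0..<w}" f] by simp
  have "card (near_class e s t) \<le> 1 + nat ((w - 1) div 2) + nat ((w - 1) div 2) + nat w + nat w"
    unfolding e near_class_def prod.case image_image
    by (intro order_trans[OF card_Un_le] add_mono half full) simp
  also have "\<dots> = 3 * nat w" using odd_w w_ge by (auto elim!: oddE)
  finally show "card (near_class e s t) \<le> 3 * nat w" .
qed

lemma star_cover:
  assumes "i \<in> {0..<w}" "s \<in> {0..<w}" "i \<noteq> s"
  shows "\<exists>d\<in>half w. (c, i) \<in> star c y s u d" "\<exists>d\<in>half w. (c, i) \<in> star c y s u (- d)"
  using half_difference[OF odd_w assms] unfolding star_def by auto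

lemma near_class_columns:
  assumes "(x, a, b, U, V) \<in> set near_classes"
  shows "{x, a, b} \<union> block_set U \<union> block_set V = {0..8}"
    and "distinct [x, a, b]" "{x, a, b} \<inter> block_set U = {}" "{x, a, b} \<inter> block_set V = {}"
    and "block_set U \<inter> block_set V = {}"
proof -
  obtain u1 u2 u3 v1 v2 v3 where UV: "U = (u1, u2, u3)" "V = (v1, v2, v3)" by (cases U, cases V)
  note near_classes_points[OF assms[unfolded UV]]
  then show "{x, a, b} \<union> block_set U \<union> block_set V = {0..8}"
    and "distinct [x, a, b]" "{x, a, b} \<inter> block_set U = {}" "{x, a, b} \<inter> block_set V = {}"
    and "block_set U \<inter> block_set V = {}"
    unfolding UV block_set_def by (simp_all add: insert_commute)
qed

lemma near_class_mem:
  "{(9, 0), (a, s), (b, t)} \<in> near_class (x, a, b, U, V) s t"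
  "d \<in> half w \<Longrightarrow> star a x s (s + t) d \<in> near_class (x, a, b, U, V) s t"
  "d \<in> half w \<Longrightarrow> star b x t (s + t) (- d) \<in> near_class (x, a, b, U, V) s t"
  "i \<in> {0..<w} \<Longrightarrow> transversal U s (- t) i \<in> near_class (x, a, b, U, V) s t"
  "i \<in> {0..<w} \<Longrightarrow> transversal V s (- t) i \<in> near_class (x, a, b, U, V) s t"
  unfolding near_class_def prod.case by blast+

lemma near_class_cover:
  assumes e: "(x, a, b, U, V) \<in> set near_classes" and st: "s \<in> {0..<w}" "t \<in> {0..<w}"
  shows "nine_points - {(x, (s + t) mod w)} \<subseteq> \<Union>(near_class (x, a, b, U, V) s t)"
proof
  fix p assume p: "p \<in> nine_points - {(x, (s + t) mod w)}"
  note near_class_mem [where x = x and a = a and b = b and s = s and t = t and U = U and V = V, intro]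
  show "p \<in> \<Union>(near_class (x, a, b, U, V) s t)"
  proof (cases "p = (9, 0)")
    case False
    then obtain c i where ci: "p = (c, i)" "c \<in> {0..8}" "i \<in> {0..<w}"
      using p unfolding nine_points_def by blast
    consider (missing) "c = x" | (first) "c = a" | (second) "c = b"
      | (block) "c \<in> block_set U" | (other_block) "c \<in> block_set V"
      using near_class_columns(1)[OF e] ci(2) by blast
    then show ?thesis
    proof cases
      case missing
      then have "i \<noteq> (s + t) mod w" using p ci by auto
      then obtain d where d: "d \<in> half w" "i = ((s + t) mod w + d) mod w \<or> i = ((s + t) mod w - d) mod w"
        using half_difference[OF odd_w ci(3) mod_range] by blast
      then have "p \<in> star a x s (s + t) d \<or> p \<in> star b x t (s + t) (- d)"
        unfolding ci missing star_def mod_add_left_eq mod_diff_left_eq by auto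
      then show ?thesis using d(1) by blast
    next
      case first
      have "\<exists>d\<in>half w. p \<in> star a x s (s + t) d" if "i \<noteq> s"
        using star_cover(1)[OF ci(3) st(1) that] unfolding ci first .
      moreover have "p \<in> {(9, 0), (a, s), (b, t)}" if "i = s" using that unfolding ci first by simp
      ultimately show ?thesis by blast
    next
      case second
      have "\<exists>d\<in>half w. p \<in> star b x t (s + t) (- d)" if "i \<noteq> t"
        using star_cover(2)[OF ci(3) st(2) that] unfolding ci second .
      moreover have "p \<in> {(9, 0), (a, s), (b, t)}" if "i = t" using that unfolding ci second by simp
      ultimately show ?thesis by blast
    next
      case block
      then show ?thesis using transversal_cover[OF block ci(3)] unfolding ci by blast
    next
      case other_block
      then show ?thesis using transversal_cover[OF other_block ci(3)] unfolding ci by blast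
    qed
  qed blast
qed

lemma parallel_class_near:
  assumes e: "e \<in> set near_classes" and st: "s \<in> {0..<w}" "t \<in> {0..<w}"
  shows "parallel_class nine_points (near_class e s t)"
proof -
  obtain x a b U V where ee: "e = (x, a, b, U, V)" by (metis prod.exhaust)
  have cols: "{x, a, b} \<union> block_set U \<union> block_set V = {0..8}"
    using near_class_columns(1) e unfolding ee .
  show ?thesis
  proof (rule parallel_class_nine_points[where p = "(x, (s + t) mod w)"])
    fix B assume "B \<in> near_class e s t"
    then consider (apex) "B = {(9, 0), (a, s), (b, t)}"
      | (star) c z d where "B = star c x z (s + t) d" "c \<in> {a, b}"
      | (transversal) L i where "B = transversal L s (- t) i" "i \<in> {0..<w}" "L \<in> {U, V}"
      unfolding ee near_class_def prod.case by blast
    then show "B \<subseteq> nine_points \<and> card B \<le> 3"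
    proof cases
      case apex
      then show ?thesis using cols st card_triple_le by (auto simp: nine_points_def)
    next
      case star
      moreover have "c \<in> {0..8}" "x \<in> {0..8}" using star(2) cols by blast+
      ultimately show ?thesis using star_block by blast
    next
      case transversal
      moreover have "block_set L \<subseteq> {0..8}" using transversal(3) cols by blast
      ultimately show ?thesis using transversal_block by blast
    qed
  qed (use near_class_cover[OF e[unfolded ee] st] ee card_near_class in simp_all)
qed

lemma star_columns: "B \<in> star c y s u ` D \<Longrightarrow> fst ` B \<subseteq> {c, y}"
  unfolding star_def by auto

lemma transversal_columns: "B \<in> transversal L s t ` I \<Longrightarrow> fst ` B \<subseteq> block_set L"
  unfolding transversal_def block_set_def by (cases L) auto

lemma star_tip_unique:
  "c \<noteq> y \<Longrightarrow> p \<in> star c y s u d \<Longrightarrow> q \<in> star c y s u d \<Longrightarrow> fst p = y \<Longrightarrow> fst q = y \<Longrightarrow> p = q"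
  unfolding star_def by auto

lemma meet_once_if_columns:
  assumes "\<And>B. B \<in> P \<Longrightarrow> fst ` B \<subseteq> L" "\<And>C. C \<in> Q \<Longrightarrow> fst ` C \<subseteq> M" "L \<inter> M \<subseteq> {z}"
    and "\<And>B p q. z \<in> L \<inter> M \<Longrightarrow> B \<in> P \<Longrightarrow> p \<in> B \<Longrightarrow> q \<in> B \<Longrightarrow> fst p = z \<Longrightarrow> fst q = z \<Longrightarrow> p = q"
  shows "meet_once P Q"
proof (rule meet_onceI)
  fix B C p q assume BC: "B \<in> P" "C \<in> Q" and pq: "p \<in> B" "p \<in> C" "q \<in> B" "q \<in> C"
  have "fst p \<in> L \<inter> M" "fst q \<in> L \<inter> M" using assms(1)[OF BC(1)] assms(2)[OF BC(2)] pq by blast+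
  moreover from this have "fst p = z" "fst q = z" using assms(3) by blast+
  ultimately show "p = q" using assms(4) BC(1) pq by metis
qed

lemma meet_once_apex_star:
  assumes "a \<noteq> b" "9 \<notin> {a, b}" "c \<in> {a, b}" "y \<notin> {9, a, b}"
  shows "meet_once {{(9, 0), (a, s), (b, t)}} (star c y s' u ` D)"
  by (rule meet_once_if_columns[OF _ star_columns, where L = "{9, a, b}" and z = c]) (use assms in auto)

lemma meet_once_apex_transversal:
  assumes "9 \<notin> block_set L" "a \<notin> block_set L" "b \<notin> block_set L"
  shows "meet_once {{(9, 0), (a, s), (b, t)}} (transversal L s' t' ` I)"
  by (rule meet_once_if_columns[OF _ transversal_columns, where L = "{9, a, b}"]) (use assms in auto)

lemma meet_once_star_star:
  assumes "c \<noteq> y" "c' \<notin> {c, y}"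
  shows "meet_once (star c y s u ` D) (star c' y s' u' ` D')"
proof (rule meet_once_if_columns[OF star_columns star_columns])
  show "{c, y} \<inter> {c', y} \<subseteq> {y}" using assms by blast
  fix B p q assume "B \<in> star c y s u ` D" "p \<in> B" "q \<in> B" "fst p = y" "fst q = y"
  then show "p = q" using star_tip_unique[OF assms(1)] by blast
qed

lemma meet_once_star_transversal:
  assumes "c \<notin> block_set L" "y \<notin> block_set L"
  shows "meet_once (star c y s u ` D) (transversal L s' t' ` I)"
  by (rule meet_once_if_columns[OF star_columns transversal_columns]) (use assms in auto)

lemma meet_once_transversals:
  assumes "block_set L \<inter> block_set L' = {}"
  shows "meet_once (transversal L s t ` I) (transversal L' s' t' ` I')"
  by (rule meet_once_if_columns[OF transversal_columns transversal_columns]) (use assms in auto)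

lemma half_not_dvd:
  assumes "i \<in> half w"
  shows "\<not> w dvd i + 1" "\<not> w dvd i + 3" "\<not> w dvd - i - 1" "\<not> w dvd - i - 3"
proof -
  have "0 < i" "i + 3 < w" using assms w_ge unfolding half_def by auto
  then show "\<not> w dvd i + 1" "\<not> w dvd i + 3"
    using zdvd_not_zless[of "i + 1" w] zdvd_not_zless[of "i + 3" w] by linarith+
  then have "\<not> w dvd - (i + 1)" "\<not> w dvd - (i + 3)" unfolding dvd_minus_iff by blast+
  then show "\<not> w dvd - i - 1" "\<not> w dvd - i - 3" by (simp_all only: minus_add_distrib diff_conv_add_uminus not_False_eq_True)
qed

lemma meet_once_apex:
  assumes "a \<noteq> b" "9 \<notin> {a, b}" "w dvd s' - s - 2" "w dvd t' - t - 2"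
  shows "meet_once {{(9, 0), (a, s), (b, t)}} {{(9, 0), (a, s'), (b, t')}}"
proof -
  have "s \<noteq> s'" "t \<noteq> t'" using assms(3,4) not_dvd_small[of "- 2"] by auto
  then show ?thesis using assms(1,2) by (intro meet_onceI) auto
qed

lemma meet_once_near_transversal:
  assumes "U \<in> ordered_blocks" and s: "w dvd s' - s - 2" and t: "w dvd t' - t - 2"
  shows "meet_once (transversal U s (- t) ` {0..<w}) (transversal U s' (- t') ` {0..<w})"
proof -
  obtain a b c where U: "U = (a, b, c)" "a < b" "b < c" using assms(1) unfolding ordered_blocks_def by auto
  have shift: "\<not> w dvd z" if "w dvd z - m" "0 < \<bar>m\<bar>" "\<bar>m\<bar> < 7" for z m
    using that not_dvd_small dvd_diff[OF _ that(1), of z] by auto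
  show ?thesis
    unfolding U(1)
  proof (rule meet_once_transversal)
    show "\<not> w dvd s - s'"
      using shift[OF s] by (simp add: dvd_diff_commute)
    show "\<not> w dvd - t - - t'"
      using shift[OF t] by (simp add: algebra_simps)
    have "w dvd (s' - s) + (t' - t) - 4" using dvd_add[OF s t] by (simp add: algebra_simps)
    from shift[OF this] have "\<not> w dvd (s' - s) + (t' - t)" by simp
    moreover have "(- t - s) - (- t' - s') = (s' - s) + (t' - t)" by simp
    ultimately show "\<not> w dvd (- t - s) - (- t' - s')" by (simp only: not_False_eq_True)
  qed (use U in auto)
qed

lemma meet_once_near:
  assumes e: "e \<in> set near_classes" and s: "w dvd s' - s - 2" and t: "w dvd t' - t - 2"
  shows "meet_once (near_class e s t) (near_class e s' t')"
proof -
  obtain x a b U V where ee: "e = (x, a, b, U, V)" by (metis prod.exhaust)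
  note e = e[unfolded ee]
  note cols = near_class_columns[OF e]
  have nine: "9 \<notin> {x, a, b} \<union> block_set U \<union> block_set V" unfolding cols(1) by simp
  then have distinct: "9 \<notin> {a, b}" "x \<notin> {9, a, b}" "b \<notin> {a, x}" "a \<notin> {b, x}" "a \<noteq> b" "a \<noteq> x" "b \<noteq> x"
    using cols(2) by auto
  have off_blocks: "9 \<notin> block_set L" "x \<notin> block_set L" "a \<notin> block_set L" "b \<notin> block_set L"
    if "L \<in> {U, V}" for L
    using nine cols(3,4) that by auto
  note cross = meet_once_apex_star meet_once_apex_transversal meet_once_star_star
    meet_once_star_transversal meet_once_transversals
  have sum: "w dvd s' + t' - (s + t) - 4" using dvd_add[OF s t] by (simp add: algebra_simps)
  have "meet_once {{(9, 0), (a, s), (b, t)}} {{(9, 0), (a, s'), (b, t')}}"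
    by (rule meet_once_apex) (use s t distinct in auto)
  moreover have "meet_once (star a x s (s + t) ` half w) (star a x s' (s' + t') ` half w)"
    by (rule meet_once_star) (use s sum half_not_dvd \<open>a \<noteq> x\<close> in auto)
  moreover have "meet_once (star b x t (s + t) ` uminus ` half w) (star b x t' (s' + t') ` uminus ` half w)"
    by (rule meet_once_star) (use t sum half_not_dvd \<open>b \<noteq> x\<close> in auto)
  moreover have "meet_once (transversal L s (- t) ` {0..<w}) (transversal L s' (- t') ` {0..<w})"
    if "L \<in> {U, V}" for L
    using meet_once_near_transversal[OF _ s t] near_class_ordered[OF e] that by blast
  ultimately show ?thesis
    unfolding ee near_class_def prod.case meet_once_Un
    using distinct cols(5) by (simp add: off_blocks cross cross[THEN iffD1[OF meet_once_commute]] Int_commute)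
qed

definition apex_triples :: "(int \<times> int) set set" where
  "apex_triples = {T. \<exists>a\<in>{0..8}. \<exists>b\<in>{0..8}. \<exists>i\<in>{0..<w}. \<exists>j\<in>{0..<w}. a \<noteq> b \<and> T = {(9, 0), (a, i), (b, j)}}"

definition split_triples :: "(int \<times> int) set set" where
  "split_triples = {T. \<exists>a\<in>{0..8}. \<exists>x\<in>{0..8}. \<exists>p\<in>{0..<w}. \<exists>q\<in>{0..<w}. \<exists>j\<in>{0..<w}.
     a \<noteq> x \<and> p \<noteq> q \<and> T = {(a, p), (a, q), (x, j)}}"

definition transversals :: "block set \<Rightarrow> (int \<times> int) set set" where
  "transversals K = {T. \<exists>L\<in>K. \<exists>s\<in>{0..<w}. \<exists>t\<in>{0..<w}. \<exists>i\<in>{0..<w}. T = transversal L s t i}"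

lemma shift_mod_inj:
  assumes "s \<in> {0..<w}" "s' \<in> {0..<w}" "(s + k) mod w = (s' + k) mod w"
  shows "s = s'"
proof -
  have "s mod w = s' mod w" using assms(3) by (simp add: mod_eq_dvd_iff)
  then show ?thesis using assms(1,2) by simp
qed

lemma dvd_shift: "w dvd (s + k) mod w - s - k"
  using mod_eq_dvd_iff[of "(s + k) mod w" w "s + k"] by (simp add: algebra_simps)

lemma near_class_apex:
  assumes "T \<in> apex_triples"
  shows "\<exists>e\<in>set near_classes. \<exists>s\<in>{0..<w}. \<exists>t\<in>{0..<w}. T \<in> near_class e s t"
proof -
  obtain a b i j where ab: "a \<in> {0..8}" "b \<in> {0..8}" "a \<noteq> b" and ij: "i \<in> {0..<w}" "j \<in> {0..<w}"
    and T: "T = {(9, 0), (a, i), (b, j)}"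
    using assms unfolding apex_triples_def by blast
  obtain x U V where "(x, a, b, U, V) \<in> set near_classes \<or> (x, b, a, U, V) \<in> set near_classes"
    using near_class_with_pair[OF ab] by blast
  moreover have "T \<in> near_class (x, a, b, U, V) i j" unfolding T by (rule near_class_mem)
  moreover have "T = {(9, 0), (b, j), (a, i)}" unfolding T by blast
  then have "T \<in> near_class (x, b, a, U, V) j i" by (simp only: near_class_mem)
  ultimately show ?thesis using ij by blast
qed

lemma near_class_split:
  assumes "T \<in> split_triples"
  shows "\<exists>e\<in>set near_classes. \<exists>s\<in>{0..<w}. \<exists>t\<in>{0..<w}. T \<in> near_class e s t"
proof -
  obtain a x p q j where ax: "x \<in> {0..8}" "a \<in> {0..8}" "a \<noteq> x" and pq: "p \<in> {0..<w}" "q \<in> {0..<w}" "p \<noteq> q"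
    and j: "j \<in> {0..<w}" and T: "T = {(a, p), (a, q), (x, j)}"
    using assms unfolding split_triples_def by blast
  obtain s d where s: "s \<in> {0..<w}" "d \<in> half w" and "{p, q} = {(s + d) mod w, (s - d) mod w}"
    using midpoint[OF odd_w pq] by blast
  then have T: "T = {(a, (s + d) mod w), (a, (s - d) mod w), (x, j)}"
    unfolding T doubleton_eq_iff by auto
  obtain b U V where "(x, a, b, U, V) \<in> set near_classes \<or> (x, b, a, U, V) \<in> set near_classes"
    using near_class_missing[OF ax] by blast
  then show ?thesis
  proof
    assume e: "(x, a, b, U, V) \<in> set near_classes"
    have "(s + (j - s - d) mod w + d) mod w = ((j - s - d) mod w + (s + d)) mod w"
      by (simp add: algebra_simps)
    also have "\<dots> = j" using j by (simp add: mod_add_left_eq)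
    finally have "T = star a x s (s + (j - s - d) mod w) d" unfolding T star_def by simp
    then show ?thesis using near_class_mem(2)[OF s(2)] e s(1) mod_range by metis
  next
    assume e: "(x, b, a, U, V) \<in> set near_classes"
    have "((j - s + d) mod w + s + - d) mod w = ((j - s + d) mod w + (s - d)) mod w"
      by (simp add: algebra_simps)
    also have "\<dots> = j" using j by (simp add: mod_add_left_eq)
    finally have "T = star a x s ((j - s + d) mod w + s) (- d)" unfolding T star_def by auto
    then show ?thesis using near_class_mem(3)[OF s(2)] e s(1) mod_range by metis
  qed
qed

lemma near_class_transversal:
  assumes "T \<in> transversals (ordered_blocks - set lines)"
  shows "\<exists>e\<in>set near_classes. \<exists>s\<in>{0..<w}. \<exists>t\<in>{0..<w}. T \<in> near_class e s t"
proof -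
  obtain L s t i where L: "L \<in> ordered_blocks" "L \<notin> set lines" and s: "s \<in> {0..<w}"
    and i: "i \<in> {0..<w}" and "T = transversal L s t i"
    using assms unfolding transversals_def by blast
  then have T: "T = transversal L s (- ((- t) mod w)) i"
    using transversal_cong[of s s t "- ((- t) mod w)" L] by (simp add: mod_minus_eq)
  obtain x a b U where "(x, a, b, L, U) \<in> set near_classes \<or> (x, a, b, U, L) \<in> set near_classes"
    using near_class_with_block[OF L] by blast
  then show ?thesis using near_class_mem(4,5)[OF i] s mod_range unfolding T by metis
qed

lemma near_linked:
  "linked nine_points (36 * (nat w * nat w))
    (apex_triples \<union> split_triples \<union> transversals (ordered_blocks - set lines))"
proof (rule linkedI)
  let ?I = "set near_classes \<times> {0..<w} \<times> {0..<w}"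
  let ?s = "\<lambda>(e, s, t). (e, (s + 2) mod w, (t + 2) mod w)"
  show "card ?I \<le> 36 * (nat w * nat w)" by (simp add: card_cartesian_product card_near_classes)
  show "linked_family nine_points ?I (\<lambda>(e, s, t). near_class e s t) ?s
      (apex_triples \<union> split_triples \<union> transversals (ordered_blocks - set lines))"
  proof (rule linked_familyI)
    show "inj_on ?s ?I"
      by (rule inj_onI) (auto intro: shift_mod_inj)
  next
    fix u assume "u \<in> ?I"
    then obtain e s t where u: "u = (e, s, t)" "e \<in> set near_classes" "s \<in> {0..<w}" "t \<in> {0..<w}" by blast
    show "?s u \<in> ?I" unfolding u(1) using u(2) mod_range by (auto simp del: atLeastLessThan_iff)
    show "parallel_class nine_points (case u of (e, s, t) \<Rightarrow> near_class e s t)"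
      unfolding u(1) using parallel_class_near[OF u(2-4)] by simp
    show "meet_once (case u of (e, s, t) \<Rightarrow> near_class e s t) (case ?s u of (e, s, t) \<Rightarrow> near_class e s t)"
      unfolding u(1) using meet_once_near[OF u(2) dvd_shift dvd_shift] by simp
  next
    fix T assume "T \<in> apex_triples \<union> split_triples \<union> transversals (ordered_blocks - set lines)"
    then obtain e s t where "e \<in> set near_classes" "s \<in> {0..<w}" "t \<in> {0..<w}" "T \<in> near_class e s t"
      using near_class_apex near_class_split near_class_transversal by blast
    then show "\<exists>u\<in>?I. T \<in> (case u of (e, s, t) \<Rightarrow> near_class e s t)" by (intro bexI[of _ "(e, s, t)"]) auto
  qed simp
qed

subsection \<open>Classes of lines\<close>

definition line_class :: "block list \<Rightarrow> int \<Rightarrow> (int \<times> int) set set" where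
  "line_class ls s = (\<Union>L\<in>set ls. transversal L s (2 * s) ` {0..<w})"

definition line_triples :: "(int \<times> int) set set" where
  "line_triples = {T. \<exists>L\<in>set lines. \<exists>s\<in>{0..<w}. \<exists>i\<in>{0..<w}. T = transversal L s (2 * s) i}"

lemma parallel_class_line:
  assumes ls: "ls \<in> set line_classes"
  shows "parallel_class nine_points (line_class ls s)"
proof (rule parallel_class_nine_points[where p = "(9, 0)"])
  show "finite (line_class ls s)" unfolding line_class_def by simp
  have "card (line_class ls s) \<le> (\<Sum>L\<in>set ls. card (transversal L s (2 * s) ` {0..<w}))"
    unfolding line_class_def by (rule card_UN_le) simp
  also have "\<dots> \<le> (\<Sum>L\<in>set ls. nat w)"
    using card_image_le[of "{0..<w}" "transversal _ s (2 * s)"] by (intro sum_mono) simp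
  also have "\<dots> \<le> 3 * nat w" using card_length[of ls] line_class_parallel(1)[OF ls] by simp
  finally show "card (line_class ls s) \<le> 3 * nat w" .
  fix B assume "B \<in> line_class ls s"
  then obtain L i where "L \<in> set ls" "i \<in> {0..<w}" "B = transversal L s (2 * s) i"
    unfolding line_class_def by blast
  moreover from this(1) have "block_set L \<subseteq> {0..8}" using line_class_parallel(2)[OF ls] by blast
  ultimately show "B \<subseteq> nine_points \<and> card B \<le> 3" using transversal_block by blast
next
  show "nine_points - {(9, 0)} \<subseteq> \<Union>(line_class ls s)"
  proof
    fix p assume "p \<in> nine_points - {(9, 0)}"
    then obtain c i where p: "p = (c, i)" "c \<in> {0..8}" "i \<in> {0..<w}" unfolding nine_points_def by blast
    then obtain L where "L \<in> set ls" "c \<in> block_set L" using line_class_parallel(2)[OF ls] by blast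
    then show "p \<in> \<Union>(line_class ls s)"
      using transversal_cover[OF _ p(3), of c L s "2 * s"] unfolding p(1) line_class_def by blast
  qed
qed

lemma meet_once_line:
  assumes ls: "ls \<in> set line_classes"
  shows "meet_once (line_class ls s) (line_class ls ((s + 1) mod w))"
proof (rule meet_onceI)
  let ?s' = "(s + 1) mod w"
  fix B C p q assume "B \<in> line_class ls s" "C \<in> line_class ls ?s'"
    and pq: "p \<in> B" "p \<in> C" "q \<in> B" "q \<in> C"
  then obtain L L' where L: "L \<in> set ls" "L' \<in> set ls" and B: "B \<in> transversal L s (2 * s) ` {0..<w}"
    and C: "C \<in> transversal L' ?s' (2 * ?s') ` {0..<w}"
    unfolding line_class_def by blast
  have "fst p \<in> block_set L" "fst p \<in> block_set L'"
    using transversal_columns[OF B] transversal_columns[OF C] pq by blast+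
  then have "L' = L" using line_class_parallel(3)[OF ls] L by metis
  have "L \<in> ordered_blocks" using L(1) ls lines_ordered by auto
  then obtain a b c where abc: "L = (a, b, c)" "a < b" "b < c" unfolding ordered_blocks_def by auto
  have cong: "transversal L ?s' (2 * ?s') = transversal L (s + 1) (2 * (s + 1))"
    by (rule transversal_cong) (simp_all add: mod_mult_right_eq)
  have "meet_once (transversal L s (2 * s) ` {0..<w}) (transversal L (s + 1) (2 * (s + 1)) ` {0..<w})"
    unfolding abc(1) by (rule meet_once_transversal) (use abc not_dvd_small[of "- 1"] not_dvd_small[of "- 2"] in auto)
  then show "p = q" using meet_onceD B C pq unfolding \<open>L' = L\<close> cong by metis
qed

lemma line_linked_family:
  "linked_family nine_points (set line_classes \<times> {0..<w}) (\<lambda>(ls, s). line_class ls s)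
    (\<lambda>(ls, s). (ls, (s + 1) mod w)) line_triples"
proof (rule linked_familyI)
  show "inj_on (\<lambda>(ls, s). (ls, (s + 1) mod w)) (set line_classes \<times> {0..<w})"
    by (rule inj_onI) (auto intro: shift_mod_inj)
next
  fix u assume "u \<in> set line_classes \<times> {0..<w}"
  then obtain ls s where u: "u = (ls, s)" "ls \<in> set line_classes" by blast
  show "(case u of (ls, s) \<Rightarrow> (ls, (s + 1) mod w)) \<in> set line_classes \<times> {0..<w}"
    unfolding u(1) using u(2) mod_range by (auto simp del: atLeastLessThan_iff)
  show "parallel_class nine_points (case u of (ls, s) \<Rightarrow> line_class ls s)"
    unfolding u(1) using parallel_class_line[OF u(2)] by simp
  show "meet_once (case u of (ls, s) \<Rightarrow> line_class ls s)
      (case case u of (ls, s) \<Rightarrow> (ls, (s + 1) mod w) of (ls, s) \<Rightarrow> line_class ls s)"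
    unfolding u(1) using meet_once_line[OF u(2)] by simp
next
  fix T assume "T \<in> line_triples"
  then obtain ls L s i where "ls \<in> set line_classes" "L \<in> set ls" "s \<in> {0..<w}" "i \<in> {0..<w}"
    "T = transversal L s (2 * s) i"
    unfolding line_triples_def by auto
  moreover from this have "T \<in> line_class ls s" unfolding line_class_def by blast
  ultimately show "\<exists>u\<in>set line_classes \<times> {0..<w}. T \<in> (case u of (ls, s) \<Rightarrow> line_class ls s)"
    by (intro bexI[of _ "(ls, s)"]) auto
qed simp

end

subsection \<open>Classes with a hole\<close>

type_synonym hole_param = "bool \<times> int \<times> int \<times> int"

locale nine_fold_hole = nine_fold w for w +
  fixes v :: int and W :: nat
  assumes w_eq: "w = 3 * v" and W_eq: "int W = w"
begin

lemma odd_v: "odd v" and v_pos: "0 < v"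
  using odd_w w_ge unfolding w_eq by auto

text \<open>In a parameter \<open>(b, e, \<alpha>, \<beta>)\<close>, the flag \<open>b\<close> selects one of the two tables, \<open>e\<close> translates the residues
  modulo 3, and \<open>\<alpha>\<close> and \<open>\<beta>\<close> are the multiples of 3 added to the differences within a line.\<close>

definition hole_params :: "hole_param set" where
  "hole_params = {False} \<times> {0..2} \<times> {0..<v} \<times> {0..<v} \<union> {True} \<times> {0..2} \<times> {0..<v} \<times> half v"

definition outer_class :: "hole_param \<Rightarrow> entry \<Rightarrow> (int \<times> int) set set" where
  "outer_class = (\<lambda>(b, e, \<alpha>, \<beta>) (x, L, (r1, r2, r3), \<epsilon>).
     let s = r2 - r1 + 3 * \<alpha>; t = (if b then 2 * s + 3 * \<epsilon> * \<beta> else r3 - r1 + 3 * \<beta>)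
     in transversal L s t ` {i \<in> {0..<w}. (i - e) mod 3 = r1})"

definition local_point :: "int \<Rightarrow> nat \<Rightarrow> int \<times> int" where
  "local_point x i = (if i = W then (9, 0) else (x, int i))"

definition hole_class :: "int \<Rightarrow> hole_param \<Rightarrow> nat set set \<Rightarrow> (int \<times> int) set set" where
  "hole_class x par Q = (`) (local_point x) ` Q \<union>
     (\<Union>en\<in>{en \<in> set (entries (fst par)). fst en = x}. outer_class par en)"

lemma card_hole_params: "finite hole_params" "2 * card hole_params = W * (W - 1)"
proof -
  show "finite hole_params" unfolding hole_params_def half_def by simp
  have "card hole_params = card ({False} \<times> {0..2::int} \<times> {0..<v} \<times> {0..<v}) +
     card ({True} \<times> {0..2::int} \<times> {0..<v} \<times> half v)"
    unfolding hole_params_def by (rule card_Un_disjoint) (auto simp: half_def)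
  then have card: "card hole_params = 3 * (nat v * nat v) + 3 * (nat v * nat ((v - 1) div 2))"
    by (simp add: card_cartesian_product half_def)
  obtain n where n: "v = 2 * n + 1" using odd_v by (auto elim: oddE)
  have "0 \<le> n" using v_pos n by simp
  then have "nat v = 2 * nat n + 1" "nat ((v - 1) div 2) = nat n" "W = 3 * (2 * nat n + 1)"
    using n W_eq w_eq by auto
  then show "2 * card hole_params = W * (W - 1)"
    unfolding card by (simp add: algebra_simps)
qed

lemma shift_residue:
  assumes "(i - e) mod 3 = r" "s mod 3 = (r' - r) mod 3" "r' \<in> {0..2}"
  shows "((i + s) mod w - e) mod 3 = r'"
proof -
  have "((i + s) mod w - e) mod 3 = (i + s - e) mod 3"
    by (rule mod_diff_cong) (simp_all add: w_eq mod_mod_cancel)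
  also have "\<dots> = ((i - e) + s) mod 3" by (simp add: algebra_simps)
  also have "\<dots> = (r + (r' - r)) mod 3"
    by (rule mod_add_cong) (use assms in auto)
  also have "\<dots> = r'" using assms(3) by simp
  finally show ?thesis .
qed

lemma outer_class_transversal:
  assumes "(x, L, (r1, r2, r3), \<epsilon>) \<in> set (entries b)"
  obtains s t where "outer_class (b, e, \<alpha>, \<beta>) (x, L, (r1, r2, r3), \<epsilon>) =
      transversal L s t ` {i \<in> {0..<w}. (i - e) mod 3 = r1}"
    and "s mod 3 = (r2 - r1) mod 3" "t mod 3 = (r3 - r1) mod 3"
proof -
  let ?s = "r2 - r1 + 3 * \<alpha>"
  have "(2 * ?s + 3 * \<epsilon> * \<beta>) mod 3 = 2 * (r2 - r1) mod 3"
  proof -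
    have "2 * ?s + 3 * \<epsilon> * \<beta> = 2 * (r2 - r1) + 3 * (2 * \<alpha> + \<epsilon> * \<beta>)" by (simp add: algebra_simps)
    then show ?thesis by (simp only: mod_mult_self2)
  qed
  then have "(if b then 2 * ?s + 3 * \<epsilon> * \<beta> else r3 - r1 + 3 * \<beta>) mod 3 = (r3 - r1) mod 3"
    using entry_progression[OF assms] by auto
  then show thesis
    by (intro that[of ?s "if b then 2 * ?s + 3 * \<epsilon> * \<beta> else r3 - r1 + 3 * \<beta>"])
      (simp_all add: outer_class_def Let_def)
qed

lemma outer_class_labels:
  assumes "en \<in> set (entries b)" "B \<in> outer_class (b, e, \<alpha>, \<beta>) en" "(y, i) \<in> B"
  shows "(y, (i - e) mod 3) \<in> labels en"
proof -
  obtain x a b' c r1 r2 r3 \<epsilon> where en: "en = (x, (a, b', c), (r1, r2, r3), \<epsilon>)" by (metis prod.exhaust)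
  obtain s t where "outer_class (b, e, \<alpha>, \<beta>) en =
      transversal (a, b', c) s t ` {i \<in> {0..<w}. (i - e) mod 3 = r1}"
    and st: "s mod 3 = (r2 - r1) mod 3" "t mod 3 = (r3 - r1) mod 3"
    using outer_class_transversal[OF assms(1)[unfolded en], of e \<alpha> \<beta>, folded en] .
  then obtain j where j: "(j - e) mod 3 = r1" and B: "B = transversal (a, b', c) s t j" using assms(2) by blast
  have "r2 \<in> {0..2}" "r3 \<in> {0..2}" using entry_labels(4)[OF assms(1)] unfolding en labels_def by auto
  then have "((j + s) mod w - e) mod 3 = r2" "((j + t) mod w - e) mod 3 = r3"
    using shift_residue[OF j] st by auto
  then show ?thesis using assms(3) j unfolding B en labels_def transversal_def by auto
qed

lemma outer_class_cover:
  assumes "en \<in> set (entries b)" "i \<in> {0..<w}" "(y, (i - e) mod 3) \<in> labels en"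
  shows "(y, i) \<in> \<Union>(outer_class (b, e, \<alpha>, \<beta>) en)"
proof -
  obtain x a b' c r1 r2 r3 \<epsilon> where en: "en = (x, (a, b', c), (r1, r2, r3), \<epsilon>)" by (metis prod.exhaust)
  obtain s t where outer: "outer_class (b, e, \<alpha>, \<beta>) en =
      transversal (a, b', c) s t ` {i \<in> {0..<w}. (i - e) mod 3 = r1}"
    and st: "s mod 3 = (r2 - r1) mod 3" "t mod 3 = (r3 - r1) mod 3"
    using outer_class_transversal[OF assms(1)[unfolded en], of e \<alpha> \<beta>, folded en] .
  have r1: "r1 \<in> {0..2}" using entry_labels(4)[OF assms(1)] unfolding en labels_def by auto
  have unshift: "((i - z) mod w - e) mod 3 = r1" if "(i - e) mod 3 = r" "z mod 3 = (r - r1) mod 3" for z r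
  proof -
    have "(- z) mod 3 = (r1 - r) mod 3" using mod_minus_cong[OF that(2)] by simp
    then show ?thesis using shift_residue[OF that(1) _ r1, of "- z"] by simp
  qed
  have mem: "(y, i) \<in> \<Union>(outer_class (b, e, \<alpha>, \<beta>) en)"
    if "j \<in> {0..<w}" "(j - e) mod 3 = r1" "(y, i) \<in> transversal (a, b', c) s t j" for j
    using that unfolding outer by blast
  have returns: "((i - z) mod w + z) mod w = i" for z using assms(2) by (simp add: mod_simps)
  consider (first) "y = a" "(i - e) mod 3 = r1" | (second) "y = b'" "(i - e) mod 3 = r2" | (third) "y = c" "(i - e) mod 3 = r3"
    using assms(3) unfolding en labels_def by auto
  then show ?thesis
  proof cases
    case first
    then show ?thesis using mem[OF assms(2)] unfolding transversal_def by simp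
  next
    case second
    then show ?thesis
      using mem[OF mod_range unshift[OF second(2) st(1)]] returns unfolding transversal_def by simp
  next
    case third
    then show ?thesis
      using mem[OF mod_range unshift[OF third(2) st(2)]] returns unfolding transversal_def by simp
  qed
qed

lemma card_outer_class: "finite (outer_class par en)" "card (outer_class par en) \<le> nat v"
proof -
  obtain b e \<alpha> \<beta> where par: "par = (b, e, \<alpha>, \<beta>)" by (metis prod.exhaust)
  obtain x L r1 r2 r3 \<epsilon> where en: "en = (x, L, (r1, r2, r3), \<epsilon>)" by (metis prod.exhaust)
  let ?I = "{i \<in> {0..<w}. (i - e) mod 3 = r1}"
  obtain s t where outer: "outer_class par en = transversal L s t ` ?I"
    unfolding par en outer_class_def Let_def by auto
  have "finite ?I" by (rule finite_subset[of _ "{0..<w}"]) auto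
  then show "finite (outer_class par en)" unfolding outer by simp
  have "inj_on (\<lambda>i. i div 3) ?I"
  proof (rule inj_onI)
    fix i j assume "i \<in> ?I" "j \<in> ?I" "i div 3 = j div 3"
    moreover from this have "(i - e + e) mod 3 = (j - e + e) mod 3" by (intro mod_add_cong) auto
    then have "i mod 3 = j mod 3" by simp
    ultimately show "i = j" by (metis div_mult_mod_eq)
  qed
  moreover have "(\<lambda>i. i div 3) ` ?I \<subseteq> {0..<v}" unfolding w_eq by auto
  ultimately have "card ?I \<le> nat v" using card_inj_on_le[of _ ?I "{0..<v}"] by simp
  then show "card (outer_class par en) \<le> nat v"
    unfolding outer using card_image_le[OF \<open>finite ?I\<close>, of "transversal L s t"] by (rule order_trans[rotated])
qed

lemma outer_class_block:
  assumes "en \<in> set (entries (fst par))" "B \<in> outer_class par en"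
  shows "B \<subseteq> nine_points \<and> card B \<le> 3"
proof -
  obtain x L r1 r2 r3 \<epsilon> where en: "en = (x, L, (r1, r2, r3), \<epsilon>)" by (metis prod.exhaust)
  have "L \<in> ordered_blocks" using entry_line lines_ordered assms(1) unfolding en by blast
  then have "block_set L \<subseteq> {0..8}" unfolding ordered_blocks_def block_set_def by auto
  moreover obtain s t i where "i \<in> {0..<w}" "B = transversal L s t i"
    using assms(2) unfolding en outer_class_def Let_def by (cases par) auto
  ultimately show ?thesis using transversal_block by blast
qed

lemma local_class:
  assumes "parallel_class {..<W + 1} Q" "x \<in> {0..8}" "B \<in> (`) (local_point x) ` Q"
  shows "B \<subseteq> nine_points \<and> card B \<le> 3"
proof -
  obtain D where D: "D \<in> Q" "B = local_point x ` D" using assms(3) by blast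
  note block = parallel_class_block[OF assms(1) D(1)]
  have "local_point x i \<in> nine_points" if "i \<in> D" for i
    using block(1) assms(2) W_eq that unfolding local_point_def nine_points_def by auto
  moreover have "finite D" using block(2) by (auto intro: card_ge_0_finite)
  ultimately show ?thesis using card_image_le[of D "local_point x"] block(2) unfolding D(2) by auto
qed

lemma local_point_surj:
  assumes "p \<in> nine_points" "p = (9, 0) \<or> fst p = x"
  obtains i where "i < W + 1" "p = local_point x i"
proof (cases "p = (9, 0)")
  case True
  then show thesis using that[of W] unfolding local_point_def by simp
next
  case False
  then obtain i where i: "p = (x, i)" "0 \<le> i" "i < int W"
    using assms W_eq unfolding nine_points_def by force
  then have "nat i < W" by linarith
  then show thesis using i that[of "nat i"] unfolding local_point_def by simp
qed

lemma W_mod_3: "(W + 1) mod 3 = 1" "(W + 1) div 3 = nat v"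
proof -
  have "W = nat v * 3" using W_eq w_eq v_pos by auto
  then show "(W + 1) mod 3 = 1" "(W + 1) div 3 = nat v" by presburger+
qed

lemma card_hole_class:
  assumes "parallel_class {..<W + 1} Q" "x \<in> {0..8}"
  shows "finite (hole_class x par Q)" "card (hole_class x par Q) \<le> 3 * nat w"
proof -
  let ?row = "{en \<in> set (entries (fst par)). fst en = x}"
  have Q: "finite Q" "card Q = nat v"
    using parallel_class_finite[OF _ assms(1)] assms(1) W_mod_3 unfolding parallel_class_def by auto
  have row: "finite ?row" "card ?row \<le> 8"
    using card_length[of "filter (\<lambda>en. fst en = x) (entries (fst par))"] length_row[OF assms(2)] by simp_all
  show "finite (hole_class x par Q)"
    unfolding hole_class_def using Q row(1) card_outer_class(1) by simp
  have "card (hole_class x par Q) \<le> card ((`) (local_point x) ` Q) + card (\<Union>en\<in>?row. outer_class par en)"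
    unfolding hole_class_def by (rule card_Un_le)
  also have "\<dots> \<le> nat v + (\<Sum>en\<in>?row. card (outer_class par en))"
    using card_image_le[OF Q(1)] Q(2) card_UN_le[OF row(1)] by (intro add_mono) auto
  also have "(\<Sum>en\<in>?row. card (outer_class par en)) \<le> card ?row * nat v"
    using sum_bounded_above[of ?row "\<lambda>en. card (outer_class par en)"] card_outer_class(2) by simp
  also have "\<dots> \<le> 8 * nat v" using row(2) by (rule mult_le_mono1)
  finally show "card (hole_class x par Q) \<le> 3 * nat w" unfolding w_eq by simp
qed

lemma parallel_class_hole:
  assumes Q: "parallel_class {..<W + 1} Q" and x: "x \<in> {0..8}"
  shows "parallel_class nine_points (hole_class x par Q)"
proof -
  have "card ({..<W + 1} - \<Union>Q) = 1" using parallel_class_uncovered[OF _ Q] W_mod_3 by simp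
  then obtain y where y: "{..<W + 1} - \<Union>Q = {y}" by (auto simp: card_1_singleton_iff)
  obtain b e \<alpha> \<beta> where par: "par = (b, e, \<alpha>, \<beta>)" by (metis prod.exhaust)
  show ?thesis
  proof (rule parallel_class_nine_points[where p = "local_point x y"])
    fix B assume "B \<in> hole_class x par Q"
    then consider "B \<in> (`) (local_point x) ` Q"
      | en where "en \<in> set (entries (fst par))" "B \<in> outer_class par en"
      unfolding hole_class_def by auto
    then show "B \<subseteq> nine_points \<and> card B \<le> 3"
      by cases (use local_class[OF Q x] outer_class_block in metis)+
  next
    show "nine_points - {local_point x y} \<subseteq> \<Union>(hole_class x par Q)"
    proof
      fix p assume p: "p \<in> nine_points - {local_point x y}"
      show "p \<in> \<Union>(hole_class x par Q)"
      proof (cases "p = (9, 0) \<or> fst p = x")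
        case True
        obtain i where i: "i < W + 1" "p = local_point x i" by (rule local_point_surj[OF _ True]) (use p in auto)
        have "i \<noteq> y" using p i(2) by auto
        then have "i \<notin> {..<W + 1} - \<Union>Q" unfolding y by simp
        then have "i \<in> \<Union>Q" using i(1) by simp
        then show ?thesis unfolding i(2) hole_class_def by blast
      next
        case False
        then obtain c i where ci: "p = (c, i)" "c \<in> {0..8}" "i \<in> {0..<w}" "c \<noteq> x"
          using p unfolding nine_points_def by auto
        have "(i - e) mod 3 \<in> {0..2}" by simp
        then obtain en where en: "en \<in> set (entries b)" "fst en = x" "(c, (i - e) mod 3) \<in> labels en"
          using entry_with_label[OF x ci(2,4)] by blast
        obtain B where "B \<in> outer_class par en" "p \<in> B"
          using outer_class_cover[OF en(1) ci(3) en(3)] unfolding ci(1) par by blast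
        moreover from this(1) have "B \<in> hole_class x par Q"
          unfolding hole_class_def by (intro UnI2 UN_I[of en]) (use en par in simp_all)
        ultimately show ?thesis by blast
      qed
    qed
  qed (rule card_hole_class[OF Q x])+
qed

lemma meet_once_local_outer:
  assumes "en \<in> set (entries (fst par))"
  shows "meet_once (outer_class par en) ((`) (local_point x) ` Q)"
proof (rule meet_once_if_columns)
  obtain b e \<alpha> \<beta> where par: "par = (b, e, \<alpha>, \<beta>)" by (metis prod.exhaust)
  note labels = outer_class_labels[of en b _ e \<alpha> \<beta>]
  fix B assume B: "B \<in> outer_class par en"
  show "fst ` B \<subseteq> {0..8}"
  proof (rule image_subsetI)
    fix p assume "p \<in> B"
    then have "(fst p, (snd p - e) mod 3) \<in> labels en" using labels assms B unfolding par by simp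
    then show "fst p \<in> {0..8}" using entry_labels(2)[OF assms] by blast
  qed
next
  show "fst ` C \<subseteq> {9, x}" if "C \<in> (`) (local_point x) ` Q" for C
    using that unfolding local_point_def by auto
  show "{0..8} \<inter> {9, x} \<subseteq> {x}" by auto
  fix B p q assume "B \<in> outer_class par en" "p \<in> B" "q \<in> B" "fst p = x" "fst q = x"
  moreover obtain x' L r1 r2 r3 \<epsilon> where en: "en = (x', L, (r1, r2, r3), \<epsilon>)" by (metis prod.exhaust)
  moreover have "L \<in> ordered_blocks" using entry_line lines_ordered assms unfolding en by blast
  ultimately show "p = q"
    unfolding outer_class_def ordered_blocks_def transversal_def Let_def by (cases par) auto
qed

lemma meet_once_outer:
  assumes "en \<in> set (entries (fst par))" "en' \<in> set (entries (fst par))" "fst en' = (fst en + 3) mod 9"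
  shows "meet_once (outer_class par en) (outer_class par en')"
proof (rule meet_onceI)
  obtain b e \<alpha> \<beta> where par: "par = (b, e, \<alpha>, \<beta>)" by (metis prod.exhaust)
  fix B C p q assume BC: "B \<in> outer_class par en" "C \<in> outer_class par en'"
    and pq: "p \<in> B" "p \<in> C" "q \<in> B" "q \<in> C"
  define lab where "lab r = (fst r, (snd r - e) mod 3)" for r :: "int \<times> int"
  have "lab r \<in> labels en" if "r \<in> B" for r
    using outer_class_labels assms(1) BC(1) that unfolding lab_def par by simp
  moreover have "lab r \<in> labels en'" if "r \<in> C" for r
    using outer_class_labels assms(2) BC(2) that unfolding lab_def par by simp
  ultimately have "lab p = lab q"
    using meet_once_labels[of en b en'] assms pq unfolding par by simp
  then have "fst p = fst q" unfolding lab_def by simp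
  obtain x' L r1 r2 r3 \<epsilon> where en: "en = (x', L, (r1, r2, r3), \<epsilon>)" by (metis prod.exhaust)
  have "L \<in> ordered_blocks" using entry_line lines_ordered assms(1) unfolding en by blast
  then show "p = q"
    using BC(1) pq(1,3) \<open>fst p = fst q\<close>
    unfolding en outer_class_def ordered_blocks_def transversal_def Let_def par by auto
qed

lemma meet_once_hole:
  assumes x: "x \<in> {0..8}"
  shows "meet_once (hole_class x par Q) (hole_class ((x + 3) mod 9) par Q)"
proof -
  let ?x' = "(x + 3) mod 9"
  have "?x' \<noteq> x" using x unfolding atLeastAtMost_iff by presburger
  then have "meet_once ((`) (local_point x) ` Q) ((`) (local_point ?x') ` Q)"
    by (intro meet_once_if_columns[where L = "{9, x}" and M = "{9, ?x'}" and z = 9])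
      (use x in \<open>auto simp: local_point_def split: if_splits\<close>)
  moreover have "meet_once ((`) (local_point x) ` Q) (outer_class par en)"
    "meet_once (outer_class par en) ((`) (local_point ?x') ` Q)" if "en \<in> set (entries (fst par))" for en
    using meet_once_local_outer[OF that] meet_once_commute by blast+
  moreover have "meet_once (outer_class par en) (outer_class par en')"
    if "en \<in> {en \<in> set (entries (fst par)). fst en = x}"
      "en' \<in> {en \<in> set (entries (fst par)). fst en = ?x'}" for en en'
    using meet_once_outer that by auto
  ultimately show ?thesis
    unfolding hole_class_def meet_once_Un meet_once_UN by blast
qed

definition skew_triples :: "(int \<times> int) set set" where
  "skew_triples = {T. \<exists>L\<in>set lines. \<exists>s\<in>{0..<w}. \<exists>t\<in>{0..<w}. \<exists>i\<in>{0..<w}.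
     t \<noteq> 2 * s mod w \<and> T = transversal L s t i}"

lemma triple_mod_w: "3 * (z mod v) = 3 * z mod w"
  unfolding w_eq by (rule mult_mod_right)

lemma add_multiple_of_3:
  assumes "r mod 3 = z mod 3"
  shows "\<exists>\<alpha>\<in>{0..<v}. (r + 3 * \<alpha>) mod w = z mod w"
proof
  have "3 dvd z - r" using assms by (metis mod_eq_dvd_iff)
  then have "3 * ((z - r) div 3) = z - r" by simp
  then show "(r + 3 * ((z - r) div 3 mod v)) mod w = z mod w"
    unfolding triple_mod_w by (simp add: mod_add_right_eq)
qed (use v_pos in simp)

lemma add_signed_multiple_of_3:
  assumes "z mod 3 = r mod 3" "z mod w \<noteq> r mod w"
  shows "\<exists>\<epsilon>\<in>{- 1, 1}. \<exists>\<beta>\<in>half v. (r + 3 * \<epsilon> * \<beta>) mod w = z mod w"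
proof -
  define k where "k = (z - r) div 3"
  have "3 dvd z - r" using assms(1) by (simp add: mod_eq_dvd_iff)
  then have k: "3 * k = z - r" unfolding k_def by simp
  have "k mod v \<noteq> 0"
  proof
    assume "k mod v = 0"
    then have "(z - r) mod w = 0" using triple_mod_w[of k] unfolding k by simp
    then show False using assms(2) by (simp add: mod_eq_dvd_iff mod_eq_0_iff_dvd)
  qed
  then obtain \<beta> where \<beta>: "\<beta> \<in> half v" "k mod v = \<beta> mod v \<or> k mod v = (- \<beta>) mod v"
    using half_difference[OF odd_v, of "k mod v" 0] v_pos by auto
  have solution: "(r + 3 * x) mod w = z mod w" if "k mod v = x mod v" for x
  proof -
    have "3 * x mod w = (z - r) mod w" unfolding triple_mod_w[symmetric] that[symmetric] using triple_mod_w[of k] k by simp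
    then have "(r + 3 * x) mod w = (r + (z - r)) mod w" by (rule mod_add_cong[OF refl])
    then show ?thesis by simp
  qed
  show ?thesis
    using \<beta> solution[of \<beta>] solution[of "- \<beta>"]
    by (intro bexI[of _ "if k mod v = \<beta> mod v then 1 else - 1"] bexI[of _ \<beta>]) auto
qed

lemma outer_classI:
  assumes en: "(x, L, (r1, r2, r3), \<epsilon>) \<in> set (entries b)" and i: "i \<in> {0..<w}"
    and s: "(r2 - r1 + 3 * \<alpha>) mod w = s mod w"
    and t: "(if b then 2 * (r2 - r1 + 3 * \<alpha>) + 3 * \<epsilon> * \<beta> else r3 - r1 + 3 * \<beta>) mod w = t mod w"
  shows "transversal L s t i \<in> outer_class (b, (i - r1) mod 3, \<alpha>, \<beta>) (x, L, (r1, r2, r3), \<epsilon>)"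
proof -
  obtain a b' c where L: "L = (a, b', c)" by (cases L)
  have "r1 \<in> {0..2}" using entry_labels(4)[OF en, of a r1] unfolding L labels_def by simp
  then have "(i - (i - r1) mod 3) mod 3 = r1" by (simp add: mod_diff_right_eq)
  then show ?thesis
    using i transversal_cong[OF s t, of L] unfolding outer_class_def Let_def by auto
qed

lemma skew_triples_covered:
  assumes "T \<in> skew_triples"
  shows "\<exists>par\<in>hole_params. \<exists>en\<in>set (entries (fst par)). T \<in> outer_class par en"
proof -
  obtain L s t i where L: "L \<in> set lines" and i: "i \<in> {0..<w}" and t: "t mod w \<noteq> 2 * s mod w"
    and T: "T = transversal L s t i"
    using assms unfolding skew_triples_def by force
  have residue: "z mod 3 \<in> {0..2}" for z :: int by simp
  show ?thesis
  proof (cases "t mod 3 = 2 * s mod 3")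
    case False
    then have "t mod 3 \<noteq> 2 * (s mod 3) mod 3" by (simp add: mod_mult_right_eq)
    then obtain x r1 r2 r3 \<epsilon> where en: "(x, L, (r1, r2, r3), \<epsilon>) \<in> set (entries False)"
      and r: "(r2 - r1) mod 3 = s mod 3" "(r3 - r1) mod 3 = t mod 3"
      using generic_entry[OF L residue residue] unfolding entries_def if_False by blast
    obtain \<alpha> \<beta> where "\<alpha> \<in> {0..<v}" "(r2 - r1 + 3 * \<alpha>) mod w = s mod w"
      and "\<beta> \<in> {0..<v}" "(r3 - r1 + 3 * \<beta>) mod w = t mod w"
      using add_multiple_of_3[OF r(1)] add_multiple_of_3[OF r(2)] by blast
    then have "(False, (i - r1) mod 3, \<alpha>, \<beta>) \<in> hole_params"
      and "T \<in> outer_class (False, (i - r1) mod 3, \<alpha>, \<beta>) (x, L, (r1, r2, r3), \<epsilon>)"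
      unfolding hole_params_def T using outer_classI[OF en i] by auto
    then show ?thesis using en by (metis fst_conv)
  next
    case True
    then obtain \<epsilon> \<beta> where \<epsilon>: "\<epsilon> \<in> {- 1, 1}" and \<beta>: "\<beta> \<in> half v" "(2 * s + 3 * \<epsilon> * \<beta>) mod w = t mod w"
      using add_signed_multiple_of_3[OF True t] by blast
    obtain x r1 r2 r3 where en: "(x, L, (r1, r2, r3), \<epsilon>) \<in> set (entries True)" and r: "(r2 - r1) mod 3 = s mod 3"
      using progression_entry[OF L residue \<epsilon>] unfolding entries_def if_True by blast
    obtain \<alpha> where \<alpha>: "\<alpha> \<in> {0..<v}" "(r2 - r1 + 3 * \<alpha>) mod w = s mod w"
      using add_multiple_of_3[OF r] by blast
    have "(2 * (r2 - r1 + 3 * \<alpha>) + 3 * \<epsilon> * \<beta>) mod w = (2 * s + 3 * \<epsilon> * \<beta>) mod w"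
      by (intro mod_add_cong mod_mult_cong refl \<alpha>(2))
    then have "(2 * (r2 - r1 + 3 * \<alpha>) + 3 * \<epsilon> * \<beta>) mod w = t mod w" using \<beta>(2) by simp
    then have "(True, (i - r1) mod 3, \<alpha>, \<beta>) \<in> hole_params"
      and "T \<in> outer_class (True, (i - r1) mod 3, \<alpha>, \<beta>) (x, L, (r1, r2, r3), \<epsilon>)"
      unfolding hole_params_def T using outer_classI[OF en i \<alpha>(2)] \<alpha>(1) \<beta>(1) by auto
    then show ?thesis using en by (metis fst_conv)
  qed
qed

lemma hole_linked:
  assumes Q: "\<And>par. par \<in> hole_params \<Longrightarrow> parallel_class {..<W + 1} (Q par)"
  shows "linked nine_points (9 * card hole_params)
    ({T. \<exists>x\<in>{0..8}. \<exists>par\<in>hole_params. T \<in> (`) (local_point x) ` Q par} \<union> skew_triples)"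
proof (rule linkedI)
  let ?I = "{0..8::int} \<times> hole_params" and ?s = "\<lambda>(x, par). ((x + 3) mod 9 :: int, par)"
  show "card ?I \<le> 9 * card hole_params" by (simp add: card_cartesian_product)
  show "linked_family nine_points ?I (\<lambda>(x, par). hole_class x par (Q par)) ?s
      ({T. \<exists>x\<in>{0..8}. \<exists>par\<in>hole_params. T \<in> (`) (local_point x) ` Q par} \<union> skew_triples)"
  proof (rule linked_familyI)
    show "finite ?I" using card_hole_params(1) by simp
    have "x = y" if "x \<in> {0..8}" "y \<in> {0..8}" "(x + 3) mod 9 = (y + 3) mod 9" for x y :: int
    proof -
      have "x mod 9 = y mod 9" using that(3) by (simp add: mod_eq_dvd_iff)
      then show ?thesis using that(1,2) by simp
    qed
    then show "inj_on ?s ?I" by (intro inj_onI) (auto simp del: atLeastAtMost_iff)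
    fix u assume "u \<in> ?I"
    then obtain x par where u: "u = (x, par)" "x \<in> {0..8}" "par \<in> hole_params" by blast
    then show "?s u \<in> ?I" by auto
    show "parallel_class nine_points (case u of (x, par) \<Rightarrow> hole_class x par (Q par))"
      using parallel_class_hole[OF Q] u by simp
    show "meet_once (case u of (x, par) \<Rightarrow> hole_class x par (Q par))
        (case ?s u of (x, par) \<Rightarrow> hole_class x par (Q par))"
      using meet_once_hole u by simp
  next
    fix T assume "T \<in> {T. \<exists>x\<in>{0..8}. \<exists>par\<in>hole_params. T \<in> (`) (local_point x) ` Q par} \<union> skew_triples"
    then consider (local) x par where "x \<in> {0..8}" "par \<in> hole_params" "T \<in> (`) (local_point x) ` Q par"
      | (outer) par en where "par \<in> hole_params" "en \<in> set (entries (fst par))" "T \<in> outer_class par en"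
      using skew_triples_covered by blast
    then show "\<exists>u\<in>?I. T \<in> (case u of (x, par) \<Rightarrow> hole_class x par (Q par))"
    proof cases
      case local
      then show ?thesis unfolding hole_class_def by (intro bexI[of _ "(x, par)"]) auto
    next
      case outer
      obtain y r where "(y, r) \<in> labels en" unfolding labels_def by (cases en) auto
      then have "fst en \<in> {0..8}" using entry_labels(1) outer(2) by blast
      moreover have "T \<in> hole_class (fst en) par (Q par)"
        unfolding hole_class_def using outer by (intro UnI2 UN_I[of en]) simp_all
      ultimately show ?thesis using outer(1) by (intro bexI[of _ "(fst en, par)"]) auto
    qed
  qed
qed

subsection \<open>The nine-fold theorem\<close>

definition copies :: "nat set set \<Rightarrow> (int \<times> int) set set" where
  "copies Q = (\<Union>x\<in>{0..8}. (`) (local_point x) ` Q)"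

lemma parallel_class_copies:
  assumes Q: "parallel_class {..<W + 1} Q" and "W \<notin> \<Union>Q"
  shows "parallel_class nine_points (copies Q)"
proof (rule parallel_class_nine_points[where p = "(9, 0)"])
  have fin: "finite Q" "card Q = nat v"
    using parallel_class_finite[OF _ Q] Q W_mod_3 unfolding parallel_class_def by auto
  then show "finite (copies Q)" unfolding copies_def by simp
  have "card (copies Q) \<le> (\<Sum>x\<in>{0..8::int}. card ((`) (local_point x) ` Q))"
    unfolding copies_def by (rule card_UN_le) simp
  also have "\<dots> \<le> (\<Sum>x\<in>{0..8::int}. nat v)"
    using card_image_le[OF fin(1)] fin(2) by (intro sum_mono) simp
  finally show "card (copies Q) \<le> 3 * nat w" unfolding w_eq by simp
  show "B \<subseteq> nine_points \<and> card B \<le> 3" if "B \<in> copies Q" for B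
    using that local_class[OF Q] unfolding copies_def by blast
  show "nine_points - {(9, 0)} \<subseteq> \<Union>(copies Q)"
  proof
    fix p assume p: "p \<in> nine_points - {(9, 0)}"
    then have x: "fst p \<in> {0..8}" unfolding nine_points_def by auto
    obtain i where i: "i < W + 1" "p = local_point (fst p) i"
      by (rule local_point_surj[of p "fst p"]) (use p in auto)
    then have "i \<noteq> W" using p unfolding local_point_def by auto
    have "card ({..<W + 1} - \<Union>Q) = 1" using parallel_class_uncovered[OF _ Q] W_mod_3 by simp
    then obtain y where y: "{..<W + 1} - \<Union>Q = {y}" by (auto simp: card_1_singleton_iff)
    moreover have "W \<in> {..<W + 1} - \<Union>Q" using assms(2) by simp
    ultimately have "i \<notin> {..<W + 1} - \<Union>Q" using \<open>i \<noteq> W\<close> by auto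
    then obtain B where "B \<in> Q" "i \<in> B" using i(1) by auto
    then have "p \<in> local_point (fst p) ` B" "local_point (fst p) ` B \<in> copies Q"
      using i(2) x unfolding copies_def by blast+
    then show "p \<in> \<Union>(copies Q)" by blast
  qed
qed

lemma meet_once_line_copies:
  assumes ls: "ls \<in> set line_classes" and "W \<notin> \<Union>Q"
  shows "meet_once (line_class ls s) (copies Q)"
proof (rule meet_onceI)
  fix B C p q assume B: "B \<in> line_class ls s" and C: "C \<in> copies Q"
    and pq: "p \<in> B" "p \<in> C" "q \<in> B" "q \<in> C"
  obtain x D where "D \<in> Q" "C = local_point x ` D" using C unfolding copies_def by blast
  then have "fst r = x" if "r \<in> C" for r using that assms(2) unfolding local_point_def by auto
  then have "fst p = fst q" using pq by simp
  obtain L i where L: "L \<in> set ls" "B = transversal L s (2 * s) i" using B unfolding line_class_def by blast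
  have "L \<in> ordered_blocks" using L(1) ls lines_ordered by auto
  then show "p = q"
    using pq(1,3) \<open>fst p = fst q\<close> unfolding L(2) transversal_def ordered_blocks_def by auto
qed

lemma lines_and_copies_linked:
  assumes J: "finite J" "card J \<le> 4 * nat w"
    and Q: "\<And>j. j \<in> J \<Longrightarrow> parallel_class {..<W + 1} (Q j) \<and> W \<notin> \<Union>(Q j)"
  shows "linked nine_points (4 * nat w + card J) (line_triples \<union> (\<Union>j\<in>J. copies (Q j)))"
proof -
  let ?I = "set line_classes \<times> {0..<w}"
  have I: "card ?I = 4 * nat w" by (simp add: card_cartesian_product card_line_classes)
  then obtain h where h: "h ` J \<subseteq> ?I" "inj_on h J"
    using card_le_inj[of J ?I] J by (metis List.finite_set finite_atLeastLessThan_int finite_cartesian_product)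
  have meet: "meet_once (case u of (ls, s) \<Rightarrow> line_class ls s) (copies (Q j))" if "j \<in> J" "fst u \<in> set line_classes" for u j
    using meet_once_line_copies Q[OF that(1)] that(2) by (cases u) simp
  show ?thesis
    unfolding I[symmetric]
  proof (rule linked_insert[OF line_linked_family J(1) _ h(2)])
    fix j assume j: "j \<in> J"
    show "parallel_class nine_points (copies (Q j))" using parallel_class_copies Q[OF j] by blast
    show "h j \<in> ?I" using h(1) j by blast
    then have "fst (h j) \<in> set line_classes" by auto
    then show "meet_once (case h j of (ls, s) \<Rightarrow> line_class ls s) (copies (Q j))" by (rule meet[OF j])
    show "meet_once (copies (Q j)) (case case h j of (ls, s) \<Rightarrow> (ls, (s + 1) mod w) of (ls, s) \<Rightarrow> line_class ls s)"
      using meet[OF j, of "(fst (h j), (snd (h j) + 1) mod w)"] \<open>fst (h j) \<in> set line_classes\<close>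
      by (simp add: case_prod_unfold meet_once_commute)
  qed
qed

lemma local_triple:
  assumes T: "T \<in> triples nine_points" and x: "\<And>p. p \<in> T \<Longrightarrow> p = (9, 0) \<or> fst p = x" "x \<in> {0..8}"
  shows "\<exists>B\<in>triples {..<W + 1}. T = local_point x ` B"
proof -
  define B where "B = {i \<in> {..<W + 1}. local_point x i \<in> T}"
  have image: "T = local_point x ` B"
  proof
    show "T \<subseteq> local_point x ` B"
    proof
      fix p assume p: "p \<in> T"
      then have "p \<in> nine_points" using T unfolding triples_def by blast
      then obtain i where "i < W + 1" "p = local_point x i" using local_point_surj x(1)[OF p] by metis
      then show "p \<in> local_point x ` B" using p unfolding B_def by blast
    qed
  qed (auto simp: B_def)
  have "inj_on (local_point x) B" using x(2) unfolding inj_on_def local_point_def by auto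
  then have "card B = 3" using T card_image unfolding image triples_def by fastforce
  then have "B \<in> triples {..<W + 1}" unfolding triples_def B_def by auto
  then show ?thesis using image by blast
qed

lemma transversals_subset:
  "transversals ordered_blocks \<subseteq> transversals (ordered_blocks - set lines) \<union> line_triples \<union> skew_triples"
proof
  fix T assume "T \<in> transversals ordered_blocks"
  then obtain L s t i where L: "L \<in> ordered_blocks" and r: "s \<in> {0..<w}" "t \<in> {0..<w}" "i \<in> {0..<w}"
    and T: "T = transversal L s t i"
    unfolding transversals_def by blast
  consider (no_line) "L \<notin> set lines" | (progression) "L \<in> set lines" "t = 2 * s mod w" | (skew) "L \<in> set lines" "t \<noteq> 2 * s mod w" by blast
  then show "T \<in> transversals (ordered_blocks - set lines) \<union> line_triples \<union> skew_triples"
  proof cases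
    case no_line
    then show ?thesis using L r T unfolding transversals_def by blast
  next
    case progression
    have "T = transversal L s (2 * s) i"
      unfolding T using transversal_cong[of s s t "2 * s" L] progression(2) by simp
    then show ?thesis using progression(1) r unfolding line_triples_def by blast
  next
    case skew
    then show ?thesis using r T unfolding skew_triples_def by blast
  qed
qed

lemma transversal_triple:
  assumes T: "T \<in> triples nine_points" "inj_on fst T"
  shows "T \<in> apex_triples \<union> transversals ordered_blocks"
proof -
  have card: "card T = 3" and sub: "T \<subseteq> nine_points" using T(1) unfolding triples_def by auto
  have "card (fst ` T) = 3" using card_image[OF T(2)] card by simp
  then obtain a b c where abc: "fst ` T = {a, b, c}" "a < b" "b < c" by (rule card_3_sorted)
  have "\<exists>i. (u, i) \<in> T" if "u \<in> fst ` T" for u using that by auto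
  then obtain i j k where pts: "(a, i) \<in> T" "(b, j) \<in> T" "(c, k) \<in> T"
    using abc(1) by (metis insertCI)
  then have Teq: "T = {(a, i), (b, j), (c, k)}"
    using abc card by (intro card_subset_eq[symmetric] card_ge_0_finite) auto
  show ?thesis
  proof (cases "c = 9")
    case True
    then have "T = {(9, 0), (a, i), (b, j)}" using sub pts(3) unfolding Teq nine_points_def by auto
    moreover have "a \<in> {0..8}" "b \<in> {0..8}" "i \<in> {0..<w}" "j \<in> {0..<w}"
      using sub pts(1,2) abc True unfolding nine_points_def by auto
    ultimately show ?thesis using less_imp_neq[OF abc(2)] unfolding apex_triples_def by blast
  next
    case False
    then have r: "0 \<le> a" "c \<le> 8" "i \<in> {0..<w}" "j \<in> {0..<w}" "k \<in> {0..<w}"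
      using sub pts abc w_ge unfolding nine_points_def by auto
    have "(i + (j - i) mod w) mod w = j" "(i + (k - i) mod w) mod w = k"
      using r by (simp_all add: mod_add_right_eq)
    then have "T = transversal (a, b, c) ((j - i) mod w) ((k - i) mod w) i"
      unfolding Teq transversal_def by simp
    moreover have "(a, b, c) \<in> ordered_blocks" using r abc unfolding ordered_blocks_def by simp
    ultimately show ?thesis using r(3) mod_range unfolding transversals_def by blast
  qed
qed

lemma nine_triples_cases:
  assumes T: "T \<in> triples nine_points"
  shows "T \<in> apex_triples \<union> split_triples \<union> transversals ordered_blocks \<or>
    (\<exists>x\<in>{0..8}. \<exists>B\<in>triples {..<W + 1}. T = local_point x ` B)"
proof -
  have card: "card T = 3" and sub: "T \<subseteq> nine_points" using T unfolding triples_def by auto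
  have column_9: "p = (9, 0)" if "p \<in> T" "fst p = 9" for p
    using that sub unfolding nine_points_def by auto
  from card show ?thesis
  proof (cases rule: card_3_fst_cases)
    case transversal
    then show ?thesis using transversal_triple[OF T] by blast
  next
    case (vertical x)
    have "x \<noteq> 9"
    proof
      assume "x = 9"
      then have "T \<subseteq> {(9, 0)}" using vertical column_9 by auto
      then show False using card card_mono[of "{(9, 0)}" T] by simp
    qed
    moreover have "T \<noteq> {}" using card by auto
    ultimately have "x \<in> {0..8}" using vertical sub unfolding nine_points_def by fastforce
    then show ?thesis using local_triple[OF T, of x] vertical by fastforce
  next
    case (split a x p q j)
    then have a: "a \<in> {0..8}" "p \<in> {0..<w}" "q \<in> {0..<w}"
      using sub column_9[of "(a, p)"] column_9[of "(a, q)"] unfolding nine_points_def by auto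
    show ?thesis
    proof (cases "x = 9")
      case True
      then have "(x, j) = (9, 0)" using column_9[of "(x, j)"] split(3) by simp
      then have "r = (9, 0) \<or> fst r = a" if "r \<in> T" for r using that split(3) by auto
      then show ?thesis using local_triple[OF T _ a(1)] a(1) by blast
    next
      case False
      then have "x \<in> {0..8}" "j \<in> {0..<w}" using sub split(3) unfolding nine_points_def by auto
      then show ?thesis using a split unfolding split_triples_def by blast
    qed
  qed
qed

lemma nine_fold_linked:
  assumes L: "linked_family {..<W + 1} I P s (triples {..<W + 1})"
    and J: "J \<subseteq> I" "\<And>i. i \<in> I - J \<Longrightarrow> W \<notin> \<Union>(P i)"
    and card: "card J = card hole_params" "card (I - J) \<le> 4 * nat w"
  shows "linked nine_points (36 * (nat w * nat w) + (4 * nat w + card (I - J)) + 9 * card hole_params)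
    (triples nine_points)"
proof -
  note family = linked_familyD[OF L]
  obtain h where h: "bij_betw h hole_params J"
    using finite_same_card_bij[OF card_hole_params(1) finite_subset[OF J(1) family(1)]] card(1) by auto
  then have h_image: "h ` hole_params = J" by (rule bij_betw_imp_surj_on)
  let ?lines = "line_triples \<union> (\<Union>i\<in>I - J. copies (P i))"
  let ?holes = "{T. \<exists>x\<in>{0..8}. \<exists>par\<in>hole_params. T \<in> (`) (local_point x) ` P (h par)} \<union> skew_triples"
  have lines: "linked nine_points (4 * nat w + card (I - J)) ?lines"
    by (rule lines_and_copies_linked) (use family(1,5) J(2) card(2) in auto)
  have holes: "linked nine_points (9 * card hole_params) ?holes"
    by (rule hole_linked[of "\<lambda>par. P (h par)"]) (use family(5) h_image J(1) in blast)
  have local_triples: "local_point x ` B \<in> ?lines \<union> ?holes" if x: "x \<in> {0..8}" and B: "B \<in> triples {..<W + 1}" for x B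
  proof -
    obtain i where i: "i \<in> I" "B \<in> P i" using family(7)[OF B] by blast
    show ?thesis
    proof (cases "i \<in> J")
      case True
      then obtain par where "par \<in> hole_params" "h par = i" using h_image by blast
      then show ?thesis using x i(2) by blast
    next
      case False
      then show ?thesis using x i unfolding copies_def by blast
    qed
  qed
  have "triples nine_points \<subseteq>
      (apex_triples \<union> split_triples \<union> transversals (ordered_blocks - set lines)) \<union> ?lines \<union> ?holes"
  proof
    fix T assume "T \<in> triples nine_points"
    then consider (covered) "T \<in> apex_triples \<union> split_triples" | (transversal) "T \<in> transversals ordered_blocks"
      | (local) x B where "x \<in> {0..8}" "B \<in> triples {..<W + 1}" "T = local_point x ` B"
      using nine_triples_cases[of T] by blast
    then show "T \<in> (apex_triples \<union> split_triples \<union> transversals (ordered_blocks - set lines)) \<union> ?lines \<union> ?holes"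
    proof cases
      case transversal
      then show ?thesis using subsetD[OF transversals_subset] by blast
    next
      case local
      then show ?thesis using local_triples[OF local(1,2)] by blast
    qed blast
  qed
  then show ?thesis by (rule linked_mono[OF linked_Un[OF linked_Un[OF near_linked lines] holes]])
qed

end

lemma card_triples_through:
  assumes "finite X" "p \<in> X"
  shows "card {B \<in> triples X. p \<in> B} = (card X - 1) choose 2"
proof -
  have "{B \<in> triples X. p \<in> B} = triples X - triples (X - {p})" unfolding triples_def by auto
  moreover have "triples (X - {p}) \<subseteq> triples X" unfolding triples_def by blast
  ultimately have "card {B \<in> triples X. p \<in> B} = (card X choose 3) - ((card X - 1) choose 3)"
    using assms card_Diff_subset[OF finite_triples, of "X - {p}" "triples X"] by (simp add: card_triples)
  moreover obtain m where "card X = Suc m" using assms by (cases "card X") auto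
  ultimately show ?thesis by (simp add: eval_nat_numeral)
qed

lemma card_classes_through:
  assumes L: "linked_family X I P s (triples X)" and X: "finite X" "p \<in> X"
    and unique: "\<And>i j B. i \<in> I \<Longrightarrow> j \<in> I \<Longrightarrow> B \<in> P i \<Longrightarrow> B \<in> P j \<Longrightarrow> i = j"
  shows "card {i \<in> I. p \<in> \<Union>(P i)} = (card X - 1) choose 2"
proof -
  note family = linked_familyD[OF L]
  let ?J = "{i \<in> I. p \<in> \<Union>(P i)}" and ?through = "\<lambda>i. {B \<in> P i. p \<in> B}"
  have single: "finite (?through i) \<and> card (?through i) = 1" if i: "i \<in> ?J" for i
  proof -
    obtain B where B: "B \<in> P i" "p \<in> B" using i by blast
    have "parallel_class X (P i)" using i family(5) by blast
    then have "?through i = {B}" using parallel_class_unique[of X "P i" _ B] B by blast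
    then show ?thesis by simp
  qed
  have blocks: "B \<in> triples X" if "i \<in> I" "B \<in> P i" for i B
    using parallel_class_triples[OF family(5)] that .
  have "{B \<in> triples X. p \<in> B} = (\<Union>i\<in>?J. ?through i)"
  proof
    show "{B \<in> triples X. p \<in> B} \<subseteq> (\<Union>i\<in>?J. ?through i)"
    proof
      fix B assume B: "B \<in> {B \<in> triples X. p \<in> B}"
      then obtain i where "i \<in> I" "B \<in> P i" using family(7)[of B] by blast
      then show "B \<in> (\<Union>i\<in>?J. ?through i)" using B by blast
    qed
  qed (auto simp: blocks)
  moreover have "card (\<Union>i\<in>?J. ?through i) = (\<Sum>i\<in>?J. card (?through i))"
    using family(1) single unique by (intro card_UN_disjoint) auto
  ultimately show ?thesis using single card_triples_through[OF X] by simp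
qed

theorem resolved_nine:
  assumes res: "resolved (W + 1)" and W: "W mod 6 = 3" "9 \<le> W"
  shows "resolved (9 * W + 1)"
proof -
  have W3: "3 * (W div 3) = W" "(W + 1) div 3 = W div 3" "odd W" using W(1) by presburger+
  interpret nine_fold_hole "int W" "int (W div 3)" W
    by unfold_locales (use W(2) W3 in \<open>simp_all flip: of_nat_mult\<close>)
  obtain I :: "nat set" and P s where L: "linked_family {..<W + 1} I P s (triples {..<W + 1})"
    and count: "6 * (card I * (W div 3)) \<le> (W + 1) * W * (W - 1)"
    and unique: "\<And>i j B. i \<in> I \<Longrightarrow> j \<in> I \<Longrightarrow> B \<in> P i \<Longrightarrow> B \<in> P j \<Longrightarrow> i = j"
    using resolvedE[OF res] W3(2) by (metis add_diff_cancel_right' diff_diff_add one_add_one)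
  define J where "J = {i \<in> I. W \<in> \<Union>(P i)}"
  have J: "J \<subseteq> I" "finite I" unfolding J_def using linked_familyD(1)[OF L] by auto
  have "card J = W choose 2" unfolding J_def using card_classes_through[OF L _ _ unique, of W] by simp
  then have cardJ: "2 * card J = W * (W - 1)"
    using times_binomial_minus1_eq[of 2 W] by (simp add: numeral_2_eq_2)
  have "W * (2 * card I) = 3 * (W div 3) * (2 * card I)" unfolding W3(1) ..
  also have "\<dots> = 6 * (card I * (W div 3))" by simp
  also have "\<dots> \<le> W * ((W + 1) * (W - 1))" using count by (simp only: ac_simps)
  finally have "2 * card I \<le> W * (W - 1) + (W - 1)" using W(2) by simp
  moreover have "card (I - J) = card I - card J" using J finite_subset by (intro card_Diff_subset) auto
  ultimately have rest: "2 * card (I - J) \<le> W - 1"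
    using cardJ by linarith
  let ?M = "36 * (W * W) + (4 * W + card (I - J)) + 9 * card hole_params"
  have linked: "linked nine_points ?M (triples nine_points)"
    using nine_fold_linked[OF L J(1)] cardJ card_hole_params(2) rest unfolding J_def by auto
  obtain u where u: "W = Suc u" using W(2) by (cases W) auto
  have "2 * ?M = 72 * (W * W) + 8 * W + 2 * card (I - J) + 9 * (2 * card hole_params)" by simp
  also have "\<dots> \<le> (9 * W + 1) * (9 * W - 1)"
    using rest unfolding card_hole_params(2) by (simp add: u algebra_simps)
  finally have bound: "2 * ?M \<le> (9 * W + 1) * (9 * W - 1)" .
  have "(9 * W + 1) div 3 = 3 * W" by presburger
  then have "6 * (?M * ((9 * W + 1) div 3)) = 2 * ?M * (9 * W)" by simp
  also have "\<dots> \<le> (9 * W + 1) * (9 * W - 1) * (9 * W)" using bound by (rule mult_le_mono1)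
  also have "\<dots> = (9 * W + 1) * (9 * W + 1 - 1) * (9 * W + 1 - 2)" by (simp add: u)
  finally show ?thesis
    by (rule resolvedI[OF linked finite_nine_points, rotated]) (simp add: card_nine_points)
qed

section \<open>The theorem\<close>

lemma resolved_power_3:
  assumes "resolved n" "odd n" "n mod 3 = 0" "3 \<le> n"
  shows "resolved (3 ^ k * n)"
proof (induction k)
  case (Suc k)
  have "odd (3 ^ k * n)" "3 ^ k * n mod 3 = 0" using assms by auto
  moreover have "1 * 3 \<le> 3 ^ k * n" using assms(4) by (intro mult_le_mono) simp_all
  ultimately show ?case using resolved_triple[OF Suc] by (simp add: mult.assoc)
qed (use assms in simp)

lemma resolved_power_9:
  assumes "resolved (n + 1)" "n mod 6 = 3" "9 \<le> n"
  shows "resolved (9 ^ k * n + 1)"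
proof (induction k)
  case (Suc k)
  have "9 ^ k * n mod 6 = 3"
  proof (induction k)
    case (Suc k)
    have "9 * (9 ^ k * n) mod 6 = 9 * (9 ^ k * n mod 6) mod 6" by (rule mod_mult_right_eq[symmetric])
    then show ?case using Suc by (simp add: mult.assoc)
  qed (use assms in simp)
  moreover have "1 * 9 \<le> 9 ^ k * n" using assms(3) by (intro mult_le_mono) simp_all
  ultimately show ?case using resolved_nine[OF Suc] by (simp add: mult.assoc)
qed (use assms in simp)

lemma mod_6_eq_3_less_100:
  fixes a :: nat
  assumes "a mod 6 = 3" "a < 100"
  shows "a \<in> {3, 9, 15, 21, 27, 33, 39, 45, 51, 57, 63, 69, 75, 81, 87, 93, 99}"
proof -
  have "a = 6 * (a div 6) + 3" using assms(1) by presburger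
  moreover have "a div 6 \<in> {..<17}" using assms(2) by auto
  ultimately have "a \<in> (\<lambda>q. 6 * q + 3) ` {..<17}" by blast
  then show ?thesis by (simp add: lessThan_nat_numeral lessThan_Suc) blast
qed

lemma resolved_base:
  assumes "a mod 6 = 3" "a < 100" "a \<notin> {3, 57, 87, 93}"
  shows "resolved a"
proof -
  have "resolved 27" "resolved 81" "resolved 45" "resolved 63" "resolved 99"
    using resolved_power_3[OF resolved_9, of 1] resolved_power_3[OF resolved_9, of 2]
      resolved_power_3[OF resolved_15, of 1] resolved_power_3[OF resolved_21, of 1]
      resolved_power_3[OF resolved_33, of 1]
    by simp_all
  then show ?thesis
    using mod_6_eq_3_less_100[OF assms(1,2)] assms(3) resolved_9 resolved_15 resolved_21 resolved_33
      resolved_39 resolved_51 resolved_69 resolved_75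
    by auto
qed

lemma resolved_base_plus_1:
  assumes "a mod 6 = 3" "a < 100" "a \<notin> {51, 69, 75}"
  shows "a mod 12 = 9 \<Longrightarrow> resolved (a + 1)" "a mod 12 = 3 \<Longrightarrow> resolved (3 * a + 1)"
proof -
  have nine: "resolved 82" "resolved 190" "resolved 298"
    using resolved_nine[of 9] resolved_nine[of 21] resolved_nine[of 33] resolved_10 resolved_22 resolved_34
    by simp_all
  note a = mod_6_eq_3_less_100[OF assms(1,2)]
  show "resolved (a + 1)" if "a mod 12 = 9"
    using a that assms(3) nine resolved_10 resolved_22 resolved_34 resolved_46 resolved_58 resolved_94 by auto
  show "resolved (3 * a + 1)" if "a mod 12 = 3"
    using a that assms(3) nine resolved_10 resolved_46 resolved_118 resolved_262 by auto
qed

lemma resolved_power_3_base: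
  assumes "a mod 6 = 3" "a < 100" "a \<notin> {57, 87, 93}" "a mod 12 = 3 \<Longrightarrow> odd m"
  shows "resolved (3 ^ m * a)"
proof (cases "a = 3")
  case True
  then obtain k where "m = Suc k" using assms(4) by (cases m) auto
  then show ?thesis using resolved_power_3[OF resolved_9, of k] True by (simp add: mult.commute)
next
  case False
  have "odd a" "a mod 3 = 0" "3 \<le> a" using assms(1) by presburger+
  then show ?thesis using resolved_power_3 resolved_base[OF assms(1,2)] assms(3) False by simp
qed

lemma resolved_power_3_base_plus_1:
  assumes "a mod 6 = 3" "a < 100" "a \<notin> {51, 69, 75}"
    and "a mod 12 = 3 \<Longrightarrow> odd m" "a mod 12 = 9 \<Longrightarrow> even m"
  shows "resolved (3 ^ m * a + 1)"
proof (cases "a mod 12 = 3")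
  case True
  then obtain k where "m = 2 * k + 1" using assms(4) by (blast elim: oddE)
  then have "3 ^ m * a = 9 ^ k * (3 * a)" by (simp add: power_mult)
  moreover have "3 * a mod 6 = 3" "9 \<le> 3 * a" using assms(1) by presburger+
  ultimately show ?thesis
    using resolved_power_9[OF resolved_base_plus_1(2)[OF assms(1-3) True], of k] by (simp only:)
next
  case False
  then have a: "a mod 12 = 9" "9 \<le> a" using assms(1) by presburger+
  then obtain k where "m = 2 * k" using assms(5) by (blast elim: evenE)
  then have "3 ^ m * a = 9 ^ k * a" by (simp add: power_mult)
  then show ?thesis
    using resolved_power_9[OF resolved_base_plus_1(1)[OF assms(1-3) a(1)] assms(1) a(2), of k] by (simp only:)
qed

theorem theorem4p11:
  fixes a m :: nat
  assumes "a > 0" and "a mod 6 = 3" and "a < 100"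
    and "a mod 12 = 3 \<Longrightarrow> odd m"
    and "a mod 12 = 9 \<Longrightarrow> even m"
  shows "(a \<notin> {57, 87, 93} \<longrightarrow> TOC_exists 3 (3 ^ m * a) 5 3)
       \<and> (a \<notin> {51, 69, 75} \<longrightarrow> TOC_exists 3 (3 ^ m * a + 1) 5 3)"
proof (intro conjI impI)
  have "a mod 3 = 0" "3 \<le> a" using assms(2) by presburger+
  then have "3 ^ m * a mod 3 = 0" "1 * 3 \<le> 3 ^ m * a" by (auto intro: mult_le_mono)
  then have n: "3 ^ m * a mod 3 \<noteq> 2" "3 \<le> 3 ^ m * a" "(3 ^ m * a + 1) mod 3 \<noteq> 2" "3 \<le> 3 ^ m * a + 1"
    by presburger+
  show "TOC_exists 3 (3 ^ m * a) 5 3" if "a \<notin> {57, 87, 93}"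
    using resolved_imp_TOC_exists[OF resolved_power_3_base[OF assms(2,3) that assms(4)] n(2,1)] .
  show "TOC_exists 3 (3 ^ m * a + 1) 5 3" if "a \<notin> {51, 69, 75}"
    using resolved_imp_TOC_exists[OF resolved_power_3_base_plus_1[OF assms(2,3) that assms(4,5)] n(4,3)] .
qed

end
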